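(* Let $\Omega\subset\mathbb{R}^d$ be bounded and of positive Lebesgue measure, $\lambda>0$, $(\mathbb{X},\rho)=(\mathcal P_2(\Omega),W_2)$ with a Borel probability measure $\mu$, and $\mathcal M=\mathcal P_2^{ac}(\Omega)$ with the total variation distance $\vartheta$. Let $l(\phi,\psi)=\frac12W_2^2(\phi,\psi)$ and take as regularization $\lambda\mathcal R$ with $\mathcal R$ the negative entropy. Then the assumptions (A1)–(A5) listed in the context are satisfied with $\mathcal J_0=+\infty$, $\beta=2$, $\tau=2$, $\alpha=1$, $a=4\,\mathrm{diam}(\Omega)^2$, $\|a\|_{\psi_1}=4\,\mathrm{diam}(\Omega)^2$, $\eta=0$, $\kappa=0$ and $\iota=0$.
   Context: $\Omega$ carries the Euclidean distance. $\mathcal P_2(\Omega)$ is the set of Borel probability measures on $\Omega$ with finite second moment, endowed with the Wasserstein distance $W_2^2(\phi,\psi)=\inf_\pi\mathbb{E}_{(X,Y)\sim\pi}\|X-Y\|_2^2$, the infimum being over couplings of $\phi$ and $\psi$. $\mathcal P_2^{ac}(\Omega)$ is the subset of measures absolutely continuous with respect to the Lebesgue measure; $\vartheta(\phi,\psi)=\frac12\|\phi-\psi\|_1$ (half the $L^1$ distance of densities). $\mathcal R(\phi)=\int_\Omega f\log f\,dx$ if $\phi=f\,dx$, $+\infty$ otherwise. Notation. The risk is $\mathcal J(\phi)=\mathbb{E}_{X\sim\mu}[l(\phi,X)]+\lambda\mathcal R(\phi)$; for $\mathbf{x}\in\mathbb{X}^n$ the empirical risk is $\widehat{\mathcal J}_{\mathbf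 x}(\phi)=\frac1n\sum_{i=1}^nl(\phi,x_i)+\lambda\mathcal R(\phi)$, both on $\mathcal M$. $\mathcal S=\arg\min\mathcal J$, $\mathcal J_*=\min\mathcal J$, $\widehat{\mathcal S}_{\mathbf x}=\arg\min\widehat{\mathcal J}_{\mathbf x}$, $\widehat{\mathcal J}_{\mathbf x,*}=\min\widehat{\mathcal J}_{\mathbf x}$. $\vartheta(\phi,E)=\inf_{\psi\in E}\vartheta(\phi,\psi)$; $[\mathcal J\le c]=\{\phi:\mathcal J(\phi)\le c\}$. $\|Z\|_{\psi_1}=\inf\{c>0:\mathbb{E}\exp(|Z|/c)\le2\}$, and for a pseudometric $a$ on $\mathbb{X}$ (metric axioms except $a(x,y)=0\Rightarrow x=y$), $\|a\|_{\psi_1}:=\|a(X,Y)\|_{\psi_1}$ with $X,Y\sim\mu$ independent. $\mathbf{X}=(X_1,\dots,X_n)$ has i.i.d. components of law $\mu$. Assumptions. (A1) $\mathcal J$ is proper and has at least one minimizer; for all $n\ge1$ and $\mu^n$-almost every $\mathbf{x}$, $\widehat{\mathcal J}_{\mathbf x}$ is proper with at least one minimizer, and its minimizers are measurable functions of $\mathbf{x}$ (the measurability is taken for granted). (A2) $\mathcal J_0\in(\mathcal J_*,+\infty]$, $\beta\ge1$, $\tau>0$, and $\phi\in[\mathcal J\le\mathcal J_0]$ implies $\tau\,\vartheta(\phi,\mathcal S)^\beta\le\mathcal J(\phi)-\mathcal J_*$. (A3) $\eta:\mathbb{N}\to[0,1]$, $\lim_n\eta(n)=0$ and $\mathbb{P}(\sup_{\widehat\phi\in\widehat{\mathcal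 S}_{\mathbf X}}\mathcal J(\widehat\phi)>\mathcal J_0)\le\eta(n)$. (A4) With $\widehat\tau_{\mathbf x}=\inf_{\mathbf y\in\mathrm{supp}(\mu)^n}\inf\left\{\frac{\widehat{\mathcal J}_{\mathbf x}(\phi)-\widehat{\mathcal J}_{\mathbf x,*}}{\vartheta(\phi,\widehat{\mathcal S}_{\mathbf x})^\beta}:\phi\in[\mathcal J\le\mathcal J_0]\cap\widehat{\mathcal S}_{\mathbf y}\right\}$ (points with $\vartheta(\phi,\widehat{\mathcal S}_{\mathbf x})=0$ disregarded), $\kappa:\mathbb{N}\to[0,1]$, $\lim_n\kappa(n)=0$ and $\mathbb{P}(\widehat\tau_{\mathbf X}<\tau/2)\le\kappa(n)$. (A5) $\alpha>0$, $a$ is a pseudometric on $\mathbb{X}$ with $\|a\|_{\psi_1}<\infty$, and there is $\Upsilon\subseteq\mathcal M$ with $\mathcal S\subseteq\Upsilon$ such that for all $\phi,\psi\in\Upsilon$ and $\mu$-almost every $x,y$, $l(\phi,x)-l(\psi,x)-l(\phi,y)+l(\psi,y)\le a(x,y)\,\vartheta(\phi,\psi)^\alpha$; moreover $\iota:\mathbb{N}\to[0,1]$, $\lim_n\iota(n)=0$ and $\mathbb{P}(\widehat{\mathcal S}_{\mathbf X}\not\subset\Upsilon)\le\iota(n)$.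
   Formalization: τ=2 fails for λ<1; proved with τ=2λ for all λ>0, and τ=2 for λ≥1. a is 4diam(Ω)² off the diagonal, 0 on it; its norm is 4diam(Ω)²/ln(1+1/p), p=P(X≠Y) (0 if p=0), not 4diam(Ω)²; (A5) also holds with a=4 ln2 diam(Ω)², whose norm is ≤4diam(Ω)². *)

theory Defs
  imports "HOL-Probability.Probability"
begin

section \<open>Generalities\<close>

definition metric_borel :: "'x set \<Rightarrow> ('x \<Rightarrow> 'x \<Rightarrow> real) \<Rightarrow> 'x measure" where
  "metric_borel X d = sigma X {U. openin (Metric_space.mtopology X d) U}"

text \<open>Lebesgue integral with values in the extended reals: positive part minus negative part.
  In all uses below one of the two parts is finite.\<close>

definition ext_integral :: "'x measure \<Rightarrow> ('x \<Rightarrow> real) \<Rightarrow> ereal" where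
  "ext_integral M f =
     enn2ereal (\<integral>\<^sup>+x. ennreal (f x) \<partial>M) - enn2ereal (\<integral>\<^sup>+x. ennreal (- f x) \<partial>M)"

text \<open>A bound on the probability of an event without a separate measurability requirement:
  the event lies in a measurable one of probability at most \<open>c\<close>. For measurable events this is
  \<open>measure M E \<le> c\<close>; writing just that would hold vacuously for nonmeasurable \<open>E\<close>.\<close>

definition prob_at_most :: "'x measure \<Rightarrow> 'x set \<Rightarrow> real \<Rightarrow> bool" where
  "prob_at_most M E c \<longleftrightarrow> (\<exists>A\<in>sets M. E \<subseteq> A \<and> measure M A \<le> c)"

definition psi1_norm :: "'w measure \<Rightarrow> ('w \<Rightarrow> real) \<Rightarrow> ereal" where
  "psi1_norm M Z = (INF c\<in>{c. 0 < c \<and> (\<integral>\<^sup>+w. ennreal (exp (\<bar>Z w\<bar> / c)) \<partial>M) \<le> 2}. ereal c)"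

definition pseudometric_on :: "'x set \<Rightarrow> ('x \<Rightarrow> 'x \<Rightarrow> real) \<Rightarrow> bool" where
  "pseudometric_on X a \<longleftrightarrow>
     (\<forall>x\<in>X. a x x = 0) \<and>
     (\<forall>x\<in>X. \<forall>y\<in>X. 0 \<le> a x y \<and> a x y = a y x) \<and>
     (\<forall>x\<in>X. \<forall>y\<in>X. \<forall>z\<in>X. a x z \<le> a x y + a y z)"

text \<open>The pseudometric "constantly \<open>c\<close>": a pseudometric vanishes on the diagonal.\<close>

definition const_pseudometric :: "real \<Rightarrow> 'x \<Rightarrow> 'x \<Rightarrow> real" where
  "const_pseudometric c x y = (if x = y then 0 else c)"

definition vanishing_rate :: "(nat \<Rightarrow> real) \<Rightarrow> bool" where
  "vanishing_rate r \<longleftrightarrow> (\<forall>n. 0 \<le> r n \<and> r n \<le> 1) \<and> r \<longlonglongrightarrow> 0"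


section \<open>Regularized risk minimization\<close>

text \<open>Data space \<open>X\<close> with metric \<open>\<rho>\<close> and law \<open>\<mu>\<close>, model space \<open>Mod\<close> with metric \<open>\<theta>\<close>, loss \<open>l\<close>,
  regularizer \<open>lam * R\<close>. Samples of size \<open>n\<close> are indexed by \<open>{..<n}\<close>.\<close>

locale risk_minimization =
  fixes X :: "'x set" and \<rho> :: "'x \<Rightarrow> 'x \<Rightarrow> real" and \<mu> :: "'x measure"
    and Mod :: "'m set" and \<theta> :: "'m \<Rightarrow> 'm \<Rightarrow> real"
    and l :: "'m \<Rightarrow> 'x \<Rightarrow> real" and lam :: real and R :: "'m \<Rightarrow> ereal"
begin

definition sample_law :: "nat \<Rightarrow> (nat \<Rightarrow> 'x) measure" where
  "sample_law n = PiM {..<n} (\<lambda>_. \<mu>)"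

definition supp :: "'x set" where
  "supp = {x\<in>X. \<forall>U. openin (Metric_space.mtopology X \<rho>) U \<and> x \<in> U \<longrightarrow> 0 < emeasure \<mu> U}"

definition risk :: "'m \<Rightarrow> ereal" where
  "risk \<phi> = ext_integral \<mu> (l \<phi>) + ereal lam * R \<phi>"

definition emp_risk :: "nat \<Rightarrow> (nat \<Rightarrow> 'x) \<Rightarrow> 'm \<Rightarrow> ereal" where
  "emp_risk n x \<phi> = ereal ((\<Sum>i<n. l \<phi> (x i)) / real n) + ereal lam * R \<phi>"

definition proper :: "('m \<Rightarrow> ereal) \<Rightarrow> bool" where
  "proper F \<longleftrightarrow> (\<forall>\<phi>\<in>Mod. F \<phi> \<noteq> -\<infinity>) \<and> (\<exists>\<phi>\<in>Mod. F \<phi> \<noteq> \<infinity>)"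

definition minimizers :: "('m \<Rightarrow> ereal) \<Rightarrow> 'm set" where
  "minimizers F = {\<phi>\<in>Mod. \<forall>\<psi>\<in>Mod. F \<phi> \<le> F \<psi>}"

definition min_value :: "('m \<Rightarrow> ereal) \<Rightarrow> ereal" where
  "min_value F = (INF \<phi>\<in>Mod. F \<phi>)"

text \<open>Only meaningful for nonempty \<open>E\<close>; below \<open>E\<close> is a set of minimizers, nonempty
  (almost surely) by \<open>A1\<close>.\<close>

definition set_dist :: "'m \<Rightarrow> 'm set \<Rightarrow> real" where
  "set_dist \<phi> E = (INF \<psi>\<in>E. \<theta> \<phi> \<psi>)"

definition tau_hat :: "ereal \<Rightarrow> real \<Rightarrow> nat \<Rightarrow> (nat \<Rightarrow> 'x) \<Rightarrow> ereal" where
  "tau_hat J0 \<beta> n x =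
     (INF y\<in>(\<Pi>\<^sub>E i\<in>{..<n}. supp).
        INF \<phi>\<in>{\<phi>\<in>minimizers (emp_risk n y).
                 risk \<phi> \<le> J0 \<and> set_dist \<phi> (minimizers (emp_risk n x)) \<noteq> 0}.
          (emp_risk n x \<phi> - min_value (emp_risk n x)) /
          ereal (set_dist \<phi> (minimizers (emp_risk n x)) powr \<beta>))"

text \<open>Measurability of the empirical minimizers: there is a measurable selection with respect
  to the Borel sigma-algebra of the metric of the model space.\<close>

definition A1 :: bool where
  "A1 \<longleftrightarrow>
     proper risk \<and> minimizers risk \<noteq> {} \<and>
     (\<forall>n\<ge>1.
        (AE x in sample_law n. proper (emp_risk n x) \<and> minimizers (emp_risk n x) \<noteq> {}) \<and>
        (\<exists>T \<in> measurable (sample_law n) (metric_borel Mod \<theta>).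
           AE x in sample_law n. T x \<in> minimizers (emp_risk n x)))"

definition A2 :: "ereal \<Rightarrow> real \<Rightarrow> real \<Rightarrow> bool" where
  "A2 J0 \<beta> \<tau> \<longleftrightarrow>
     min_value risk < J0 \<and> 1 \<le> \<beta> \<and> 0 < \<tau> \<and>
     (\<forall>\<phi>\<in>Mod. risk \<phi> \<le> J0 \<longrightarrow>
        ereal (\<tau> * set_dist \<phi> (minimizers risk) powr \<beta>) \<le> risk \<phi> - min_value risk)"

definition A3 :: "ereal \<Rightarrow> (nat \<Rightarrow> real) \<Rightarrow> bool" where
  "A3 J0 \<eta> \<longleftrightarrow>
     vanishing_rate \<eta> \<and>
     (\<forall>n\<ge>1. prob_at_most (sample_law n)
        {x \<in> space (sample_law n). (SUP \<phi>\<in>minimizers (emp_risk n x). risk \<phi>) > J0} (\<eta> n))"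

definition A4 :: "ereal \<Rightarrow> real \<Rightarrow> real \<Rightarrow> (nat \<Rightarrow> real) \<Rightarrow> bool" where
  "A4 J0 \<beta> \<tau> \<kappa> \<longleftrightarrow>
     vanishing_rate \<kappa> \<and>
     (\<forall>n\<ge>1. prob_at_most (sample_law n)
        {x \<in> space (sample_law n). tau_hat J0 \<beta> n x < ereal (\<tau> / 2)} (\<kappa> n))"

text \<open>\<open>\<parallel>a(X,Y)\<parallel>\<close> for independent \<open>X, Y\<close> of law \<open>\<mu>\<close>.\<close>

definition pm_norm :: "('x \<Rightarrow> 'x \<Rightarrow> real) \<Rightarrow> ereal" where
  "pm_norm a = psi1_norm (\<mu> \<Otimes>\<^sub>M \<mu>) (\<lambda>(x, y). a x y)"

definition A5 :: "real \<Rightarrow> ('x \<Rightarrow> 'x \<Rightarrow> real) \<Rightarrow> (nat \<Rightarrow> real) \<Rightarrow> bool" where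
  "A5 \<alpha> a \<iota> \<longleftrightarrow>
     0 < \<alpha> \<and> pseudometric_on X a \<and>
     (\<lambda>(x, y). a x y) \<in> borel_measurable (\<mu> \<Otimes>\<^sub>M \<mu>) \<and> pm_norm a < \<infinity> \<and>
     vanishing_rate \<iota> \<and>
     (\<exists>\<Upsilon>\<subseteq>Mod. minimizers risk \<subseteq> \<Upsilon> \<and>
        (\<forall>\<phi>\<in>\<Upsilon>. \<forall>\<psi>\<in>\<Upsilon>. AE x in \<mu>. AE y in \<mu>.
           l \<phi> x - l \<psi> x - l \<phi> y + l \<psi> y \<le> a x y * \<theta> \<phi> \<psi> powr \<alpha>) \<and>
        (\<forall>n\<ge>1. prob_at_most (sample_law n)
           {x \<in> space (sample_law n). \<not> minimizers (emp_risk n x) \<subseteq> \<Upsilon>} (\<iota> n)))"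

definition assumptions ::
  "ereal \<Rightarrow> real \<Rightarrow> real \<Rightarrow> real \<Rightarrow> ('x \<Rightarrow> 'x \<Rightarrow> real) \<Rightarrow>
   (nat \<Rightarrow> real) \<Rightarrow> (nat \<Rightarrow> real) \<Rightarrow> (nat \<Rightarrow> real) \<Rightarrow> bool" where
  "assumptions J0 \<beta> \<tau> \<alpha> a \<eta> \<kappa> \<iota> \<longleftrightarrow>
     A1 \<and> A2 J0 \<beta> \<tau> \<and> A3 J0 \<eta> \<and> A4 J0 \<beta> \<tau> \<kappa> \<and> A5 \<alpha> a \<iota>"

end


section \<open>Wasserstein space, total variation and entropy\<close>

definition P2 :: "(real ^ 'n) set \<Rightarrow> (real ^ 'n) measure set" where
  "P2 \<Omega> = {\<phi>. prob_space \<phi> \<and> sets \<phi> = sets (restrict_space borel \<Omega>) \<and>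
               integrable \<phi> (\<lambda>x. (norm x)\<^sup>2)}"

definition couplings :: "'a measure \<Rightarrow> 'b measure \<Rightarrow> ('a \<times> 'b) measure set" where
  "couplings \<phi> \<psi> = {\<pi>. sets \<pi> = sets (\<phi> \<Otimes>\<^sub>M \<psi>) \<and> distr \<pi> \<phi> fst = \<phi> \<and> distr \<pi> \<psi> snd = \<psi>}"

definition W2 :: "(real ^ 'n) measure \<Rightarrow> (real ^ 'n) measure \<Rightarrow> real" where
  "W2 \<phi> \<psi> = sqrt (enn2real
     (INF \<pi>\<in>couplings \<phi> \<psi>. \<integral>\<^sup>+z. ennreal ((norm (fst z - snd z))\<^sup>2) \<partial>\<pi>))"

text \<open>Lebesgue measure on the Borel sets of \<open>\<Omega>\<close>; for Borel \<open>\<Omega>\<close> this is \<open>restrict_space lborel \<Omega>\<close>,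
  but \<open>\<Omega>\<close> may be any Lebesgue measurable set.\<close>

definition leb :: "(real ^ 'n) set \<Rightarrow> (real ^ 'n) measure" where
  "leb \<Omega> = restr_to_subalg (lebesgue_on \<Omega>) (restrict_space borel \<Omega>)"

definition P2ac :: "(real ^ 'n) set \<Rightarrow> (real ^ 'n) measure set" where
  "P2ac \<Omega> = {\<phi>\<in>P2 \<Omega>. absolutely_continuous (leb \<Omega>) \<phi>}"

definition dens :: "(real ^ 'n) set \<Rightarrow> (real ^ 'n) measure \<Rightarrow> real ^ 'n \<Rightarrow> real" where
  "dens \<Omega> \<phi> x = enn2real (RN_deriv (leb \<Omega>) \<phi> x)"

definition tv :: "(real ^ 'n) set \<Rightarrow> (real ^ 'n) measure \<Rightarrow> (real ^ 'n) measure \<Rightarrow> real" where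
  "tv \<Omega> \<phi> \<psi> = (\<integral>x. \<bar>dens \<Omega> \<phi> x - dens \<Omega> \<psi> x\<bar> \<partial>leb \<Omega>) / 2"

text \<open>Note \<open>ln 0 = 0\<close>, so \<open>0 * ln 0 = 0\<close> as required.\<close>

definition neg_entropy :: "(real ^ 'n) set \<Rightarrow> (real ^ 'n) measure \<Rightarrow> ereal" where
  "neg_entropy \<Omega> \<phi> =
     (if absolutely_continuous (leb \<Omega>) \<phi>
      then ext_integral (leb \<Omega>) (\<lambda>x. dens \<Omega> \<phi> x * ln (dens \<Omega> \<phi> x)) else \<infinity>)"

definition W2_loss :: "(real ^ 'n) measure \<Rightarrow> (real ^ 'n) measure \<Rightarrow> real" where
  "W2_loss \<phi> \<psi> = (W2 \<phi> \<psi>)\<^sup>2 / 2"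

abbreviation barycenter_assumptions where
  "barycenter_assumptions \<Omega> lam \<mu> \<equiv>
     risk_minimization.assumptions (P2 \<Omega>) W2 \<mu> (P2ac \<Omega>) (tv \<Omega>) W2_loss lam (neg_entropy \<Omega>)"

abbreviation barycenter_A5 where
  "barycenter_A5 \<Omega> lam \<mu> \<equiv>
     risk_minimization.A5 (P2 \<Omega>) \<mu> (P2ac \<Omega>) (tv \<Omega>) W2_loss lam (neg_entropy \<Omega>)"

end

theory Submission
  imports Defs
begin

text \<open>Both risks have the form \<open>F + lam * R\<close>, where the loss term \<open>F\<close> is convex along mixtures of densities
  and Lipschitz in total variation, and where the entropy is strongly convex with respect to the \<open>L\<^sup>1\<close>
  norm by Pinsker's inequality. Hence minimizing sequences are Cauchy in \<open>L\<^sup>1\<close>, there is exactly one minimizer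
  \<open>\<phi>\<close>, and the risk exceeds its minimum at \<open>\<psi>\<close> by at least \<open>2 * lam * tv \<psi> \<phi>\<^sup>2\<close>. This growth
  gives A2 and A4, and it makes the minimizer of the empirical risk depend continuously on the sample, hence
  measurably, as the Wasserstein space is totally bounded. The Lipschitz bound for the loss gives A5: replacing
  \<open>\<phi>\<close> by \<open>\<psi>\<close> in a coupling moves mass \<open>tv \<phi> \<psi>\<close> at a cost of at most the squared diameter each.\<close>

section \<open>Couplings on a bounded domain\<close>

text \<open>The constant \<open>2 * lam\<close> comes from Pinsker: the negative entropy has strong
  convexity modulus 1 in the L1 norm, so the risk grows by \<open>lam / 2\<close> times the squared
  L1 distance, and that distance is \<open>2 * tv\<close>. This is why \<open>\<tau> = 2\<close> is
  claimed only for \<open>1 \<le> lam\<close>. The law \<open>\<mu>\<close> lives on the Borel sets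
  of the topology of \<open>W2\<close>, so \<open>W2\<close> has to be shown to be a metric first.
  Samples carry the product sigma-algebra, which is built from boxes; second countability, supplied
  by total boundedness, places the open sets of samples and the complement of the diagonal in it.
  Existence of optimal couplings is avoided: near-optimal ones are glued, mixed or partly
  redirected, and the slack tends to 0. A coupling is produced each time as the joint law of two
  maps on an auxiliary space.\<close>

lemma distr_eqI_nn_integral:
  assumes S: "S \<in> measurable Q \<phi>"
    and eq: "\<And>A. A \<in> sets \<phi> \<Longrightarrow> (\<integral>\<^sup>+q. indicator A (S q) \<partial>Q) = emeasure \<phi> A"
  shows "distr Q \<phi> S = \<phi>"
proof (rule measure_eqI)
  fix A assume "A \<in> sets (distr Q \<phi> S)"
  then have A: "A \<in> sets \<phi>" by simp
  have "emeasure (distr Q \<phi> S) A = (\<integral>\<^sup>+x. indicator A x \<partial>distr Q \<phi> S)"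
    using A by simp
  also have "\<dots> = (\<integral>\<^sup>+q. indicator A (S q) \<partial>Q)"
    using S A by (intro nn_integral_distr) auto
  finally show "emeasure (distr Q \<phi> S) A = emeasure \<phi> A" using eq[OF A] by simp
qed simp

definition transport_cost :: "('a::real_normed_vector \<times> 'a) measure \<Rightarrow> ennreal" where
  "transport_cost \<pi> = (\<integral>\<^sup>+z. ennreal ((norm (fst z - snd z))\<^sup>2) \<partial>\<pi>)"

text \<open>Couplings are built below on larger spaces, such as a product of two couplings or a
  coupling with an additional coin; the two maps extract the pair of interest.\<close>

lemma coupling_distr:
  assumes T: "T1 \<in> measurable Q \<phi>" "T2 \<in> measurable Q \<psi>"
    and d: "distr Q \<phi> T1 = \<phi>" "distr Q \<psi> T2 = \<psi>"
  shows "distr Q (\<phi> \<Otimes>\<^sub>M \<psi>) (\<lambda>q. (T1 q, T2 q)) \<in> couplings \<phi> \<psi>"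
proof -
  note T[measurable]
  have "distr (distr Q (\<phi> \<Otimes>\<^sub>M \<psi>) (\<lambda>q. (T1 q, T2 q))) \<phi> fst = distr Q \<phi> T1"
    by (subst distr_distr) (auto simp: comp_def)
  moreover have "distr (distr Q (\<phi> \<Otimes>\<^sub>M \<psi>) (\<lambda>q. (T1 q, T2 q))) \<psi> snd = distr Q \<psi> T2"
    by (subst distr_distr) (auto simp: comp_def)
  ultimately show ?thesis using d by (simp add: couplings_def)
qed

locale bounded_domain =
  fixes \<Omega> :: "(real ^ 'n) set"
  assumes bounded: "bounded \<Omega>"
begin

abbreviation "borel_on \<equiv> restrict_space borel \<Omega>"

lemma dist_le_diameter: "x \<in> \<Omega> \<Longrightarrow> y \<in> \<Omega> \<Longrightarrow> norm (x - y) \<le> diameter \<Omega>"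
  using diameter_bounded_bound[OF bounded] by (simp add: dist_norm)

lemma diameter_nonneg: "0 \<le> diameter \<Omega>"
  using diameter_ge_0[OF bounded] .

lemma P2_sets: "\<phi> \<in> P2 \<Omega> \<Longrightarrow> sets \<phi> = sets borel_on"
  by (simp add: P2_def)

lemma P2_space: "\<phi> \<in> P2 \<Omega> \<Longrightarrow> space \<phi> = \<Omega>"
  using sets_eq_imp_space_eq[OF P2_sets] by (simp add: space_restrict_space)

lemma P2_prob: "\<phi> \<in> P2 \<Omega> \<Longrightarrow> prob_space \<phi>"
  by (simp add: P2_def)

lemma measurable_id_borel: "(\<lambda>x. x) \<in> borel_on \<rightarrow>\<^sub>M borel"
  by (simp add: measurable_restrict_space1)

text \<open>Boundedness of \<open>\<Omega>\<close> makes the second moment finite, so only the total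
  mass and the sigma-algebra remain to be checked.\<close>

lemma P2I:
  assumes "prob_space \<phi>" "sets \<phi> = sets borel_on"
  shows "\<phi> \<in> P2 \<Omega>"
proof -
  interpret prob_space \<phi> by fact
  have [simp]: "space \<phi> = \<Omega>" using sets_eq_imp_space_eq[OF assms(2)] by (simp add: space_restrict_space)
  obtain b where b: "\<And>x. x \<in> \<Omega> \<Longrightarrow> norm x \<le> b" using bounded by (auto simp: bounded_iff)
  have m: "(\<lambda>x. x) \<in> borel_measurable \<phi>"
    using measurable_id_borel measurable_cong_sets[OF assms(2) refl] by blast
  have "integrable \<phi> (\<lambda>x. (norm x)\<^sup>2)"
    by (rule integrable_const_bound[of _ "b\<^sup>2"]) (use m b in \<open>auto intro!: power_mono\<close>)
  then show ?thesis using assms by (simp add: P2_def)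
qed

lemma coupling_sets:
  assumes "\<pi> \<in> couplings \<phi> \<psi>" "\<phi> \<in> P2 \<Omega>" "\<psi> \<in> P2 \<Omega>"
  shows "sets \<pi> = sets (borel_on \<Otimes>\<^sub>M borel_on)"
  using sets_pair_measure_cong[OF P2_sets[OF assms(2)] P2_sets[OF assms(3)]] assms(1)
  unfolding couplings_def by blast

lemma coupling_space:
  assumes "\<pi> \<in> couplings \<phi> \<psi>" "\<phi> \<in> P2 \<Omega>" "\<psi> \<in> P2 \<Omega>"
  shows "space \<pi> = \<Omega> \<times> \<Omega>"
  using sets_eq_imp_space_eq[OF coupling_sets[OF assms]]
  by (simp add: space_pair_measure space_restrict_space)

lemma coupling_mem:
  assumes "\<pi> \<in> couplings \<phi> \<psi>" "\<phi> \<in> P2 \<Omega>" "\<psi> \<in> P2 \<Omega>" "z \<in> space \<pi>"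
  shows "fst z \<in> \<Omega>" "snd z \<in> \<Omega>"
  using assms(4) unfolding coupling_space[OF assms(1-3)] mem_Times_iff by blast+

lemma coupling_prob:
  assumes "\<pi> \<in> couplings \<phi> \<psi>" "\<phi> \<in> P2 \<Omega>" "\<psi> \<in> P2 \<Omega>"
  shows "prob_space \<pi>"
proof -
  have "fst \<in> measurable \<pi> \<phi>"
    using assms(1) measurable_cong_sets[of \<pi> "\<phi> \<Otimes>\<^sub>M \<psi>" \<phi> \<phi>] by (auto simp: couplings_def)
  then show ?thesis
    using prob_space_distrD[of fst \<pi> \<phi>] assms P2_prob by (simp add: couplings_def)
qed

lemma coupling_measurable:
  assumes "\<pi> \<in> couplings \<phi> \<psi>"
  shows "fst \<in> measurable \<pi> \<phi>" "snd \<in> measurable \<pi> \<psi>"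
  using assms measurable_cong_sets[of \<pi> "\<phi> \<Otimes>\<^sub>M \<psi>"] by (auto simp: couplings_def)

lemma coupling_nn_integral:
  assumes "\<pi> \<in> couplings \<phi> \<psi>"
  shows "f \<in> borel_measurable \<phi> \<Longrightarrow> (\<integral>\<^sup>+z. f (fst z) \<partial>\<pi>) = (\<integral>\<^sup>+x. f x \<partial>\<phi>)"
    and "g \<in> borel_measurable \<psi> \<Longrightarrow> (\<integral>\<^sup>+z. g (snd z) \<partial>\<pi>) = (\<integral>\<^sup>+x. g x \<partial>\<psi>)"
proof -
  have d: "distr \<pi> \<phi> fst = \<phi>" "distr \<pi> \<psi> snd = \<psi>" using assms by (auto simp: couplings_def)
  show "f \<in> borel_measurable \<phi> \<Longrightarrow> (\<integral>\<^sup>+z. f (fst z) \<partial>\<pi>) = (\<integral>\<^sup>+x. f x \<partial>\<phi>)"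
    using nn_integral_distr[OF coupling_measurable(1)[OF assms], of f] d by simp
  show "g \<in> borel_measurable \<psi> \<Longrightarrow> (\<integral>\<^sup>+z. g (snd z) \<partial>\<pi>) = (\<integral>\<^sup>+x. g x \<partial>\<psi>)"
    using nn_integral_distr[OF coupling_measurable(2)[OF assms], of g] d by simp
qed

lemma coupling_AE:
  assumes "\<pi> \<in> couplings \<phi> \<psi>"
  shows "AE x in \<phi>. P x \<Longrightarrow> AE z in \<pi>. P (fst z)" "AE x in \<psi>. P x \<Longrightarrow> AE z in \<pi>. P (snd z)"
proof -
  have d: "distr \<pi> \<phi> fst = \<phi>" "distr \<pi> \<psi> snd = \<psi>" using assms by (auto simp: couplings_def)
  show "AE x in \<phi>. P x \<Longrightarrow> AE z in \<pi>. P (fst z)"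
    using AE_distrD[OF coupling_measurable(1)[OF assms], of P] unfolding d(1) .
  show "AE x in \<psi>. P x \<Longrightarrow> AE z in \<pi>. P (snd z)"
    using AE_distrD[OF coupling_measurable(2)[OF assms], of P] unfolding d(2) .
qed

lemma measurable_sq_dist [measurable]:
  assumes "f \<in> M \<rightarrow>\<^sub>M borel_on" "g \<in> M \<rightarrow>\<^sub>M borel_on"
  shows "(\<lambda>x. ennreal ((norm (f x - g x))\<^sup>2)) \<in> borel_measurable M"
proof -
  have "f \<in> borel_measurable M" "g \<in> borel_measurable M"
    using assms[THEN measurable_compose[OF _ measurable_id_borel]] by auto
  then show ?thesis by auto
qed

lemma transport_cost_le:
  assumes "\<pi> \<in> couplings \<phi> \<psi>" "\<phi> \<in> P2 \<Omega>" "\<psi> \<in> P2 \<Omega>"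
  shows "transport_cost \<pi> \<le> ennreal ((diameter \<Omega>)\<^sup>2)"
proof -
  interpret prob_space \<pi> using coupling_prob[OF assms] .
  have "transport_cost \<pi> \<le> (\<integral>\<^sup>+z. ennreal ((diameter \<Omega>)\<^sup>2) \<partial>\<pi>)"
    unfolding transport_cost_def
  proof (rule nn_integral_mono)
    fix z assume "z \<in> space \<pi>"
    then show "ennreal ((norm (fst z - snd z))\<^sup>2) \<le> ennreal ((diameter \<Omega>)\<^sup>2)"
      by (intro ennreal_leI power_mono dist_le_diameter norm_ge_zero coupling_mem[OF assms])
  qed
  also have "\<dots> = ennreal ((diameter \<Omega>)\<^sup>2)"
    by (simp only: nn_integral_const emeasure_space_1 mult_1_right)
  finally show ?thesis .
qed

lemma product_coupling:
  assumes "\<phi> \<in> P2 \<Omega>" "\<psi> \<in> P2 \<Omega>"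
  shows "\<phi> \<Otimes>\<^sub>M \<psi> \<in> couplings \<phi> \<psi>"
proof -
  interpret p: prob_space \<phi> using P2_prob assms by auto
  interpret q: prob_space \<psi> using P2_prob assms by auto
  interpret pair_prob_space \<phi> \<psi> ..
  have "distr (\<phi> \<Otimes>\<^sub>M \<psi>) \<phi> fst = \<phi>"
    by (rule q.distr_pair_fst)
  moreover have "distr (\<phi> \<Otimes>\<^sub>M \<psi>) \<psi> snd = \<psi>"
  proof (rule distr_eqI_nn_integral)
    fix A assume "A \<in> sets \<psi>"
    then show "(\<integral>\<^sup>+z. indicator A (snd z) \<partial>(\<phi> \<Otimes>\<^sub>M \<psi>)) = emeasure \<psi> A"
      by (subst q.nn_integral_fst[symmetric]) (auto simp: p.emeasure_space_1)
  qed simp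
  ultimately show ?thesis by (simp add: couplings_def)
qed

lemma W2_nonneg [simp]: "0 \<le> W2 \<phi> \<psi>"
  by (simp add: W2_def)

text \<open>\<open>enn2real\<close> in the definition of \<open>W2\<close> would turn an infinite
  cost into 0. The product coupling costs at most the squared diameter, so nothing is lost.\<close>

lemma W2_sq:
  assumes "\<phi> \<in> P2 \<Omega>" "\<psi> \<in> P2 \<Omega>"
  shows "ennreal ((W2 \<phi> \<psi>)\<^sup>2) = (INF \<pi>\<in>couplings \<phi> \<psi>. transport_cost \<pi>)"
proof -
  have "(INF \<pi>\<in>couplings \<phi> \<psi>. transport_cost \<pi>) \<le> ennreal ((diameter \<Omega>)\<^sup>2)"
    using INF_lower[OF product_coupling[OF assms], of transport_cost]
      transport_cost_le[OF product_coupling[OF assms] assms] by (rule order_trans)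
  then have "(INF \<pi>\<in>couplings \<phi> \<psi>. transport_cost \<pi>) < \<top>"
    by (rule le_less_trans) simp
  then have "ennreal (enn2real (INF \<pi>\<in>couplings \<phi> \<psi>. transport_cost \<pi>)) = (INF \<pi>\<in>couplings \<phi> \<psi>. transport_cost \<pi>)"
    by (rule ennreal_enn2real)
  moreover have "(W2 \<phi> \<psi>)\<^sup>2 = enn2real (INF \<pi>\<in>couplings \<phi> \<psi>. transport_cost \<pi>)"
    unfolding W2_def transport_cost_def by (rule real_sqrt_pow2) simp
  ultimately show ?thesis by (simp only:)
qed

lemma W2_sq_le_diameter:
  assumes "\<phi> \<in> P2 \<Omega>" "\<psi> \<in> P2 \<Omega>"
  shows "(W2 \<phi> \<psi>)\<^sup>2 \<le> (diameter \<Omega>)\<^sup>2"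
proof -
  have "ennreal ((W2 \<phi> \<psi>)\<^sup>2) \<le> ennreal ((diameter \<Omega>)\<^sup>2)"
    unfolding W2_sq[OF assms]
    using INF_lower[OF product_coupling[OF assms], of transport_cost]
      transport_cost_le[OF product_coupling[OF assms] assms] by (rule order_trans)
  then show ?thesis by (simp add: ennreal_le_iff)
qed

lemma W2_le_diameter:
  assumes "\<phi> \<in> P2 \<Omega>" "\<psi> \<in> P2 \<Omega>"
  shows "W2 \<phi> \<psi> \<le> diameter \<Omega>"
  by (rule power2_le_imp_le[OF W2_sq_le_diameter[OF assms] diameter_nonneg])

text \<open>The tool for upper bounds on \<open>W2\<close>: any two maps on any measure
  \<open>Q\<close> with the right laws give a coupling, whose cost is computed on
  \<open>Q\<close>.\<close>

lemma W2_sq_leI: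
  assumes P: "\<phi> \<in> P2 \<Omega>" "\<psi> \<in> P2 \<Omega>"
    and T: "T1 \<in> measurable Q \<phi>" "T2 \<in> measurable Q \<psi>"
    and d: "distr Q \<phi> T1 = \<phi>" "distr Q \<psi> T2 = \<psi>"
    and c: "(\<integral>\<^sup>+q. ennreal ((norm (T1 q - T2 q))\<^sup>2) \<partial>Q) \<le> ennreal c" "0 \<le> c"
  shows "(W2 \<phi> \<psi>)\<^sup>2 \<le> c"
proof -
  note T[measurable]
  have s: "sets (\<phi> \<Otimes>\<^sub>M \<psi>) = sets (borel_on \<Otimes>\<^sub>M borel_on)"
    by (rule sets_pair_measure_cong[OF P2_sets[OF P(1)] P2_sets[OF P(2)]])
  have m: "(\<lambda>z. ennreal ((norm (fst z - snd z))\<^sup>2)) \<in> borel_measurable (\<phi> \<Otimes>\<^sub>M \<psi>)"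
    unfolding measurable_cong_sets[OF s refl] by measurable
  let ?\<pi> = "distr Q (\<phi> \<Otimes>\<^sub>M \<psi>) (\<lambda>q. (T1 q, T2 q))"
  have "ennreal ((W2 \<phi> \<psi>)\<^sup>2) \<le> transport_cost ?\<pi>"
    unfolding W2_sq[OF P] by (rule INF_lower) (rule coupling_distr[OF T d])
  also have "\<dots> = (\<integral>\<^sup>+q. ennreal ((norm (T1 q - T2 q))\<^sup>2) \<partial>Q)"
    unfolding transport_cost_def by (subst nn_integral_distr) (use m in \<open>auto intro: measurable_Pair T\<close>)
  also note c(1)
  finally show ?thesis using c(2) by simp
qed

text \<open>A substitute for optimal couplings, whose existence would need a compactness argument;
  every use lets \<open>c\<close> tend to \<open>W2 \<phi> \<psi>\<close>.\<close>

lemma W2_less_coupling: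
  assumes P: "\<phi> \<in> P2 \<Omega>" "\<psi> \<in> P2 \<Omega>" and c: "W2 \<phi> \<psi> < c"
  obtains \<pi> where "\<pi> \<in> couplings \<phi> \<psi>" "transport_cost \<pi> \<le> ennreal (c\<^sup>2)"
proof -
  have "(W2 \<phi> \<psi>)\<^sup>2 < c\<^sup>2" using c W2_nonneg by (intro power_strict_mono) auto
  then have "(INF \<pi>\<in>couplings \<phi> \<psi>. transport_cost \<pi>) < ennreal (c\<^sup>2)"
    unfolding W2_sq[OF P, symmetric] by (intro ennreal_lessI) (auto intro: le_less_trans[OF zero_le_power2])
  then obtain \<pi> where "\<pi> \<in> couplings \<phi> \<psi>" "transport_cost \<pi> < ennreal (c\<^sup>2)"
    unfolding INF_less_iff by blast
  then show ?thesis by (intro that[of \<pi>] less_imp_le)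
qed

end

text \<open>Weighted Cauchy-Schwarz, with equality for \<open>p, q, r\<close> proportional to
  \<open>a, b, c\<close>. Integrated with \<open>a, b, c\<close> bounding the L2 norms of three
  steps, it yields Minkowski's inequality.\<close>

lemma sum_squared_le_weighted:
  fixes a b c p q r :: real
  assumes "0 < a" "0 < b" "0 < c"
  shows "(p + q + r)\<^sup>2 \<le> (a + b + c) / a * p\<^sup>2 + (a + b + c) / b * q\<^sup>2 + (a + b + c) / c * r\<^sup>2"
proof -
  define S where "S = a + b + c"
  define t where "t = (p + q + r) / S"
  have S: "S > 0" using assms by (simp add: S_def)
  \<comment> \<open>\<open>u\<^sup>2 / v\<close> is the supremum over \<open>t\<close> of the left
    side; one common slope \<open>t\<close> for the three terms makes the linear parts add
    up.\<close>
  have *: "2 * t * u - t\<^sup>2 * v \<le> u\<^sup>2 / v" if "v > 0" for u v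
  proof -
    have "0 \<le> (u - t * v)\<^sup>2 / v" using that by simp
    also have "\<dots> = u\<^sup>2 / v - (2 * t * u - t\<^sup>2 * v)" using that by (simp add: field_simps power2_eq_square)
    finally show ?thesis by simp
  qed
  have "(p + q + r)\<^sup>2 / S = 2 * t * (p + q + r) - t\<^sup>2 * S"
    using S by (simp add: t_def power2_eq_square)
  also have "\<dots> = (2 * t * p - t\<^sup>2 * a) + (2 * t * q - t\<^sup>2 * b) + (2 * t * r - t\<^sup>2 * c)"
    by (simp add: S_def algebra_simps)
  also have "\<dots> \<le> p\<^sup>2 / a + q\<^sup>2 / b + r\<^sup>2 / c"
    using assms by (intro add_mono *) auto
  finally have "(p + q + r)\<^sup>2 \<le> S * (p\<^sup>2 / a + q\<^sup>2 / b + r\<^sup>2 / c)"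
    using S by (simp add: field_simps)
  then show ?thesis unfolding S_def[symmetric] by (simp add: algebra_simps)
qed

lemma nn_integral_lincomb3:
  fixes f g h :: "'a \<Rightarrow> ennreal"
  assumes "f \<in> borel_measurable M" "g \<in> borel_measurable M" "h \<in> borel_measurable M"
  shows "(\<integral>\<^sup>+x. a * f x + b * g x + c * h x \<partial>M)
    = a * integral\<^sup>N M f + b * integral\<^sup>N M g + c * integral\<^sup>N M h"
  using assms by (simp add: nn_integral_add nn_integral_cmult)

section \<open>Gluing two couplings through a coupling of their middle measures\<close>

context bounded_domain
begin

text \<open>\<open>w1\<close> and \<open>w2\<close> say that \<open>w\<close> is the density of a
  coupling of \<open>\<psi>1\<close> and \<open>\<psi>2\<close> with respect to their product. Given
  such a density, two couplings can be chained to a path \<open>x, y, y', z\<close> without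
  disintegrating them.\<close>

lemma W2_glue:
  fixes w :: "real ^ 'n \<Rightarrow> real ^ 'n \<Rightarrow> ennreal"
  assumes P: "\<phi> \<in> P2 \<Omega>" "\<psi>1 \<in> P2 \<Omega>" "\<psi>2 \<in> P2 \<Omega>" "\<xi> \<in> P2 \<Omega>"
    and pi1: "\<pi>1 \<in> couplings \<phi> \<psi>1" and pi2: "\<pi>2 \<in> couplings \<psi>2 \<xi>"
    and w: "(\<lambda>z. w (fst z) (snd z)) \<in> borel_measurable (borel_on \<Otimes>\<^sub>M borel_on)"
    and w1: "AE y in \<psi>1. (\<integral>\<^sup>+y'. w y y' \<partial>\<psi>2) = 1"
    and w2: "AE y' in \<psi>2. (\<integral>\<^sup>+y. w y y' \<partial>\<psi>1) = 1"
    and pos: "0 < a" "0 < b" "0 < c"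
    and costs: "transport_cost \<pi>1 \<le> ennreal (a\<^sup>2)" "transport_cost \<pi>2 \<le> ennreal (c\<^sup>2)"
      "(\<integral>\<^sup>+y. \<integral>\<^sup>+y'. w y y' * ennreal ((norm (y - y'))\<^sup>2) \<partial>\<psi>2 \<partial>\<psi>1) \<le> ennreal (b\<^sup>2)"
  shows "W2 \<phi> \<xi> \<le> a + b + c"
proof -
  interpret p1: prob_space \<pi>1 using coupling_prob[OF pi1 P(1,2)] .
  interpret p2: prob_space \<pi>2 using coupling_prob[OF pi2 P(3,4)] .
  interpret q2: prob_space \<psi>2 using P2_prob[OF P(3)] .
  interpret p12: pair_sigma_finite \<pi>1 \<pi>2 ..
  note [measurable_cong] = coupling_sets[OF pi1 P(1,2)] coupling_sets[OF pi2 P(3,4)]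
    P2_sets[OF P(1)] P2_sets[OF P(2)] P2_sets[OF P(3)] P2_sets[OF P(4)]
  have [measurable]: "fst \<in> \<pi>1 \<rightarrow>\<^sub>M borel_on" "snd \<in> \<pi>1 \<rightarrow>\<^sub>M borel_on"
    "fst \<in> \<pi>2 \<rightarrow>\<^sub>M borel_on" "snd \<in> \<pi>2 \<rightarrow>\<^sub>M borel_on"
    by measurable
  have sp[simp]: "z \<in> space \<pi>1 \<Longrightarrow> snd z \<in> \<Omega>" "z \<in> space \<pi>2 \<Longrightarrow> fst z \<in> \<Omega>" for z
    using coupling_mem[OF pi1 P(1,2)] coupling_mem[OF pi2 P(3,4)] by auto
  have sb[simp]: "space borel_on = \<Omega>" by (simp add: space_restrict_space)
  have w_m[measurable]: "(\<lambda>x. w (f x) (g x)) \<in> borel_measurable N"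
    if "f \<in> N \<rightarrow>\<^sub>M borel_on" "g \<in> N \<rightarrow>\<^sub>M borel_on" for f g and N :: "'z measure"
    using measurable_compose[OF measurable_Pair[OF that] w] by simp
  let ?W = "\<lambda>q. w (snd (fst q)) (fst (snd q))"
  have f1[measurable]: "(\<lambda>q. fst (fst q)) \<in> \<pi>1 \<Otimes>\<^sub>M \<pi>2 \<rightarrow>\<^sub>M borel_on" by measurable
  have f2[measurable]: "(\<lambda>q. snd (fst q)) \<in> \<pi>1 \<Otimes>\<^sub>M \<pi>2 \<rightarrow>\<^sub>M borel_on" by measurable
  have f3[measurable]: "(\<lambda>q. fst (snd q)) \<in> \<pi>1 \<Otimes>\<^sub>M \<pi>2 \<rightarrow>\<^sub>M borel_on" by measurable
  have f4[measurable]: "(\<lambda>q. snd (snd q)) \<in> \<pi>1 \<Otimes>\<^sub>M \<pi>2 \<rightarrow>\<^sub>M borel_on" by measurable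
  have W: "?W \<in> borel_measurable (\<pi>1 \<Otimes>\<^sub>M \<pi>2)" by measurable
  \<comment> \<open>Under \<open>Q\<close> the two outer pairs keep the laws \<open>\<pi>1\<close>
    and \<open>\<pi>2\<close>, while the middle pair gets density \<open>w\<close>, so its cost is
    the third one in \<open>costs\<close>.\<close>
  define Q where "Q = density (\<pi>1 \<Otimes>\<^sub>M \<pi>2) ?W"
  have Qs[measurable_cong]: "sets Q = sets (\<pi>1 \<Otimes>\<^sub>M \<pi>2)" by (simp add: Q_def)
  \<comment> \<open>The weight sees only the first coordinate of the second pair, so integrating
    that pair out leaves an integral over \<open>\<psi>2\<close>, which is 1 by
    \<open>w1\<close>.\<close>
  have m1: "(\<integral>\<^sup>+q. F (fst q) \<partial>Q) = (\<integral>\<^sup>+z. F z \<partial>\<pi>1)" if F[measurable]: "F \<in> borel_measurable \<pi>1" for F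
  proof -
    have "(\<integral>\<^sup>+q. F (fst q) \<partial>Q) = (\<integral>\<^sup>+q. ?W q * F (fst q) \<partial>(\<pi>1 \<Otimes>\<^sub>M \<pi>2))"
      unfolding Q_def by (rule nn_integral_density) measurable
    also have "\<dots> = (\<integral>\<^sup>+z. \<integral>\<^sup>+z'. w (snd z) (fst z') * F z \<partial>\<pi>2 \<partial>\<pi>1)"
      by (subst p2.nn_integral_fst[symmetric]) simp_all
    also have "\<dots> = (\<integral>\<^sup>+z. (\<integral>\<^sup>+z'. w (snd z) (fst z') \<partial>\<pi>2) * F z \<partial>\<pi>1)"
      by (intro nn_integral_cong nn_integral_multc) measurable
    also have "\<dots> = (\<integral>\<^sup>+z. (\<integral>\<^sup>+y'. w (snd z) y' \<partial>\<psi>2) * F z \<partial>\<pi>1)"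
      by (intro nn_integral_cong arg_cong2[where f="(*)"] refl coupling_nn_integral(1)[OF pi2]) measurable
    also have "\<dots> = (\<integral>\<^sup>+z. F z \<partial>\<pi>1)"
      using coupling_AE(2)[OF pi1 w1] by (intro nn_integral_cong_AE) auto
    finally show ?thesis .
  qed
  have m2: "(\<integral>\<^sup>+q. F (snd q) \<partial>Q) = (\<integral>\<^sup>+z. F z \<partial>\<pi>2)" if F[measurable]: "F \<in> borel_measurable \<pi>2" for F
  proof -
    have "(\<integral>\<^sup>+q. F (snd q) \<partial>Q) = (\<integral>\<^sup>+q. ?W q * F (snd q) \<partial>(\<pi>1 \<Otimes>\<^sub>M \<pi>2))"
      unfolding Q_def by (rule nn_integral_density) measurable
    also have "\<dots> = (\<integral>\<^sup>+z'. \<integral>\<^sup>+z. w (snd z) (fst z') * F z' \<partial>\<pi>1 \<partial>\<pi>2)"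
      by (subst p12.nn_integral_snd[symmetric]) simp_all
    also have "\<dots> = (\<integral>\<^sup>+z'. (\<integral>\<^sup>+z. w (snd z) (fst z') \<partial>\<pi>1) * F z' \<partial>\<pi>2)"
      by (intro nn_integral_cong nn_integral_multc) measurable
    also have "\<dots> = (\<integral>\<^sup>+z'. (\<integral>\<^sup>+y. w y (fst z') \<partial>\<psi>1) * F z' \<partial>\<pi>2)"
      by (intro nn_integral_cong arg_cong2[where f="(*)"] refl coupling_nn_integral(2)[OF pi1]) measurable
    also have "\<dots> = (\<integral>\<^sup>+z. F z \<partial>\<pi>2)"
      using coupling_AE(1)[OF pi2 w2] by (intro nn_integral_cong_AE) auto
    finally show ?thesis .
  qed
  have mid: "(\<integral>\<^sup>+q. ennreal ((norm (snd (fst q) - fst (snd q)))\<^sup>2) \<partial>Q)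
      = (\<integral>\<^sup>+y. \<integral>\<^sup>+y'. w y y' * ennreal ((norm (y - y'))\<^sup>2) \<partial>\<psi>2 \<partial>\<psi>1)"
  proof -
    have "(\<integral>\<^sup>+q. ennreal ((norm (snd (fst q) - fst (snd q)))\<^sup>2) \<partial>Q)
        = (\<integral>\<^sup>+q. ?W q * ennreal ((norm (snd (fst q) - fst (snd q)))\<^sup>2) \<partial>(\<pi>1 \<Otimes>\<^sub>M \<pi>2))"
      unfolding Q_def by (rule nn_integral_density) measurable
    also have "\<dots> = (\<integral>\<^sup>+z. \<integral>\<^sup>+z'. w (snd z) (fst z') * ennreal ((norm (snd z - fst z'))\<^sup>2) \<partial>\<pi>2 \<partial>\<pi>1)"
      by (subst p2.nn_integral_fst[symmetric]) simp_all
    also have "\<dots> = (\<integral>\<^sup>+z. \<integral>\<^sup>+y'. w (snd z) y' * ennreal ((norm (snd z - y'))\<^sup>2) \<partial>\<psi>2 \<partial>\<pi>1)"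
      by (intro nn_integral_cong coupling_nn_integral(1)[OF pi2, where f="\<lambda>y'. w y y' * ennreal ((norm (y - y'))\<^sup>2)" for y])
         measurable
    also have "\<dots> = (\<integral>\<^sup>+y. \<integral>\<^sup>+y'. w y y' * ennreal ((norm (y - y'))\<^sup>2) \<partial>\<psi>2 \<partial>\<psi>1)"
      by (rule coupling_nn_integral(2)[OF pi1]) measurable
    finally show ?thesis .
  qed
  have mQ: "(\<lambda>q. ennreal ((norm (fst (fst q) - snd (fst q)))\<^sup>2)) \<in> borel_measurable Q"
    "(\<lambda>q. ennreal ((norm (snd (fst q) - fst (snd q)))\<^sup>2)) \<in> borel_measurable Q"
    "(\<lambda>q. ennreal ((norm (fst (snd q) - snd (snd q)))\<^sup>2)) \<in> borel_measurable Q"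
    by (rule measurable_sq_dist; measurable)+
  let ?S = "a + b + c"
  have S: "?S > 0" using pos by simp
  have "(W2 \<phi> \<xi>)\<^sup>2 \<le> ?S\<^sup>2"
  proof (rule W2_sq_leI[OF P(1,4), where Q=Q])
    show t1: "(\<lambda>q. fst (fst q)) \<in> Q \<rightarrow>\<^sub>M \<phi>" and t2: "(\<lambda>q. snd (snd q)) \<in> Q \<rightarrow>\<^sub>M \<xi>" by measurable
    show "distr Q \<phi> (\<lambda>q. fst (fst q)) = \<phi>"
    proof (rule distr_eqI_nn_integral[OF t1])
      fix A assume A[measurable]: "A \<in> sets \<phi>"
      have "(\<integral>\<^sup>+q. indicator A (fst (fst q)) \<partial>Q) = (\<integral>\<^sup>+z. indicator A (fst z) \<partial>\<pi>1)"
        by (rule m1) measurable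
      also have "\<dots> = (\<integral>\<^sup>+z. indicator A z \<partial>\<phi>)" by (rule coupling_nn_integral(1)[OF pi1]) measurable
      finally show "(\<integral>\<^sup>+q. indicator A (fst (fst q)) \<partial>Q) = emeasure \<phi> A" using A by simp
    qed
    show "distr Q \<xi> (\<lambda>q. snd (snd q)) = \<xi>"
    proof (rule distr_eqI_nn_integral[OF t2])
      fix A assume A[measurable]: "A \<in> sets \<xi>"
      have "(\<integral>\<^sup>+q. indicator A (snd (snd q)) \<partial>Q) = (\<integral>\<^sup>+z. indicator A (snd z) \<partial>\<pi>2)"
        by (rule m2) measurable
      also have "\<dots> = (\<integral>\<^sup>+z. indicator A z \<partial>\<xi>)" by (rule coupling_nn_integral(2)[OF pi2]) measurable
      finally show "(\<integral>\<^sup>+q. indicator A (snd (snd q)) \<partial>Q) = emeasure \<xi> A" using A by simp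
    qed
    have "(\<integral>\<^sup>+q. ennreal ((norm (fst (fst q) - snd (snd q)))\<^sup>2) \<partial>Q)
      \<le> (\<integral>\<^sup>+q. ennreal (?S / a) * ennreal ((norm (fst (fst q) - snd (fst q)))\<^sup>2)
            + ennreal (?S / b) * ennreal ((norm (snd (fst q) - fst (snd q)))\<^sup>2)
            + ennreal (?S / c) * ennreal ((norm (fst (snd q) - snd (snd q)))\<^sup>2) \<partial>Q)"
    proof (rule nn_integral_mono)
      fix q :: "((real ^ 'n) \<times> (real ^ 'n)) \<times> ((real ^ 'n) \<times> (real ^ 'n))"
      let ?x = "fst (fst q)" and ?y = "snd (fst q)" and ?y' = "fst (snd q)" and ?z = "snd (snd q)"
      have "norm (?x - ?z) = norm ((?x - ?y) + (?y - ?y') + (?y' - ?z))" by (simp add: algebra_simps)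
      also have "\<dots> \<le> norm (?x - ?y) + norm (?y - ?y') + norm (?y' - ?z)"
        by (intro norm_triangle_le add_right_mono norm_triangle_ineq)
      finally have "(norm (?x - ?z))\<^sup>2 \<le> (norm (?x - ?y) + norm (?y - ?y') + norm (?y' - ?z))\<^sup>2"
        by (intro power_mono norm_ge_zero)
      also have "\<dots> \<le> ?S / a * (norm (?x - ?y))\<^sup>2 + ?S / b * (norm (?y - ?y'))\<^sup>2 + ?S / c * (norm (?y' - ?z))\<^sup>2"
        by (rule sum_squared_le_weighted[OF pos])
      finally show "ennreal ((norm (?x - ?z))\<^sup>2) \<le> ennreal (?S / a) * ennreal ((norm (?x - ?y))\<^sup>2)
            + ennreal (?S / b) * ennreal ((norm (?y - ?y'))\<^sup>2) + ennreal (?S / c) * ennreal ((norm (?y' - ?z))\<^sup>2)"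
        using S pos by (simp add: ennreal_mult[symmetric] ennreal_plus[symmetric] ennreal_leI del: ennreal_plus)
    qed
    also have "\<dots> = ennreal (?S / a) * transport_cost \<pi>1
        + ennreal (?S / b) * (\<integral>\<^sup>+y. \<integral>\<^sup>+y'. w y y' * ennreal ((norm (y - y'))\<^sup>2) \<partial>\<psi>2 \<partial>\<psi>1)
        + ennreal (?S / c) * transport_cost \<pi>2"
    proof -
      have c1: "(\<integral>\<^sup>+q. ennreal ((norm (fst (fst q) - snd (fst q)))\<^sup>2) \<partial>Q) = transport_cost \<pi>1"
        unfolding transport_cost_def by (rule m1) measurable
      have c2: "(\<integral>\<^sup>+q. ennreal ((norm (fst (snd q) - snd (snd q)))\<^sup>2) \<partial>Q) = transport_cost \<pi>2"
        unfolding transport_cost_def by (rule m2) measurable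
      show ?thesis
        unfolding c1[symmetric] c2[symmetric] mid[symmetric]
        by (rule nn_integral_lincomb3[OF mQ])
    qed
    also have "\<dots> \<le> ennreal (?S / a) * ennreal (a\<^sup>2) + ennreal (?S / b) * ennreal (b\<^sup>2) + ennreal (?S / c) * ennreal (c\<^sup>2)"
      by (intro add_mono mult_left_mono costs) auto
    also have "\<dots> = ennreal (?S / a * a\<^sup>2 + ?S / b * b\<^sup>2 + ?S / c * c\<^sup>2)"
      using S pos by (simp add: ennreal_mult[symmetric] ennreal_plus[symmetric] del: ennreal_plus)
    also have "?S / a * a\<^sup>2 + ?S / b * b\<^sup>2 + ?S / c * c\<^sup>2 = ?S\<^sup>2"
    proof -
      have "?S / a * a\<^sup>2 = ?S * a" "?S / b * b\<^sup>2 = ?S * b" "?S / c * c\<^sup>2 = ?S * c"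
        using pos by (simp_all add: power2_eq_square)
      then show ?thesis by (simp only: power2_eq_square distrib_left)
    qed
    finally show "(\<integral>\<^sup>+q. ennreal ((norm (fst (fst q) - snd (snd q)))\<^sup>2) \<partial>Q) \<le> ennreal (?S\<^sup>2)" .
  qed simp
  then show ?thesis using S by (rule power2_le_imp_le[OF _ less_imp_le])
qed

end

text \<open>The maximal coupling of two finite distributions: the common mass stays on the diagonal
  and the two residuals are coupled independently. If the distributions agree, the denominator is 0
  and the second term is 0 by the convention for division.\<close>

definition coupling_matrix :: "nat \<Rightarrow> (nat \<Rightarrow> real) \<Rightarrow> (nat \<Rightarrow> real) \<Rightarrow> nat \<Rightarrow> nat \<Rightarrow> real" where
  "coupling_matrix N p q i j = (if i = j then min (p i) (q i) else 0)
     + (p i - min (p i) (q i)) * (q j - min (p j) (q j)) / (1 - (\<Sum>k<N. min (p k) (q k)))"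

text \<open>At most \<open>1 - m\<close>, half the l1 distance, lies off the diagonal. The last two
  facts allow dividing by \<open>p i\<close> and \<open>q j\<close> later, since cells without mass
  get no entry.\<close>

lemma coupling_matrix:
  fixes p q :: "nat \<Rightarrow> real"
  assumes p: "\<And>i. 0 \<le> p i" "(\<Sum>i<N. p i) = 1" and q: "\<And>i. 0 \<le> q i" "(\<Sum>i<N. q i) = 1"
  defines "m \<equiv> \<Sum>k<N. min (p k) (q k)"
  shows "0 \<le> coupling_matrix N p q i j"
    and "i < N \<Longrightarrow> (\<Sum>j<N. coupling_matrix N p q i j) = p i"
    and "j < N \<Longrightarrow> (\<Sum>i<N. coupling_matrix N p q i j) = q j"
    and "m \<le> (\<Sum>i<N. coupling_matrix N p q i i)"
    and "m \<le> 1"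
    and "p i = 0 \<Longrightarrow> coupling_matrix N p q i j = 0"
    and "q j = 0 \<Longrightarrow> coupling_matrix N p q i j = 0"
proof -
  show m1: "m \<le> 1" unfolding m_def p(2)[symmetric] by (rule sum_mono) simp
  show nn: "0 \<le> coupling_matrix N p q i j" for i j
    unfolding coupling_matrix_def m_def[symmetric] using m1 p q by auto
  have res: "(\<Sum>i<N. p i - min (p i) (q i)) = 1 - m" "(\<Sum>i<N. q i - min (p i) (q i)) = 1 - m"
    by (simp_all add: sum_subtractf p q m_def)
  \<comment> \<open>For \<open>m = 1\<close> both residuals vanish below \<open>N\<close>, so the
    default value of division by \<open>1 - m\<close> gives the correct row and column sums.\<close>
  have z: "p i - min (p i) (q i) = 0 \<and> q i - min (p i) (q i) = 0" if "m = 1" "i < N" for i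
  proof -
    have 0: "(\<Sum>i<N. p i - min (p i) (q i)) = 0" "(\<Sum>i<N. q i - min (p i) (q i)) = 0"
      using res that(1) by simp_all
    have "p i - min (p i) (q i) = 0"
      by (rule sum_nonneg_0[OF _ _ 0(1)]) (use that(2) in auto)
    moreover have "q i - min (p i) (q i) = 0"
      by (rule sum_nonneg_0[OF _ _ 0(2)]) (use that(2) in auto)
    ultimately show ?thesis ..
  qed
  show "(\<Sum>j<N. coupling_matrix N p q i j) = p i" if "i < N"
  proof -
    have "(\<Sum>j<N. coupling_matrix N p q i j) = min (p i) (q i)
        + (p i - min (p i) (q i)) * (\<Sum>j<N. q j - min (p j) (q j)) / (1 - m)"
      unfolding coupling_matrix_def m_def[symmetric] sum.distrib
      using that by (simp add: sum_divide_distrib[symmetric] sum_distrib_left[symmetric])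
    then show ?thesis unfolding res using z[OF _ that] by (cases "m = 1") auto
  qed
  show "(\<Sum>i<N. coupling_matrix N p q i j) = q j" if "j < N"
  proof -
    have "(\<Sum>i<N. coupling_matrix N p q i j) = min (p j) (q j)
        + (\<Sum>i<N. p i - min (p i) (q i)) * (q j - min (p j) (q j)) / (1 - m)"
      unfolding coupling_matrix_def m_def[symmetric] sum.distrib
      using that by (simp add: sum_divide_distrib[symmetric] sum_distrib_right[symmetric])
    then show ?thesis unfolding res using z[OF _ that] by (cases "m = 1") auto
  qed
  show "m \<le> (\<Sum>i<N. coupling_matrix N p q i i)"
    unfolding m_def
  proof (rule sum_mono)
    fix i
    have "0 \<le> (p i - min (p i) (q i)) * (q i - min (p i) (q i)) / (1 - m)"
      using m1 by (intro divide_nonneg_nonneg mult_nonneg_nonneg) auto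
    then show "min (p i) (q i) \<le> coupling_matrix N p q i i"
      by (simp add: coupling_matrix_def m_def)
  qed
  show "p i = 0 \<Longrightarrow> coupling_matrix N p q i j = 0"
    using q(1)[of i] by (auto simp: coupling_matrix_def)
  show "q j = 0 \<Longrightarrow> coupling_matrix N p q i j = 0"
    using p(1)[of j] by (auto simp: coupling_matrix_def)
qed

section \<open>Finite partitions into small cells and gluing along them\<close>

context bounded_domain
begin

text \<open>Cells are level sets of one index function, so that functions constant on cells are
  compositions with \<open>c\<close> and integrate to finite sums.\<close>

definition partition_map :: "nat \<Rightarrow> (real ^ 'n \<Rightarrow> nat) \<Rightarrow> real \<Rightarrow> bool" where
  "partition_map N c \<epsilon> \<longleftrightarrow> c \<in> measurable borel_on (count_space UNIV) \<and> (\<forall>x\<in>\<Omega>. c x < N) \<and>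
     (\<forall>x\<in>\<Omega>. \<forall>y\<in>\<Omega>. c x = c y \<longrightarrow> norm (x - y) \<le> \<epsilon>)"

text \<open>Finitely many balls of radius \<open>\<epsilon>/2\<close> cover the compact closure; the
  cell of a point is the first ball in a list that contains it, which makes the cells
  disjoint.\<close>

lemma ex_partition_map:
  assumes "0 < \<epsilon>"
  shows "\<exists>N c. partition_map N c \<epsilon>"
proof -
  have "compact (closure \<Omega>)" using bounded_closure[OF bounded] by (simp add: compact_eq_bounded_closed)
  then obtain k where k: "finite k" "closure \<Omega> \<subseteq> (\<Union>x\<in>k. ball x (\<epsilon>/2))"
    using assms unfolding compact_eq_totally_bounded by (meson half_gt_zero)
  obtain xs where xs: "set xs = k" using finite_list[OF k(1)] by blast
  let ?P = "\<lambda>x i. i < length xs \<and> dist (xs ! i) x < \<epsilon>/2"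
  define c where "c x = (LEAST i. ?P x i)" for x
  have c: "?P x (c x)" if "x \<in> \<Omega>" for x
  proof -
    have "x \<in> (\<Union>x\<in>k. ball x (\<epsilon>/2))" using k(2) closure_subset that by blast
    then have "\<exists>i. ?P x i" unfolding xs[symmetric] by (auto simp: in_set_conv_nth)
    then show ?thesis unfolding c_def by (rule LeastI_ex)
  qed
  have "c \<in> measurable borel (count_space UNIV)" unfolding c_def by measurable
  then have "c \<in> measurable borel_on (count_space UNIV)" by (rule measurable_restrict_space1)
  moreover have "norm (x - y) \<le> \<epsilon>" if "x \<in> \<Omega>" "y \<in> \<Omega>" "c x = c y" for x y
    using c[OF that(1)] c[OF that(2)] that(3) dist_triangle3[of x y "xs ! c x"]
    by (simp add: dist_norm)
  ultimately have "partition_map (length xs) c \<epsilon>" using c by (auto simp: partition_map_def)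
  then show ?thesis by blast
qed

definition mass :: "(real ^ 'n) measure \<Rightarrow> (real ^ 'n \<Rightarrow> nat) \<Rightarrow> nat \<Rightarrow> real" where
  "mass \<phi> c i = measure \<phi> {x\<in>\<Omega>. c x = i}"

lemma mass_nonneg: "0 \<le> mass \<phi> c i"
  by (simp add: mass_def)

lemma cell_sets:
  assumes "\<phi> \<in> P2 \<Omega>" "partition_map N c \<epsilon>"
  shows "{x\<in>\<Omega>. c x = i} \<in> sets \<phi>"
proof -
  have c: "c \<in> measurable \<phi> (count_space UNIV)"
    using assms(2) measurable_cong_sets[OF P2_sets[OF assms(1)] refl] by (auto simp: partition_map_def)
  have "c -` {i} \<inter> space \<phi> \<in> sets \<phi>" using measurable_sets[OF c] by simp
  also have "c -` {i} \<inter> space \<phi> = {x\<in>\<Omega>. c x = i}" by (auto simp: P2_space[OF assms(1)])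
  finally show ?thesis .
qed

lemma nn_integral_partition:
  assumes phi: "\<phi> \<in> P2 \<Omega>" and c: "partition_map N c \<epsilon>" and f: "\<And>i. 0 \<le> f i"
  shows "(\<integral>\<^sup>+x. ennreal (f (c x)) \<partial>\<phi>) = ennreal (\<Sum>i<N. f i * mass \<phi> c i)"
proof -
  interpret prob_space \<phi> using P2_prob[OF phi] .
  have [measurable]: "{x\<in>\<Omega>. c x = i} \<in> sets \<phi>" for i using cell_sets[OF phi c] .
  have "(\<integral>\<^sup>+x. ennreal (f (c x)) \<partial>\<phi>) = (\<integral>\<^sup>+x. (\<Sum>i<N. ennreal (f i) * indicator {x\<in>\<Omega>. c x = i} x) \<partial>\<phi>)"
  proof (rule nn_integral_cong)
    fix x assume "x \<in> space \<phi>"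
    then have x: "x \<in> \<Omega>" "c x < N" using c P2_space[OF phi] by (auto simp: partition_map_def)
    then have "(\<Sum>i<N. ennreal (f i) * indicator {x\<in>\<Omega>. c x = i} x) = (\<Sum>i<N. if i = c x then ennreal (f i) else 0)"
      by (intro sum.cong) (auto simp: indicator_def)
    then show "ennreal (f (c x)) = (\<Sum>i<N. ennreal (f i) * indicator {x\<in>\<Omega>. c x = i} x)"
      using x by simp
  qed
  also have "\<dots> = (\<Sum>i<N. ennreal (f i) * emeasure \<phi> {x\<in>\<Omega>. c x = i})"
    by (subst nn_integral_sum) (simp_all add: nn_integral_cmult_indicator)
  also have "\<dots> = ennreal (\<Sum>i<N. f i * mass \<phi> c i)"
    using f by (simp add: mass_def emeasure_eq_measure ennreal_mult[symmetric] sum_nonneg)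
  finally show ?thesis .
qed

lemma mass_sum:
  assumes phi: "\<phi> \<in> P2 \<Omega>" and c: "partition_map N c \<epsilon>"
  shows "(\<Sum>i<N. mass \<phi> c i) = 1"
proof -
  interpret prob_space \<phi> using P2_prob[OF phi] .
  have "ennreal (\<Sum>i<N. mass \<phi> c i) = 1"
    using nn_integral_partition[OF phi c, of "\<lambda>_. 1"] by (simp add: emeasure_space_1)
  then show ?thesis by simp
qed

text \<open>The gluing weight divides by cell masses; the finitely many cells of mass 0 are met with
  probability 0.\<close>

lemma AE_mass_pos:
  assumes phi: "\<phi> \<in> P2 \<Omega>" and c: "partition_map N c \<epsilon>"
  shows "AE x in \<phi>. x \<in> \<Omega> \<and> c x < N \<and> 0 < mass \<phi> c (c x)"
proof -
  interpret prob_space \<phi> using P2_prob[OF phi] .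
  have "AE x in \<phi>. c x = i \<longrightarrow> 0 < mass \<phi> c i" for i
  proof (cases "mass \<phi> c i = 0")
    case True
    then have "{x\<in>\<Omega>. c x = i} \<in> null_sets \<phi>"
      using cell_sets[OF phi c] by (simp add: null_sets_def mass_def emeasure_eq_measure)
    from AE_not_in[OF this] show ?thesis using AE_space by eventually_elim (auto simp: P2_space[OF phi])
  qed (use mass_nonneg[of \<phi> c i] in auto)
  then have "AE x in \<phi>. \<forall>i. c x = i \<longrightarrow> 0 < mass \<phi> c i" by (subst AE_all_countable) blast
  then show ?thesis using AE_space
    by eventually_elim (use c P2_space[OF phi] in \<open>auto simp: partition_map_def\<close>)
qed

text \<open>Gluing along a finite partition into small cells instead of along a disintegration, which need not
  exist as \<open>\<Omega>\<close> is only Lebesgue measurable. The middle measures may differ: for \<open>\<psi>1 = \<psi>2\<close> this gives the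
  triangle inequality, for \<open>\<phi> = \<psi>1\<close> and \<open>\<psi>2 = \<xi>\<close> total boundedness.\<close>

lemma W2_glue_partition:
  assumes P: "\<phi> \<in> P2 \<Omega>" "\<psi>1 \<in> P2 \<Omega>" "\<psi>2 \<in> P2 \<Omega>" "\<xi> \<in> P2 \<Omega>"
    and c: "partition_map N c \<epsilon>"
    and b: "\<epsilon>\<^sup>2 + (diameter \<Omega>)\<^sup>2 * (1 - (\<Sum>i<N. min (mass \<psi>1 c i) (mass \<psi>2 c i))) \<le> b\<^sup>2" "0 < b"
  shows "W2 \<phi> \<xi> \<le> W2 \<phi> \<psi>1 + b + W2 \<psi>2 \<xi>"
proof (rule field_le_epsilon)
  fix e :: real assume e: "0 < e"
  obtain \<pi>1 where pi1: "\<pi>1 \<in> couplings \<phi> \<psi>1" "transport_cost \<pi>1 \<le> ennreal ((W2 \<phi> \<psi>1 + e/2)\<^sup>2)"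
    using W2_less_coupling[OF P(1,2), of "W2 \<phi> \<psi>1 + e/2"] e by auto
  obtain \<pi>2 where pi2: "\<pi>2 \<in> couplings \<psi>2 \<xi>" "transport_cost \<pi>2 \<le> ennreal ((W2 \<psi>2 \<xi> + e/2)\<^sup>2)"
    using W2_less_coupling[OF P(3,4), of "W2 \<psi>2 \<xi> + e/2"] e by auto
  let ?D = "diameter \<Omega>"
  define p where "p = mass \<psi>1 c"
  define q where "q = mass \<psi>2 c"
  note pq = mass_nonneg[of \<psi>1 c, folded p_def] mass_sum[OF P(2) c, folded p_def]
    mass_nonneg[of \<psi>2 c, folded q_def] mass_sum[OF P(3) c, folded q_def]
  define K where "K = coupling_matrix N p q"
  note K = coupling_matrix[OF pq, folded K_def]
  \<comment> \<open>Density of the coupling of \<open>\<psi>1\<close> and \<open>\<psi>2\<close>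
    that picks a pair of cells according to \<open>K\<close> and is independent inside the chosen
    cells.\<close>
  define w where "w y y' = ennreal (K (c y) (c y') / (p (c y) * q (c y')))" for y y'
  have c_m[measurable]: "c \<in> measurable borel_on (count_space UNIV)" using c by (simp add: partition_map_def)
  have wm: "(\<lambda>z. w (fst z) (snd z)) \<in> borel_measurable (borel_on \<Otimes>\<^sub>M borel_on)"
    unfolding w_def by measurable
  have int1: "(\<integral>\<^sup>+y'. ennreal (K (c y) (c y') / (p (c y) * q (c y')) * g (c y')) \<partial>\<psi>2)
      = ennreal ((\<Sum>j<N. K (c y) j * g j) / p (c y))"
    if "\<And>j. 0 \<le> g j" "0 < p (c y)" for y and g :: "nat \<Rightarrow> real"
  proof -
    have "(\<integral>\<^sup>+y'. ennreal (K (c y) (c y') / (p (c y) * q (c y')) * g (c y')) \<partial>\<psi>2)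
      = ennreal (\<Sum>j<N. K (c y) j / (p (c y) * q j) * g j * mass \<psi>2 c j)"
      by (rule nn_integral_partition[OF P(3) c, where f="\<lambda>j. K (c y) j / (p (c y) * q j) * g j"])
        (use that pq K(1) in \<open>auto intro!: mult_nonneg_nonneg divide_nonneg_nonneg\<close>)
    also have "(\<Sum>j<N. K (c y) j / (p (c y) * q j) * g j * mass \<psi>2 c j) = (\<Sum>j<N. K (c y) j * g j / p (c y))"
      using K(7) that by (intro sum.cong refl) (auto simp: q_def[symmetric])
    finally show ?thesis by (simp add: sum_divide_distrib)
  qed
  have w1: "AE y in \<psi>1. (\<integral>\<^sup>+y'. w y y' \<partial>\<psi>2) = 1"
    using AE_mass_pos[OF P(2) c]
  proof eventually_elim
    case (elim y)
    then show ?case using int1[of "\<lambda>_. 1" y] K(2)[of "c y"] by (simp add: w_def p_def)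
  qed
  have w2: "AE y' in \<psi>2. (\<integral>\<^sup>+y. w y y' \<partial>\<psi>1) = 1"
    using AE_mass_pos[OF P(3) c]
  proof eventually_elim
    case (elim y')
    have "(\<integral>\<^sup>+y. w y y' \<partial>\<psi>1) = ennreal (\<Sum>i<N. K i (c y') / (p i * q (c y')) * mass \<psi>1 c i)"
      unfolding w_def
      by (rule nn_integral_partition[OF P(2) c, where f="\<lambda>i. K i (c y') / (p i * q (c y'))"])
        (use pq K(1) in \<open>auto intro!: mult_nonneg_nonneg divide_nonneg_nonneg\<close>)
    also have "(\<Sum>i<N. K i (c y') / (p i * q (c y')) * mass \<psi>1 c i) = (\<Sum>i<N. K i (c y') / q (c y'))"
      using K(6) by (intro sum.cong refl) (auto simp: p_def[symmetric])
    also have "\<dots> = 1" using K(3)[of "c y'"] elim by (simp add: sum_divide_distrib[symmetric] q_def)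
    finally show ?case by simp
  qed
  have "(\<integral>\<^sup>+y. \<integral>\<^sup>+y'. w y y' * ennreal ((norm (y - y'))\<^sup>2) \<partial>\<psi>2 \<partial>\<psi>1)
      \<le> (\<integral>\<^sup>+y. ennreal ((\<lambda>i. \<epsilon>\<^sup>2 + ?D\<^sup>2 * (1 - K i i / p i)) (c y)) \<partial>\<psi>1)"
  proof (rule nn_integral_mono_AE)
    show "AE y in \<psi>1. (\<integral>\<^sup>+y'. w y y' * ennreal ((norm (y - y'))\<^sup>2) \<partial>\<psi>2)
        \<le> ennreal ((\<lambda>i. \<epsilon>\<^sup>2 + ?D\<^sup>2 * (1 - K i i / p i)) (c y))"
      using AE_mass_pos[OF P(2) c]
    proof eventually_elim
      case (elim y)
      \<comment> \<open>Bound for the squared distance to a point of cell \<open>j\<close>: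
        \<open>\<epsilon>\<close> bounds it within the cell of \<open>y\<close>, the diameter
        elsewhere. The additional \<open>\<epsilon>\<^sup>2\<close> off the cell keeps the sum
        linear in \<open>K i i\<close>.\<close>
      let ?g = "\<lambda>j. \<epsilon>\<^sup>2 + ?D\<^sup>2 * (if j = c y then 0 else 1)"
      have p0: "0 < p (c y)" using elim by (simp add: p_def)
      have "(\<integral>\<^sup>+y'. w y y' * ennreal ((norm (y - y'))\<^sup>2) \<partial>\<psi>2)
          \<le> (\<integral>\<^sup>+y'. ennreal (K (c y) (c y') / (p (c y) * q (c y')) * ?g (c y')) \<partial>\<psi>2)"
      proof (rule nn_integral_mono)
        fix y' assume "y' \<in> space \<psi>2"
        then have y': "y' \<in> \<Omega>" using P2_space[OF P(3)] by simp
        have "(norm (y - y'))\<^sup>2 \<le> ?g (c y')"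
        proof (cases "c y' = c y")
          case True
          then have "norm (y - y') \<le> \<epsilon>" using c elim y' by (auto simp: partition_map_def)
          then show ?thesis using True by (simp add: power_mono)
        next
          case False
          have "(norm (y - y'))\<^sup>2 \<le> ?D\<^sup>2" using elim y' by (intro power_mono dist_le_diameter norm_ge_zero) auto
          then show ?thesis using False by (simp add: add_increasing)
        qed
        then show "w y y' * ennreal ((norm (y - y'))\<^sup>2) \<le> ennreal (K (c y) (c y') / (p (c y) * q (c y')) * ?g (c y'))"
          unfolding w_def using K(1) pq
          by (subst ennreal_mult[symmetric]; intro ennreal_leI mult_left_mono divide_nonneg_nonneg mult_nonneg_nonneg zero_le_power2)
      qed
      also have "\<dots> = ennreal ((\<Sum>j<N. K (c y) j * ?g j) / p (c y))"
        by (rule int1[OF _ p0]) simp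
      also have "(\<Sum>j<N. K (c y) j * ?g j) = (\<Sum>j<N. K (c y) j * (\<epsilon>\<^sup>2 + ?D\<^sup>2) - (if j = c y then K (c y) j * ?D\<^sup>2 else 0))"
        by (intro sum.cong refl) (simp add: algebra_simps)
      also have "\<dots> = p (c y) * (\<epsilon>\<^sup>2 + ?D\<^sup>2) - K (c y) (c y) * ?D\<^sup>2"
        using K(2)[of "c y"] elim by (simp add: sum_subtractf sum_distrib_right[symmetric])
      also have "\<dots> / p (c y) = \<epsilon>\<^sup>2 + ?D\<^sup>2 * (1 - K (c y) (c y) / p (c y))"
        using p0 by (simp add: field_simps)
      finally show ?case by simp
    qed
  qed
  also have "\<dots> = ennreal (\<Sum>i<N. (\<epsilon>\<^sup>2 + ?D\<^sup>2 * (1 - K i i / p i)) * mass \<psi>1 c i)"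
  proof (rule nn_integral_partition[OF P(2) c])
    fix i
    \<comment> \<open>\<open>nn_integral_partition\<close> asks for nonnegative coefficients at
      every index. From \<open>N\<close> on the cell is empty, so \<open>p i\<close> and the entry
      of \<open>K\<close> are 0.\<close>
    have "K i i \<le> p i"
    proof (cases "i < N")
      case True
      have "K i i \<le> (\<Sum>j<N. K i j)" using True K(1) by (intro member_le_sum) auto
      then show ?thesis using K(2)[OF True] by simp
    next
      case False
      then have empty: "{x\<in>\<Omega>. c x = i} = {}" using c by (auto simp: partition_map_def)
      have "p i = 0" unfolding p_def mass_def empty by simp
      then show ?thesis using K(6)[of i i] by simp
    qed
    then have "K i i / p i \<le> 1" using pq(1)[of i] by (auto simp: divide_le_eq_1)
    then show "0 \<le> \<epsilon>\<^sup>2 + ?D\<^sup>2 * (1 - K i i / p i)" by simp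
  qed
  also have "(\<Sum>i<N. (\<epsilon>\<^sup>2 + ?D\<^sup>2 * (1 - K i i / p i)) * mass \<psi>1 c i) = (\<Sum>i<N. (\<epsilon>\<^sup>2 + ?D\<^sup>2) * p i - ?D\<^sup>2 * K i i)"
    using K(6) by (intro sum.cong refl) (auto simp: p_def[symmetric] field_simps)
  also have "\<dots> = \<epsilon>\<^sup>2 + ?D\<^sup>2 - ?D\<^sup>2 * (\<Sum>i<N. K i i)"
    using pq(2) by (simp add: sum_subtractf sum_distrib_left[symmetric])
  also have "ennreal \<dots> \<le> ennreal (b\<^sup>2)"
  proof (rule ennreal_leI)
    have "?D\<^sup>2 * (\<Sum>i<N. min (p i) (q i)) \<le> ?D\<^sup>2 * (\<Sum>i<N. K i i)"
      using K(4) by (intro mult_left_mono) auto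
    then show "\<epsilon>\<^sup>2 + ?D\<^sup>2 - ?D\<^sup>2 * (\<Sum>i<N. K i i) \<le> b\<^sup>2"
      using b(1) by (simp add: p_def q_def algebra_simps)
  qed
  finally have mid: "(\<integral>\<^sup>+y. \<integral>\<^sup>+y'. w y y' * ennreal ((norm (y - y'))\<^sup>2) \<partial>\<psi>2 \<partial>\<psi>1) \<le> ennreal (b\<^sup>2)" .
  have "W2 \<phi> \<xi> \<le> (W2 \<phi> \<psi>1 + e/2) + b + (W2 \<psi>2 \<xi> + e/2)"
    by (rule W2_glue[OF P pi1(1) pi2(1) wm w1 w2 _ b(2) _ pi1(2) pi2(2) mid])
      (use e in \<open>auto intro: add_nonneg_pos\<close>)
  then show "W2 \<phi> \<xi> \<le> W2 \<phi> \<psi>1 + b + W2 \<psi>2 \<xi> + e" by simp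
qed

lemma W2_triangle:
  assumes "\<phi> \<in> P2 \<Omega>" "\<psi> \<in> P2 \<Omega>" "\<xi> \<in> P2 \<Omega>"
  shows "W2 \<phi> \<xi> \<le> W2 \<phi> \<psi> + W2 \<psi> \<xi>"
proof (rule field_le_epsilon)
  fix e :: real assume e: "0 < e"
  obtain N c where c: "partition_map N c e" using ex_partition_map[OF e] by blast
  show "W2 \<phi> \<xi> \<le> W2 \<phi> \<psi> + W2 \<psi> \<xi> + e"
    using W2_glue_partition[OF assms(1,2,2,3) c, of e] e mass_sum[OF assms(2) c] by simp
qed

end

text \<open>A simple function below \<open>f\<close> becomes, composed with \<open>T\<close>, a
  measurable function below the integrand on the right; thus the bound survives for nonmeasurable
  \<open>f\<close>.\<close>

lemma nn_integral_distr_le: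
  assumes T: "T \<in> measurable M N"
  shows "(\<integral>\<^sup>+y. f y \<partial>distr M N T) \<le> (\<integral>\<^sup>+x. f (T x) \<partial>M)"
  unfolding nn_integral_def[of "distr M N T"]
proof (rule SUP_least)
  fix g assume "g \<in> {g. simple_function (distr M N T) g \<and> g \<le> f}"
  then have g: "simple_function (distr M N T) g" "g \<le> f" by auto
  have "integral\<^sup>S (distr M N T) g = (\<integral>\<^sup>+y. g y \<partial>distr M N T)"
    using g by (simp add: nn_integral_eq_simple_integral)
  also have "\<dots> = (\<integral>\<^sup>+x. g (T x) \<partial>M)"
    using T borel_measurable_simple_function[OF g(1)] by (intro nn_integral_distr)
  also have "\<dots> \<le> (\<integral>\<^sup>+x. f (T x) \<partial>M)"
    using g(2) by (intro nn_integral_mono) (auto simp: le_fun_def)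
  finally show "integral\<^sup>S (distr M N T) g \<le> (\<integral>\<^sup>+x. f (T x) \<partial>M)" .
qed

text \<open>Symmetry is needed for arbitrary measures, for which the cost may fail to be measurable; hence
  the inequality \<open>nn_integral_distr_le\<close> instead of the change of variables formula.\<close>

lemma W2_commute: "W2 \<phi> \<psi> = W2 \<psi> \<phi>"
proof -
  have le: "(INF \<pi>\<in>couplings \<psi> \<phi>. transport_cost \<pi>) \<le> (INF \<pi>\<in>couplings \<phi> \<psi>. transport_cost \<pi>)"
    for \<phi> \<psi> :: "(real ^ 'n) measure"
  proof (rule INF_greatest)
    fix \<pi> assume p: "\<pi> \<in> couplings \<phi> \<psi>"
    then have [measurable_cong]: "sets \<pi> = sets (\<phi> \<Otimes>\<^sub>M \<psi>)"
      and d: "distr \<pi> \<phi> fst = \<phi>" "distr \<pi> \<psi> snd = \<psi>" by (auto simp: couplings_def)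
    have m: "fst \<in> \<pi> \<rightarrow>\<^sub>M \<phi>" "snd \<in> \<pi> \<rightarrow>\<^sub>M \<psi>" by measurable
    let ?\<pi> = "distr \<pi> (\<psi> \<Otimes>\<^sub>M \<phi>) (\<lambda>z. (snd z, fst z))"
    have "(INF \<pi>\<in>couplings \<psi> \<phi>. transport_cost \<pi>) \<le> transport_cost ?\<pi>"
      by (rule INF_lower) (rule coupling_distr[OF m(2,1) d(2,1)])
    also have "\<dots> \<le> transport_cost \<pi>"
      using nn_integral_distr_le[OF measurable_Pair[OF m(2,1)], of "\<lambda>z. ennreal ((norm (fst z - snd z))\<^sup>2)"]
      by (simp add: transport_cost_def norm_minus_commute)
    finally show "(INF \<pi>\<in>couplings \<psi> \<phi>. transport_cost \<pi>) \<le> transport_cost \<pi>" .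
  qed
  show ?thesis
    using antisym[OF le[of \<psi> \<phi>] le[of \<phi> \<psi>]] by (simp add: W2_def transport_cost_def)
qed

section \<open>Separation of points and total boundedness of the Wasserstein space\<close>

context bounded_domain
begin

lemma W2_refl:
  assumes "\<phi> \<in> P2 \<Omega>"
  shows "W2 \<phi> \<phi> = 0"
proof -
  have "distr \<phi> \<phi> (\<lambda>x. x) = \<phi>" by (rule distr_id)
  then have "(W2 \<phi> \<phi>)\<^sup>2 \<le> 0"
    by (intro W2_sq_leI[OF assms assms, where Q=\<phi> and ?T1.0="\<lambda>x. x" and ?T2.0="\<lambda>x. x"]) auto
  then show ?thesis by simp
qed

text \<open>The easy half of Kantorovich duality together with the bound of the first Wasserstein
  distance by the second. It lets \<open>W2\<close> control enough integrals to separate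
  measures.\<close>

lemma lipschitz_integral_le:
  assumes P: "\<phi> \<in> P2 \<Omega>" "\<psi> \<in> P2 \<Omega>"
    and f: "f \<in> borel_measurable borel_on" "\<And>x. x \<in> \<Omega> \<Longrightarrow> \<bar>f x\<bar> \<le> B"
    and L: "0 \<le> L" "\<And>x y. x \<in> \<Omega> \<Longrightarrow> y \<in> \<Omega> \<Longrightarrow> \<bar>f x - f y\<bar> \<le> L * norm (x - y)"
  shows "(\<integral>x. f x \<partial>\<phi>) \<le> (\<integral>x. f x \<partial>\<psi>) + L * W2 \<phi> \<psi>"
proof -
  have "(\<integral>x. f x \<partial>\<phi>) - (\<integral>x. f x \<partial>\<psi>) \<le> L * (W2 \<phi> \<psi> + e)" if e: "0 < e" for e
  proof -
    let ?c = "W2 \<phi> \<psi> + e"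
    have c: "0 < ?c" using e W2_nonneg by (simp add: add_nonneg_pos)
    obtain \<pi> where p: "\<pi> \<in> couplings \<phi> \<psi>" "transport_cost \<pi> \<le> ennreal (?c\<^sup>2)"
      using W2_less_coupling[OF P, of ?c] e by auto
    interpret prob_space \<pi> using coupling_prob[OF p(1) P] .
    note mem = coupling_mem[OF p(1) P]
    note [measurable_cong] = coupling_sets[OF p(1) P]
    have fst_m: "fst \<in> \<pi> \<rightarrow>\<^sub>M borel_on" and snd_m: "snd \<in> \<pi> \<rightarrow>\<^sub>M borel_on" by measurable
    have fm: "(\<lambda>z. f (fst z)) \<in> borel_measurable \<pi>" "(\<lambda>z. f (snd z)) \<in> borel_measurable \<pi>"
      using measurable_compose[OF fst_m f(1)] measurable_compose[OF snd_m f(1)] .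
    have i1: "integrable \<pi> (\<lambda>z. f (fst z))" and i2: "integrable \<pi> (\<lambda>z. f (snd z))"
      by (rule integrable_const_bound[of _ B]; use fm f(2) mem in auto)+
    have d: "distr \<pi> \<phi> fst = \<phi>" "distr \<pi> \<psi> snd = \<psi>" using p(1) by (auto simp: couplings_def)
    have fp: "f \<in> borel_measurable \<phi>" "f \<in> borel_measurable \<psi>"
      using f(1) measurable_cong_sets[OF P2_sets[OF P(1)] refl] measurable_cong_sets[OF P2_sets[OF P(2)] refl] by auto
    have e1: "(\<integral>x. f x \<partial>\<phi>) = (\<integral>z. f (fst z) \<partial>\<pi>)"
      using integral_distr[OF coupling_measurable(1)[OF p(1)] fp(1)] unfolding d(1) .
    have e2: "(\<integral>x. f x \<partial>\<psi>) = (\<integral>z. f (snd z) \<partial>\<pi>)"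
      using integral_distr[OF coupling_measurable(2)[OF p(1)] fp(2)] unfolding d(2) .
    have nm: "(\<lambda>z. (norm (fst z - snd z))\<^sup>2) \<in> borel_measurable \<pi>"
      using measurable_compose[OF fst_m measurable_id_borel] measurable_compose[OF snd_m measurable_id_borel] by measurable
    have i3: "integrable \<pi> (\<lambda>z. (norm (fst z - snd z))\<^sup>2)"
      by (rule integrable_const_bound[of _ "(diameter \<Omega>)\<^sup>2"])
        (use nm mem in \<open>auto intro!: power_mono dist_le_diameter\<close>)
    have "ennreal (\<integral>z. (norm (fst z - snd z))\<^sup>2 \<partial>\<pi>) \<le> ennreal (?c\<^sup>2)"
      using p(2) nn_integral_eq_integral[OF i3] by (simp add: transport_cost_def)
    then have cost: "(\<integral>z. (norm (fst z - snd z))\<^sup>2 \<partial>\<pi>) \<le> ?c\<^sup>2" by simp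
    have "(\<integral>x. f x \<partial>\<phi>) - (\<integral>x. f x \<partial>\<psi>) = (\<integral>z. f (fst z) - f (snd z) \<partial>\<pi>)"
      unfolding e1 e2 using i1 i2 by simp
    also have "\<dots> \<le> (\<integral>z. L * (?c / 2) + L / (2 * ?c) * (norm (fst z - snd z))\<^sup>2 \<partial>\<pi>)"
    proof (rule integral_mono)
      fix z assume z: "z \<in> space \<pi>"
      let ?n = "norm (fst z - snd z)"
      have "f (fst z) - f (snd z) \<le> L * ?n" using L(2)[OF mem[OF z]] by simp
      \<comment> \<open>The arithmetic-geometric mean inequality, tuned to be sharp at
        \<open>?n = ?c\<close>, replaces Cauchy-Schwarz and reduces everything to the quadratic
        cost.\<close>
      also have "?n \<le> ?c / 2 + ?n\<^sup>2 / (2 * ?c)"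
      proof -
        have "0 \<le> (?n - ?c)\<^sup>2 / (2 * ?c)" using c by simp
        also have "\<dots> = ?c / 2 + ?n\<^sup>2 / (2 * ?c) - ?n" using c by (simp add: field_simps power2_eq_square)
        finally show ?thesis by simp
      qed
      finally show "f (fst z) - f (snd z) \<le> L * (?c / 2) + L / (2 * ?c) * ?n\<^sup>2"
        using L(1) by (simp add: distrib_left mult_left_mono)
    qed (use i1 i2 i3 in auto)
    also have "\<dots> = L * (?c / 2) + L / (2 * ?c) * (\<integral>z. (norm (fst z - snd z))\<^sup>2 \<partial>\<pi>)"
      using i3 by (simp add: prob_space)
    also have "\<dots> \<le> L * (?c / 2) + L / (2 * ?c) * ?c\<^sup>2"
      using cost L(1) c by (intro add_left_mono mult_left_mono) auto
    also have "\<dots> = L * ?c"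
    proof -
      have "L * (d / 2) + L / (2 * d) * d\<^sup>2 = L * d" if "0 < d" for d
        using that by (simp add: power2_eq_square field_simps)
      then show ?thesis using c by blast
    qed
    finally show ?thesis .
  qed
  note * = this
  show ?thesis
  proof (rule field_le_epsilon)
    fix \<delta> :: real assume d: "0 < \<delta>"
    have "L * (\<delta> / (L + 1)) \<le> \<delta>" using L(1) d by (simp add: field_simps)
    then show "(\<integral>x. f x \<partial>\<phi>) \<le> (\<integral>x. f x \<partial>\<psi>) + L * W2 \<phi> \<psi> + \<delta>"
      using *[of "\<delta> / (L + 1)"] L(1) d by (simp add: distrib_left)
  qed
qed

text \<open>At distance 0 the integrals of bounded Lipschitz functions agree. Such functions
  approximate indicators of open sets, and the traces of open sets are an intersection-stable
  generator of the Borel sets of \<open>\<Omega>\<close>.\<close>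

lemma W2_eq_0_imp_eq:
  assumes P: "\<phi> \<in> P2 \<Omega>" "\<psi> \<in> P2 \<Omega>" and 0: "W2 \<phi> \<psi> = 0"
  shows "\<phi> = \<psi>"
proof -
  interpret p: prob_space \<phi> using P2_prob[OF P(1)] .
  interpret q: prob_space \<psi> using P2_prob[OF P(2)] .
  have z0: "W2 \<psi> \<phi> = 0" using W2_commute[of \<phi> \<psi>] 0 by simp
  have open_eq: "emeasure \<phi> (\<Omega> \<inter> U) = emeasure \<psi> (\<Omega> \<inter> U)" if U: "open U" for U
  proof (cases "U = UNIV")
    case True
    then show ?thesis using p.emeasure_space_1 q.emeasure_space_1 P2_space[OF P(1)] P2_space[OF P(2)] by simp
  next
    case False
    \<comment> \<open>\<open>infdist\<close> to the empty set is 0, so this approximation would be 0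
      for \<open>U = UNIV\<close>; that case is split off above. Otherwise \<open>g n\<close> tends
      to the indicator of \<open>U\<close>.\<close>
    define g where "g n x = min 1 (real n * infdist x (- U))" for n :: nat and x :: "real ^ 'n"
    have g0: "0 \<le> g n x" "g n x \<le> 1" for n x by (auto simp: g_def infdist_nonneg)
    have lip: "\<bar>g n x - g n y\<bar> \<le> real n * norm (x - y)" for n x y
    proof -
      have "\<bar>g n x - g n y\<bar> \<le> \<bar>real n * infdist x (- U) - real n * infdist y (- U)\<bar>"
        unfolding g_def by (auto simp: min_def)
      also have "\<dots> = real n * \<bar>infdist x (- U) - infdist y (- U)\<bar>"
        by (simp add: right_diff_distrib[symmetric] abs_mult)
      also have "\<dots> \<le> real n * norm (x - y)"
        using infdist_triangle_abs[of x "- U" y] by (intro mult_left_mono) (auto simp: dist_norm)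
      finally show ?thesis .
    qed
    have gm: "g n \<in> borel_measurable borel_on" for n
      unfolding g_def
      by (intro measurable_restrict_space1 borel_measurable_continuous_onI continuous_intros continuous_on_infdist)
    have eq: "(\<integral>x. g n x \<partial>\<phi>) = (\<integral>x. g n x \<partial>\<psi>)" for n
    proof (rule antisym)
      show "(\<integral>x. g n x \<partial>\<phi>) \<le> (\<integral>x. g n x \<partial>\<psi>)"
        using lipschitz_integral_le[OF P gm[of n], of 1 "real n"] g0 lip 0 by auto
      show "(\<integral>x. g n x \<partial>\<psi>) \<le> (\<integral>x. g n x \<partial>\<phi>)"
        using lipschitz_integral_le[OF P(2,1) gm[of n], of 1 "real n"] g0 lip z0 by auto
    qed
    have lim: "(\<lambda>n. g n x) \<longlonglongrightarrow> indicator U x" for x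
    proof (cases "x \<in> U")
      case True
      have "infdist x (- U) > 0"
      proof -
        have "infdist x (- U) \<noteq> 0"
          using in_closed_iff_infdist_zero[of "- U" x] U False True by auto
        then show ?thesis using infdist_nonneg[of x "- U"] by simp
      qed
      then obtain k :: nat where k: "1 < real k * infdist x (- U)" using ex_less_of_nat_mult by blast
      have "g n x = 1" if "k \<le> n" for n
      proof -
        have "real k * infdist x (- U) \<le> real n * infdist x (- U)"
          using that by (intro mult_right_mono infdist_nonneg) auto
        then show ?thesis using k by (simp add: g_def)
      qed
      then have "\<forall>\<^sub>F n in sequentially. g n x = indicator U x"
        using True unfolding eventually_sequentially by auto
      then show ?thesis by (rule tendsto_eventually)
    next
      case False
      then have "g n x = indicator U x" for n by (simp add: g_def)
      then show ?thesis by simp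
    qed
    have conv: "(\<lambda>n. \<integral>x. g n x \<partial>M) \<longlonglongrightarrow> measure M (\<Omega> \<inter> U)" if M: "M \<in> P2 \<Omega>" for M
    proof -
      interpret m: prob_space M using P2_prob[OF M] .
      have gM: "g n \<in> borel_measurable M" for n
        using gm measurable_cong_sets[OF P2_sets[OF M] refl] by blast
      have iM: "(indicator U :: _ \<Rightarrow> real) \<in> borel_measurable M"
        unfolding measurable_cong_sets[OF P2_sets[OF M] refl]
        using U by (intro measurable_restrict_space1) simp
      have "(\<lambda>n. \<integral>x. g n x \<partial>M) \<longlonglongrightarrow> (\<integral>x. indicator U x \<partial>M)"
        by (rule integral_dominated_convergence[where w="\<lambda>_. 1"]) (use gM iM lim g0 in auto)
      also have "(\<integral>x. indicator U x \<partial>M) = measure M (U \<inter> space M)" by simp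
      finally show ?thesis by (simp add: P2_space[OF M] Int_commute)
    qed
    have "measure \<phi> (\<Omega> \<inter> U) = measure \<psi> (\<Omega> \<inter> U)"
      using LIMSEQ_unique[OF conv[OF P(1)]] conv[OF P(2)] eq by simp
    then show ?thesis by (simp add: p.emeasure_eq_measure q.emeasure_eq_measure)
  qed
  let ?G = "{\<Omega> \<inter> U |U. open U}"
  have "sets borel_on = sets (vimage_algebra \<Omega> (\<lambda>x. x) (sigma UNIV {U. open U}))"
    using restrict_space_eq_vimage_algebra'[of borel \<Omega>] by (simp add: borel_def)
  also have "vimage_algebra \<Omega> (\<lambda>x. x) (sigma UNIV {U. open U}) = sigma \<Omega> ?G"
    by (subst vimage_algebra_sigma) (auto simp: Int_commute)
  also have "sets (sigma \<Omega> ?G) = sigma_sets \<Omega> ?G"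
    by (rule sets_measure_of) auto
  finally have sets: "sets borel_on = sigma_sets \<Omega> ?G" .
  show ?thesis
  proof (rule measure_eqI_generator_eq[where E="?G" and \<Omega>=\<Omega> and A="\<lambda>_. \<Omega>"])
    show "Int_stable ?G"
    proof (rule Int_stableI)
      fix a b assume "a \<in> ?G" "b \<in> ?G"
      then obtain U V where "open U" "open V" "a = \<Omega> \<inter> U" "b = \<Omega> \<inter> V" by auto
      then have "a \<inter> b = \<Omega> \<inter> (U \<inter> V)" "open (U \<inter> V)" by auto
      then show "a \<inter> b \<in> ?G" by blast
    qed
    show "sets \<phi> = sigma_sets \<Omega> ?G" "sets \<psi> = sigma_sets \<Omega> ?G"
      using P2_sets[OF P(1)] P2_sets[OF P(2)] sets by auto
    show "range (\<lambda>_. \<Omega>) \<subseteq> ?G" using open_UNIV by auto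
  qed (use open_eq in auto)
qed

lemma W2_metric: "Metric_space (P2 \<Omega>) W2"
proof
  fix x y z assume x: "x \<in> P2 \<Omega>" and y: "y \<in> P2 \<Omega>"
  show "(W2 x y = 0) = (x = y)" using W2_eq_0_imp_eq[OF x y] W2_refl[OF x] by auto
  show "W2 x z \<le> W2 x y + W2 y z" if "z \<in> P2 \<Omega>" using W2_triangle[OF x y that] .
qed (simp_all add: W2_commute)

text \<open>Measures whose cell masses agree after rounding down to multiples of
  \<open>1 / m\<close> are close by gluing, and only finitely many rounded mass vectors
  exist.\<close>

lemma W2_totally_bounded:
  assumes r: "0 < r"
  shows "\<exists>F\<subseteq>P2 \<Omega>. finite F \<and> (\<forall>\<phi>\<in>P2 \<Omega>. \<exists>\<psi>\<in>F. W2 \<psi> \<phi> < r)"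
proof -
  obtain N c where c: "partition_map N c (r/4)" using ex_partition_map[of "r/4"] r by auto
  let ?D = "diameter \<Omega>"
  \<comment> \<open>Rounding moves at most \<open>N / m\<close> of mass, at cost below
    \<open>r\<^sup>2 / 8\<close>. With cells of size \<open>r / 4\<close> the total is at most
    \<open>3 / 16 * r\<^sup>2\<close>, which is below \<open>(r / 2)\<^sup>2\<close>.\<close>
  obtain m :: nat where m: "?D\<^sup>2 * real N / (r\<^sup>2/8) < real m" using reals_Archimedean2 by blast
  have m0: "0 < real m" by (rule le_less_trans[OF _ m]) simp
  define k where "k \<phi> = restrict (\<lambda>i. nat \<lfloor>real m * mass \<phi> c i\<rfloor>) {..<N}" for \<phi>
  have "k ` P2 \<Omega> \<subseteq> ({..<N} \<rightarrow>\<^sub>E {..m})"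
  proof
    fix v assume "v \<in> k ` P2 \<Omega>"
    then obtain \<phi> where "\<phi> \<in> P2 \<Omega>" and v: "v = k \<phi>" by auto
    interpret prob_space \<phi> using P2_prob[OF \<open>\<phi> \<in> P2 \<Omega>\<close>] .
    have "nat \<lfloor>real m * mass \<phi> c i\<rfloor> \<le> m" for i
    proof -
      have "real m * mass \<phi> c i \<le> real m * 1" unfolding mass_def by (intro mult_left_mono prob_le_1) auto
      then have "\<lfloor>real m * mass \<phi> c i\<rfloor> \<le> int m" by (simp add: floor_le_iff)
      then show ?thesis by simp
    qed
    then show "v \<in> {..<N} \<rightarrow>\<^sub>E {..m}" by (auto simp: v k_def)
  qed
  then have "finite (k ` P2 \<Omega>)" by (rule finite_subset) (simp add: finite_PiE)
  \<comment> \<open>One representative for each rounded vector that occurs, so the net lies inside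
    \<open>P2 \<Omega>\<close>.\<close>
  then obtain F where F: "F \<subseteq> P2 \<Omega>" "finite F" "k ` P2 \<Omega> = k ` F"
    by (meson finite_subset_image subset_refl)
  have "\<exists>\<psi>\<in>F. W2 \<psi> \<phi> < r" if phi: "\<phi> \<in> P2 \<Omega>" for \<phi>
  proof -
    obtain \<psi> where psi: "\<psi> \<in> F" "k \<psi> = k \<phi>" using F(3) phi by (metis imageE image_eqI)
    then have psi': "\<psi> \<in> P2 \<Omega>" using F by auto
    have diff: "mass \<psi> c i - min (mass \<psi> c i) (mass \<phi> c i) \<le> 1 / real m" if "i < N" for i
    proof -
      have "nat \<lfloor>real m * mass \<psi> c i\<rfloor> = nat \<lfloor>real m * mass \<phi> c i\<rfloor>"
        using fun_cong[OF psi(2), of i] that by (simp add: k_def)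
      moreover have "0 \<le> \<lfloor>real m * mass \<psi> c i\<rfloor>" "0 \<le> \<lfloor>real m * mass \<phi> c i\<rfloor>"
        using mass_nonneg by (auto intro!: mult_nonneg_nonneg)
      ultimately have "\<lfloor>real m * mass \<psi> c i\<rfloor> = \<lfloor>real m * mass \<phi> c i\<rfloor>" by linarith
      then have "real m * mass \<psi> c i - real m * mass \<phi> c i \<le> 1" by linarith
      then have "mass \<psi> c i - mass \<phi> c i \<le> 1 / real m" using m0 by (simp add: field_simps)
      then show ?thesis by (auto simp: min_def)
    qed
    have half: "(r/4)\<^sup>2 + x \<le> (r/2)\<^sup>2" if "x \<le> r\<^sup>2 / 8" for x
    proof -
      have "(r/4)\<^sup>2 = r\<^sup>2 / 16" "(r/2)\<^sup>2 = r\<^sup>2 / 4" by (simp_all add: power_divide)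
      then show ?thesis using that zero_le_power2[of r] by linarith
    qed
    have "1 - (\<Sum>i<N. min (mass \<psi> c i) (mass \<phi> c i)) = (\<Sum>i<N. mass \<psi> c i - min (mass \<psi> c i) (mass \<phi> c i))"
      by (simp add: sum_subtractf mass_sum[OF psi' c])
    also have "\<dots> \<le> (\<Sum>i<N. 1 / real m)" using diff by (intro sum_mono) auto
    finally have "?D\<^sup>2 * (1 - (\<Sum>i<N. min (mass \<psi> c i) (mass \<phi> c i))) \<le> ?D\<^sup>2 * (real N / real m)"
      by (intro mult_left_mono) auto
    also have "\<dots> \<le> r\<^sup>2 / 8" using m m0 r by (simp add: field_simps)
    finally have "?D\<^sup>2 * (1 - (\<Sum>i<N. min (mass \<psi> c i) (mass \<phi> c i))) \<le> r\<^sup>2 / 8" .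
    then have "(r/4)\<^sup>2 + ?D\<^sup>2 * (1 - (\<Sum>i<N. min (mass \<psi> c i) (mass \<phi> c i))) \<le> (r/2)\<^sup>2"
      by (rule half)
    from W2_glue_partition[OF psi' psi' phi phi c this] r
    have "W2 \<psi> \<phi> \<le> r/2" by (simp add: W2_refl psi' phi)
    then show ?thesis using psi(1) r by (intro bexI[of _ \<psi>]) auto
  qed
  then show ?thesis using F by blast
qed

end

text \<open>A point of law \<open>M\<close> together with a coin that shows \<open>True\<close> with
  conditional probability \<open>h\<close>, provided \<open>h\<close> has values in
  \<open>[0, 1]\<close>. The coin lets a transport plan switch between two pairs of maps.\<close>

definition switch_law :: "'a measure \<Rightarrow> ('a \<Rightarrow> real) \<Rightarrow> ('a \<times> bool) measure" where
  "switch_law M h = density (M \<Otimes>\<^sub>M count_space UNIV) (\<lambda>zb. ennreal (if snd zb then h (fst zb) else 1 - h (fst zb)))"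

lemma nn_integral_switch_law:
  assumes h[measurable]: "h \<in> borel_measurable M"
    and F[measurable]: "F \<in> borel_measurable (M \<Otimes>\<^sub>M count_space UNIV)"
  shows "(\<integral>\<^sup>+q. F q \<partial>switch_law M h) =
    (\<integral>\<^sup>+z. ennreal (h z) * F (z, True) + ennreal (1 - h z) * F (z, False) \<partial>M)"
proof -
  interpret b: sigma_finite_measure "count_space (UNIV :: bool set)"
    by (rule sigma_finite_measure_count_space_finite) simp
  have "(\<integral>\<^sup>+q. F q \<partial>switch_law M h) =
      (\<integral>\<^sup>+q. ennreal (if snd q then h (fst q) else 1 - h (fst q)) * F q \<partial>(M \<Otimes>\<^sub>M count_space UNIV))"
    unfolding switch_law_def by (rule nn_integral_density) measurable
  also have "\<dots> = (\<integral>\<^sup>+z. \<integral>\<^sup>+b. ennreal (if b then h z else 1 - h z) * F (z, b) \<partial>count_space UNIV \<partial>M)"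
    by (subst b.nn_integral_fst[symmetric]) (simp_all cong: if_cong)
  also have "\<dots> = (\<integral>\<^sup>+z. ennreal (h z) * F (z, True) + ennreal (1 - h z) * F (z, False) \<partial>M)"
    by (intro nn_integral_cong) (simp add: nn_integral_count_space_finite UNIV_bool add.commute)
  finally show ?thesis .
qed

section \<open>Convexity of the squared distance and its bound by total variation\<close>

context bounded_domain
begin

text \<open>The coin decides between the pairs \<open>(u1, u2)\<close> and \<open>(v1, v2)\<close>;
  facts \<open>1\<close> and \<open>2\<close> are the two marginals and \<open>c\<close> is the
  cost. A constant \<open>h\<close> will give mixtures, a position-dependent \<open>h\<close> the
  partial redirection of mass.\<close>

lemma W2_sq_le_switch:
  assumes P: "\<phi> \<in> P2 \<Omega>" "\<xi> \<in> P2 \<Omega>"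
    and h: "h \<in> borel_measurable M"
    and u: "u1 \<in> M \<rightarrow>\<^sub>M \<phi>" "v1 \<in> M \<rightarrow>\<^sub>M \<phi>" "u2 \<in> M \<rightarrow>\<^sub>M \<xi>" "v2 \<in> M \<rightarrow>\<^sub>M \<xi>"
    and 1: "\<And>A. A \<in> sets \<phi> \<Longrightarrow>
      (\<integral>\<^sup>+z. ennreal (h z) * indicator A (u1 z) + ennreal (1 - h z) * indicator A (v1 z) \<partial>M) = emeasure \<phi> A"
    and 2: "\<And>A. A \<in> sets \<xi> \<Longrightarrow>
      (\<integral>\<^sup>+z. ennreal (h z) * indicator A (u2 z) + ennreal (1 - h z) * indicator A (v2 z) \<partial>M) = emeasure \<xi> A"
    and c: "(\<integral>\<^sup>+z. ennreal (h z) * ennreal ((norm (u1 z - u2 z))\<^sup>2)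
      + ennreal (1 - h z) * ennreal ((norm (v1 z - v2 z))\<^sup>2) \<partial>M) \<le> ennreal c" "0 \<le> c"
  shows "(W2 \<phi> \<xi>)\<^sup>2 \<le> c"
proof (rule W2_sq_leI[OF P _ _ _ _ _ c(2), where Q="switch_law M h"
      and ?T1.0="\<lambda>q. if snd q then u1 (fst q) else v1 (fst q)"
      and ?T2.0="\<lambda>q. if snd q then u2 (fst q) else v2 (fst q)"])
  note h[measurable] u[measurable]
  note [measurable_cong] = P2_sets[OF P(1)] P2_sets[OF P(2)]
  have [measurable_cong]: "sets (switch_law M h) = sets (M \<Otimes>\<^sub>M count_space UNIV)"
    by (simp add: switch_law_def)
  show t1: "(\<lambda>q. if snd q then u1 (fst q) else v1 (fst q)) \<in> switch_law M h \<rightarrow>\<^sub>M \<phi>"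
    by measurable
  show t2: "(\<lambda>q. if snd q then u2 (fst q) else v2 (fst q)) \<in> switch_law M h \<rightarrow>\<^sub>M \<xi>"
    by measurable
  have t1': "(\<lambda>q. if snd q then u1 (fst q) else v1 (fst q)) \<in> M \<Otimes>\<^sub>M count_space UNIV \<rightarrow>\<^sub>M \<phi>"
    by measurable
  have t2': "(\<lambda>q. if snd q then u2 (fst q) else v2 (fst q)) \<in> M \<Otimes>\<^sub>M count_space UNIV \<rightarrow>\<^sub>M \<xi>"
    by measurable
  show "distr (switch_law M h) \<phi> (\<lambda>q. if snd q then u1 (fst q) else v1 (fst q)) = \<phi>"
  proof (rule distr_eqI_nn_integral[OF t1])
    fix A assume A: "A \<in> sets \<phi>"
    show "(\<integral>\<^sup>+q. indicator A (if snd q then u1 (fst q) else v1 (fst q)) \<partial>switch_law M h) = emeasure \<phi> A"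
      by (subst nn_integral_switch_law[OF h])
        (use measurable_compose[OF t1' borel_measurable_indicator[OF A]] 1[OF A] in auto)
  qed
  show "distr (switch_law M h) \<xi> (\<lambda>q. if snd q then u2 (fst q) else v2 (fst q)) = \<xi>"
  proof (rule distr_eqI_nn_integral[OF t2])
    fix A assume A: "A \<in> sets \<xi>"
    show "(\<integral>\<^sup>+q. indicator A (if snd q then u2 (fst q) else v2 (fst q)) \<partial>switch_law M h) = emeasure \<xi> A"
      by (subst nn_integral_switch_law[OF h])
        (use measurable_compose[OF t2' borel_measurable_indicator[OF A]] 2[OF A] in auto)
  qed
  have m: "(\<lambda>q. ennreal ((norm ((if snd q then u1 (fst q) else v1 (fst q)) - (if snd q then u2 (fst q) else v2 (fst q))))\<^sup>2))
      \<in> borel_measurable (M \<Otimes>\<^sub>M count_space UNIV)"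
    by (rule measurable_sq_dist)
      (use t1' t2' measurable_cong_sets[OF refl P2_sets[OF P(1)]] measurable_cong_sets[OF refl P2_sets[OF P(2)]] in blast)+
  show "(\<integral>\<^sup>+q. ennreal ((norm ((if snd q then u1 (fst q) else v1 (fst q)) - (if snd q then u2 (fst q) else v2 (fst q))))\<^sup>2)
      \<partial>switch_law M h) \<le> ennreal c"
    by (subst nn_integral_switch_law[OF h m]) (use c in simp)
qed

text \<open>A mixture of couplings couples the mixture: an independent coin of bias
  \<open>1 - t\<close> chooses between near-optimal couplings of the two components with
  \<open>\<xi>\<close>, which are realized together on their product.\<close>

lemma W2_sq_convex:
  assumes P: "\<phi> \<in> P2 \<Omega>" "\<psi> \<in> P2 \<Omega>" "\<xi> \<in> P2 \<Omega>" "\<theta> \<in> P2 \<Omega>"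
    and t: "0 \<le> t" "t \<le> 1"
    and mix: "\<And>A. A \<in> sets borel_on \<Longrightarrow>
      emeasure \<theta> A = ennreal (1 - t) * emeasure \<phi> A + ennreal t * emeasure \<psi> A"
  shows "(W2 \<theta> \<xi>)\<^sup>2 \<le> (1 - t) * (W2 \<phi> \<xi>)\<^sup>2 + t * (W2 \<psi> \<xi>)\<^sup>2"
proof -
  have "(W2 \<theta> \<xi>)\<^sup>2 \<le> (1 - t) * (W2 \<phi> \<xi> + e)\<^sup>2 + t * (W2 \<psi> \<xi> + e)\<^sup>2" if e: "0 < e" for e
  proof -
    obtain \<pi>1 where p1: "\<pi>1 \<in> couplings \<phi> \<xi>" "transport_cost \<pi>1 \<le> ennreal ((W2 \<phi> \<xi> + e)\<^sup>2)"
      using W2_less_coupling[OF P(1,3), of "W2 \<phi> \<xi> + e"] e by auto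
    obtain \<pi>2 where p2: "\<pi>2 \<in> couplings \<psi> \<xi>" "transport_cost \<pi>2 \<le> ennreal ((W2 \<psi> \<xi> + e)\<^sup>2)"
      using W2_less_coupling[OF P(2,3), of "W2 \<psi> \<xi> + e"] e by auto
    interpret p1: prob_space \<pi>1 using coupling_prob[OF p1(1) P(1,3)] .
    interpret p2: prob_space \<pi>2 using coupling_prob[OF p2(1) P(2,3)] .
    interpret p12: pair_sigma_finite \<pi>1 \<pi>2 ..
    note [measurable_cong] = coupling_sets[OF p1(1) P(1,3)] coupling_sets[OF p2(1) P(2,3)]
      P2_sets[OF P(1)] P2_sets[OF P(2)] P2_sets[OF P(3)] P2_sets[OF P(4)]
    have sep: "(\<integral>\<^sup>+z. ennreal (1 - t) * F (fst z) + ennreal t * G (snd z) \<partial>(\<pi>1 \<Otimes>\<^sub>M \<pi>2))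
        = ennreal (1 - t) * (\<integral>\<^sup>+z. F z \<partial>\<pi>1) + ennreal t * (\<integral>\<^sup>+z. G z \<partial>\<pi>2)"
      if [measurable]: "F \<in> borel_measurable \<pi>1" "G \<in> borel_measurable \<pi>2" for F G
    proof -
      have f: "(\<lambda>z. F (fst z)) \<in> borel_measurable (\<pi>1 \<Otimes>\<^sub>M \<pi>2)"
        and g: "(\<lambda>z. G (snd z)) \<in> borel_measurable (\<pi>1 \<Otimes>\<^sub>M \<pi>2)" by measurable
      have "(\<integral>\<^sup>+z. F (fst z) \<partial>(\<pi>1 \<Otimes>\<^sub>M \<pi>2)) = (\<integral>\<^sup>+z. F z \<partial>\<pi>1)"
        by (subst p2.nn_integral_fst[symmetric, OF f]) (simp add: p2.emeasure_space_1)
      moreover have "(\<integral>\<^sup>+z. G (snd z) \<partial>(\<pi>1 \<Otimes>\<^sub>M \<pi>2)) = (\<integral>\<^sup>+z. G z \<partial>\<pi>2)"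
        by (subst p2.nn_integral_fst[symmetric, OF g]) (simp add: p1.emeasure_space_1)
      ultimately show ?thesis using f g by (simp add: nn_integral_add nn_integral_cmult)
    qed
    show ?thesis
    proof (rule W2_sq_le_switch[OF P(4,3), where M="\<pi>1 \<Otimes>\<^sub>M \<pi>2" and h="\<lambda>_. 1 - t"
          and ?u1.0="\<lambda>z. fst (fst z)" and ?v1.0="\<lambda>z. fst (snd z)"
          and ?u2.0="\<lambda>z. snd (fst z)" and ?v2.0="\<lambda>z. snd (snd z)"])
      fix A assume A: "A \<in> sets \<theta>"
      then have A': "A \<in> sets borel_on" "A \<in> sets \<phi>" "A \<in> sets \<psi>"
        using P2_sets[OF P(4)] P2_sets[OF P(1)] P2_sets[OF P(2)] by auto
      show "(\<integral>\<^sup>+z. ennreal (1 - t) * indicator A (fst (fst z)) + ennreal (1 - (1 - t)) * indicator A (fst (snd z))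
          \<partial>(\<pi>1 \<Otimes>\<^sub>M \<pi>2)) = emeasure \<theta> A"
        using sep[of "\<lambda>z. indicator A (fst z)" "\<lambda>z. indicator A (fst z)"]
          coupling_nn_integral(1)[OF p1(1), of "indicator A"] coupling_nn_integral(1)[OF p2(1), of "indicator A"]
          measurable_compose[OF coupling_measurable(1)[OF p1(1)] borel_measurable_indicator[OF A'(2)]]
          measurable_compose[OF coupling_measurable(1)[OF p2(1)] borel_measurable_indicator[OF A'(3)]] A'
        by (simp add: mix)
    next
      fix A assume A: "A \<in> sets \<xi>"
      show "(\<integral>\<^sup>+z. ennreal (1 - t) * indicator A (snd (fst z)) + ennreal (1 - (1 - t)) * indicator A (snd (snd z))
          \<partial>(\<pi>1 \<Otimes>\<^sub>M \<pi>2)) = emeasure \<xi> A"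
        using sep[of "\<lambda>z. indicator A (snd z)" "\<lambda>z. indicator A (snd z)"]
          coupling_nn_integral(2)[OF p1(1), of "indicator A"] coupling_nn_integral(2)[OF p2(1), of "indicator A"]
          measurable_compose[OF coupling_measurable(2)[OF p1(1)] borel_measurable_indicator[OF A]]
          measurable_compose[OF coupling_measurable(2)[OF p2(1)] borel_measurable_indicator[OF A]] A t
        by (simp add: distrib_right[symmetric] ennreal_plus[symmetric] del: ennreal_plus)
    next
      have "(\<integral>\<^sup>+z. ennreal (1 - t) * ennreal ((norm (fst (fst z) - snd (fst z)))\<^sup>2)
          + ennreal t * ennreal ((norm (fst (snd z) - snd (snd z)))\<^sup>2) \<partial>(\<pi>1 \<Otimes>\<^sub>M \<pi>2))
          = ennreal (1 - t) * transport_cost \<pi>1 + ennreal t * transport_cost \<pi>2"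
        unfolding transport_cost_def
        by (rule sep[of "\<lambda>z. ennreal ((norm (fst z - snd z))\<^sup>2)" "\<lambda>z. ennreal ((norm (fst z - snd z))\<^sup>2)"]; measurable)
      also have "\<dots> \<le> ennreal (1 - t) * ennreal ((W2 \<phi> \<xi> + e)\<^sup>2) + ennreal t * ennreal ((W2 \<psi> \<xi> + e)\<^sup>2)"
        by (intro add_mono mult_left_mono p1 p2) auto
      also have "\<dots> = ennreal ((1 - t) * (W2 \<phi> \<xi> + e)\<^sup>2 + t * (W2 \<psi> \<xi> + e)\<^sup>2)"
        using t by (simp add: ennreal_mult)
      finally show "(\<integral>\<^sup>+z. ennreal (1 - t) * ennreal ((norm (fst (fst z) - snd (fst z)))\<^sup>2)
          + ennreal (1 - (1 - t)) * ennreal ((norm (fst (snd z) - snd (snd z)))\<^sup>2) \<partial>(\<pi>1 \<Otimes>\<^sub>M \<pi>2))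
          \<le> ennreal ((1 - t) * (W2 \<phi> \<xi> + e)\<^sup>2 + t * (W2 \<psi> \<xi> + e)\<^sup>2)" by simp
    next
      show "0 \<le> (1 - t) * (W2 \<phi> \<xi> + e)\<^sup>2 + t * (W2 \<psi> \<xi> + e)\<^sup>2" using t by simp
    qed measurable
  qed
  then have "\<forall>\<^sub>F e in at_right 0. (W2 \<theta> \<xi>)\<^sup>2 \<le> (1 - t) * (W2 \<phi> \<xi> + e)\<^sup>2 + t * (W2 \<psi> \<xi> + e)\<^sup>2"
    using eventually_at_right_less[of "0::real"] by (auto elim: eventually_mono)
  moreover have "((\<lambda>e. (1 - t) * (W2 \<phi> \<xi> + e)\<^sup>2 + t * (W2 \<psi> \<xi> + e)\<^sup>2) \<longlongrightarrow>
      (1 - t) * (W2 \<phi> \<xi> + 0)\<^sup>2 + t * (W2 \<psi> \<xi> + 0)\<^sup>2) (at_right 0)"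
    by (intro tendsto_intros)
  ultimately show ?thesis
    using tendsto_lowerbound[of _ _ "at_right (0::real)"] by fastforce
qed

text \<open>The common part of \<open>\<phi>\<close> and \<open>\<psi>\<close> keeps its partners in a coupling of \<open>\<phi>\<close> and \<open>\<xi>\<close>; the remaining
  mass, of size the total variation distance, is redirected independently.\<close>

lemma W2_sq_le_tv:
  fixes f g :: "real ^ 'n \<Rightarrow> real"
  assumes xi: "\<xi> \<in> P2 \<Omega>"
    and nu: "sets \<nu> = sets borel_on"
    and f: "integrable \<nu> f" "\<And>x. 0 \<le> f x" "(\<integral>x. f x \<partial>\<nu>) = 1"
    and g: "integrable \<nu> g" "\<And>x. 0 \<le> g x" "(\<integral>x. g x \<partial>\<nu>) = 1"
  defines "d \<equiv> (\<integral>x. \<bar>f x - g x\<bar> \<partial>\<nu>) / 2"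
  shows "(W2 (density \<nu> (\<lambda>x. ennreal (g x))) \<xi>)\<^sup>2 \<le>
    (W2 (density \<nu> (\<lambda>x. ennreal (f x))) \<xi>)\<^sup>2 + (diameter \<Omega>)\<^sup>2 * d"
proof -
  let ?D = "diameter \<Omega>"
  define \<phi> where "\<phi> = density \<nu> (\<lambda>x. ennreal (f x))"
  define \<psi> where "\<psi> = density \<nu> (\<lambda>x. ennreal (g x))"
  note [measurable] = borel_measurable_integrable[OF f(1)] borel_measurable_integrable[OF g(1)]
  note [measurable_cong] = nu P2_sets[OF xi]
  have sp: "space \<nu> = \<Omega>" using sets_eq_imp_space_eq[OF nu] by (simp add: space_restrict_space)
  have dens_P2: "density \<nu> (\<lambda>x. ennreal (k x)) \<in> P2 \<Omega>"
    if k: "integrable \<nu> k" "\<And>x. 0 \<le> k x" "(\<integral>x. k x \<partial>\<nu>) = 1" for k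
  proof (rule P2I)
    have "emeasure (density \<nu> (\<lambda>x. ennreal (k x))) \<Omega> = (\<integral>\<^sup>+x. ennreal (k x) * indicator \<Omega> x \<partial>\<nu>)"
      using borel_measurable_integrable[OF k(1)] sets.top[of \<nu>] sp by (subst emeasure_density) auto
    also have "\<dots> = (\<integral>\<^sup>+x. ennreal (k x) \<partial>\<nu>)"
      by (rule nn_integral_cong) (simp add: sp)
    also have "\<dots> = 1" using k by (simp add: nn_integral_eq_integral)
    finally show "prob_space (density \<nu> (\<lambda>x. ennreal (k x)))" by (intro prob_spaceI) (simp add: sp)
  qed (simp add: nu)
  have phi: "\<phi> \<in> P2 \<Omega>" unfolding \<phi>_def by (rule dens_P2[OF f])
  have psi: "\<psi> \<in> P2 \<Omega>" unfolding \<psi>_def by (rule dens_P2[OF g])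
  have s[measurable_cong]: "sets \<phi> = sets borel_on" "sets \<psi> = sets borel_on" using P2_sets phi psi by auto
  define m where "m x = min (f x) (g x)" for x
  have im: "integrable \<nu> m" unfolding m_def using f g by (intro integrable_min)
  have [measurable]: "m \<in> borel_measurable \<nu>" using im by auto
  have d_f: "(\<integral>x. f x - m x \<partial>\<nu>) = d" and d_g: "(\<integral>x. g x - m x \<partial>\<nu>) = d"
  proof -
    have "(\<integral>x. \<bar>f x - g x\<bar> \<partial>\<nu>) = (\<integral>x. f x + g x - 2 * m x \<partial>\<nu>)"
      by (intro Bochner_Integration.integral_cong) (auto simp: m_def min_def)
    then have "d = 1 - (\<integral>x. m x \<partial>\<nu>)" using f g im by (simp add: d_def)
    then show "(\<integral>x. f x - m x \<partial>\<nu>) = d" "(\<integral>x. g x - m x \<partial>\<nu>) = d" using f g im by auto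
  qed
  have m0: "0 \<le> m x" "m x \<le> f x" "m x \<le> g x" for x using f g by (auto simp: m_def)
  have d_f': "(\<integral>\<^sup>+x. ennreal (f x - m x) \<partial>\<nu>) = ennreal d"
    using f im m0 d_f by (subst nn_integral_eq_integral) auto
  have d_g': "(\<integral>\<^sup>+x. ennreal (g x - m x) \<partial>\<nu>) = ennreal d"
    using g im m0 d_g by (subst nn_integral_eq_integral) auto
  have d0: "0 \<le> d" by (simp add: d_def)
  have "(W2 \<psi> \<xi>)\<^sup>2 \<le> (W2 \<phi> \<xi>)\<^sup>2 + ?D\<^sup>2 * d"
  proof (cases "d = 0")
    case True
    have "AE x in \<nu>. f x = m x" "AE x in \<nu>. g x = m x"
      using integral_nonneg_eq_0_iff_AE[of \<nu> "\<lambda>x. f x - m x"] integral_nonneg_eq_0_iff_AE[of \<nu> "\<lambda>x. g x - m x"]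
        f g im m0 d_f d_g True by auto
    then have "AE x in \<nu>. ennreal (f x) = ennreal (g x)" by eventually_elim auto
    then have "\<phi> = \<psi>" unfolding \<phi>_def \<psi>_def by (intro density_cong) auto
    then show ?thesis using True by simp
  next
    case False
    then have d: "0 < d" using d0 by simp
    \<comment> \<open>The normalized excess of \<open>g\<close> over the common part: redirected
      mass takes its new position from \<open>\<rho>\<close>. The normalization is why
      \<open>d = 0\<close> was treated separately.\<close>
    define \<rho> where "\<rho> = density \<nu> (\<lambda>x. ennreal ((g x - m x) / d))"
    have rho: "\<rho> \<in> P2 \<Omega>" unfolding \<rho>_def
      using g im m0 d d_g by (intro dens_P2) auto
    interpret r: prob_space \<rho> using P2_prob[OF rho] .
    have sr[measurable_cong]: "sets \<rho> = sets borel_on" using P2_sets rho by auto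
    \<comment> \<open>The fraction of the mass of \<open>\<phi>\<close> at \<open>x\<close> that is
      kept. Where \<open>f\<close> is 0 the quotient is 0, and \<open>h x * f x = m x\<close> still
      holds.\<close>
    define h where "h x = m x / f x" for x
    have h: "0 \<le> h x" "h x \<le> 1" for x using m0[of x] f(2)[of x] by (auto simp: h_def divide_le_eq_1 less_le)
    have h_m: "h \<in> borel_measurable borel_on" unfolding h_def by measurable
    have hf: "h x * f x = m x" for x using m0[of x] by (cases "f x = 0") (auto simp: h_def)
    have nn_phi: "(\<integral>\<^sup>+x. ennreal (F x) \<partial>\<phi>) = (\<integral>\<^sup>+x. ennreal (F x * f x) \<partial>\<nu>)"
      if F: "F \<in> borel_measurable borel_on" "\<And>x. 0 \<le> F x" for F
    proof -
      note F(1)[measurable]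
      show ?thesis unfolding \<phi>_def
        using F(2) f(2) by (subst nn_integral_density) (auto simp: ennreal_mult mult.commute)
    qed
    have "(W2 \<psi> \<xi>)\<^sup>2 \<le> (W2 \<phi> \<xi> + e)\<^sup>2 + ?D\<^sup>2 * d" if e: "0 < e" for e
    proof -
      obtain \<pi> where p: "\<pi> \<in> couplings \<phi> \<xi>" "transport_cost \<pi> \<le> ennreal ((W2 \<phi> \<xi> + e)\<^sup>2)"
        using W2_less_coupling[OF phi xi, of "W2 \<phi> \<xi> + e"] e by auto
      interpret p: prob_space \<pi> using coupling_prob[OF p(1) phi xi] .
      interpret pr: pair_sigma_finite \<pi> \<rho> ..
      note [measurable_cong] = coupling_sets[OF p(1) phi xi]
      note h_m[measurable]
      have fst_m[measurable]: "fst \<in> \<pi> \<rightarrow>\<^sub>M borel_on" and snd_m[measurable]: "snd \<in> \<pi> \<rightarrow>\<^sub>M borel_on" by measurable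
      have h1: "(\<integral>\<^sup>+z. ennreal (1 - h (fst z)) \<partial>\<pi>) = ennreal d"
      proof -
        have "(\<integral>\<^sup>+z. ennreal (1 - h (fst z)) \<partial>\<pi>) = (\<integral>\<^sup>+x. ennreal (1 - h x) \<partial>\<phi>)"
          by (rule coupling_nn_integral(1)[OF p(1)]) measurable
        also have "\<dots> = (\<integral>\<^sup>+x. ennreal ((1 - h x) * f x) \<partial>\<nu>)" by (rule nn_phi) (use h in auto)
        also have "\<dots> = ennreal d" unfolding left_diff_distrib hf using d_f' by simp
        finally show ?thesis .
      qed
      \<comment> \<open>Only the first coordinate is changed when the coin says to redirect, so the
        second marginal stays \<open>\<xi>\<close>. Redirection happens with total probability
        \<open>d\<close> (\<open>h1\<close>).\<close>
      show ?thesis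
      proof (rule W2_sq_le_switch[OF psi xi, where M="\<pi> \<Otimes>\<^sub>M \<rho>" and h="\<lambda>z. h (fst (fst z))"
          and ?u1.0="\<lambda>z. fst (fst z)" and ?v1.0="\<lambda>z. snd z"
          and ?u2.0="\<lambda>z. snd (fst z)" and ?v2.0="\<lambda>z. snd (fst z)"])
        fix A assume A: "A \<in> sets \<psi>"
        then have A'[measurable]: "A \<in> sets borel_on" using s by auto
        have Ar: "A \<in> sets \<rho>" "A \<in> sets \<nu>" using A' sr nu by auto
        have "(\<integral>\<^sup>+z. ennreal (h (fst (fst z))) * indicator A (fst (fst z))
            + ennreal (1 - h (fst (fst z))) * indicator A (snd z) \<partial>(\<pi> \<Otimes>\<^sub>M \<rho>))
          = (\<integral>\<^sup>+z. \<integral>\<^sup>+x. ennreal (h (fst z)) * indicator A (fst z) + ennreal (1 - h (fst z)) * indicator A x \<partial>\<rho> \<partial>\<pi>)"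
          by (subst r.nn_integral_fst[symmetric]) simp_all
        also have "\<dots> = (\<integral>\<^sup>+z. ennreal (h (fst z)) * indicator A (fst z) + ennreal (1 - h (fst z)) * emeasure \<rho> A \<partial>\<pi>)"
          using Ar by (intro nn_integral_cong) (simp add: nn_integral_add nn_integral_cmult r.emeasure_space_1)
        also have "\<dots> = (\<integral>\<^sup>+z. ennreal (h (fst z)) * indicator A (fst z) \<partial>\<pi>) + ennreal d * emeasure \<rho> A"
          by (subst nn_integral_add) (simp_all add: nn_integral_multc h1)
        also have "(\<integral>\<^sup>+z. ennreal (h (fst z)) * indicator A (fst z) \<partial>\<pi>) = (\<integral>\<^sup>+x. ennreal (h x) * indicator A x \<partial>\<phi>)"
          by (rule coupling_nn_integral(1)[OF p(1)]) measurable
        also have "\<dots> = (\<integral>\<^sup>+x. ennreal (h x * indicator A x) \<partial>\<phi>)"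
          by (intro nn_integral_cong) (simp add: indicator_def)
        also have "\<dots> = (\<integral>\<^sup>+x. ennreal (h x * indicator A x * f x) \<partial>\<nu>)"
          by (rule nn_phi) (use h in auto)
        also have "\<dots> = (\<integral>\<^sup>+x. ennreal (m x) * indicator A x \<partial>\<nu>)"
          using hf by (intro nn_integral_cong) (auto simp: indicator_def)
        also have "ennreal d * emeasure \<rho> A = (\<integral>\<^sup>+x. ennreal (g x - m x) * indicator A x \<partial>\<nu>)"
        proof -
          have "ennreal d * emeasure \<rho> A = ennreal d * (\<integral>\<^sup>+x. ennreal ((g x - m x) / d) * indicator A x \<partial>\<nu>)"
            unfolding \<rho>_def using Ar by (subst emeasure_density) auto
          also have "\<dots> = (\<integral>\<^sup>+x. ennreal d * (ennreal ((g x - m x) / d) * indicator A x) \<partial>\<nu>)"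
            using Ar by (subst nn_integral_cmult) auto
          also have "\<dots> = (\<integral>\<^sup>+x. ennreal (g x - m x) * indicator A x \<partial>\<nu>)"
            using d m0 by (intro nn_integral_cong) (simp add: mult.assoc[symmetric] ennreal_mult[symmetric])
          finally show ?thesis .
        qed
        also have "(\<integral>\<^sup>+x. ennreal (m x) * indicator A x \<partial>\<nu>) + (\<integral>\<^sup>+x. ennreal (g x - m x) * indicator A x \<partial>\<nu>)
          = (\<integral>\<^sup>+x. ennreal (m x) * indicator A x + ennreal (g x - m x) * indicator A x \<partial>\<nu>)"
          using Ar by (subst nn_integral_add) auto
        also have "\<dots> = (\<integral>\<^sup>+x. ennreal (g x) * indicator A x \<partial>\<nu>)"
          using m0 by (intro nn_integral_cong) (simp add: distrib_right[symmetric] ennreal_plus[symmetric] del: ennreal_plus)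
        also have "\<dots> = emeasure \<psi> A"
          unfolding \<psi>_def using Ar by (subst emeasure_density) auto
        finally show "(\<integral>\<^sup>+z. ennreal (h (fst (fst z))) * indicator A (fst (fst z))
            + ennreal (1 - h (fst (fst z))) * indicator A (snd z) \<partial>(\<pi> \<Otimes>\<^sub>M \<rho>)) = emeasure \<psi> A" .
      next
        fix A assume A: "A \<in> sets \<xi>"
        then have [measurable]: "A \<in> sets borel_on" using P2_sets[OF xi] by auto
        have "(\<integral>\<^sup>+z. ennreal (h (fst (fst z))) * indicator A (snd (fst z))
            + ennreal (1 - h (fst (fst z))) * indicator A (snd (fst z)) \<partial>(\<pi> \<Otimes>\<^sub>M \<rho>))
          = (\<integral>\<^sup>+z. indicator A (snd (fst z)) \<partial>(\<pi> \<Otimes>\<^sub>M \<rho>))"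
          using h by (intro nn_integral_cong) (simp add: distrib_right[symmetric] ennreal_plus[symmetric] del: ennreal_plus)
        also have "\<dots> = (\<integral>\<^sup>+z. indicator A (snd z) \<partial>\<pi>)"
          by (subst r.nn_integral_fst[symmetric]) (simp_all add: r.emeasure_space_1)
        also have "\<dots> = (\<integral>\<^sup>+x. indicator A x \<partial>\<xi>)"
          by (rule coupling_nn_integral(2)[OF p(1)]) measurable
        also have "\<dots> = emeasure \<xi> A" using A by simp
        finally show "(\<integral>\<^sup>+z. ennreal (h (fst (fst z))) * indicator A (snd (fst z))
            + ennreal (1 - h (fst (fst z))) * indicator A (snd (fst z)) \<partial>(\<pi> \<Otimes>\<^sub>M \<rho>)) = emeasure \<xi> A" .
      next
        have m3: "(\<lambda>z. ennreal ((norm (fst (fst z) - snd (fst z)))\<^sup>2)) \<in> borel_measurable (\<pi> \<Otimes>\<^sub>M \<rho>)"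
          by (rule measurable_sq_dist) measurable
        have "(\<integral>\<^sup>+z. ennreal (h (fst (fst z))) * ennreal ((norm (fst (fst z) - snd (fst z)))\<^sup>2)
            + ennreal (1 - h (fst (fst z))) * ennreal ((norm (snd z - snd (fst z)))\<^sup>2) \<partial>(\<pi> \<Otimes>\<^sub>M \<rho>))
          \<le> (\<integral>\<^sup>+z. ennreal ((norm (fst (fst z) - snd (fst z)))\<^sup>2) + ennreal (1 - h (fst (fst z))) * ennreal (?D\<^sup>2) \<partial>(\<pi> \<Otimes>\<^sub>M \<rho>))"
        proof (rule nn_integral_mono)
          fix z assume "z \<in> space (\<pi> \<Otimes>\<^sub>M \<rho>)"
          then have z: "fst z \<in> space \<pi>" "snd z \<in> \<Omega>" by (auto simp: space_pair_measure P2_space[OF rho])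
          have "(norm (snd z - snd (fst z)))\<^sup>2 \<le> ?D\<^sup>2"
            by (intro power_mono dist_le_diameter norm_ge_zero z coupling_mem[OF p(1) phi xi])
          moreover have "ennreal (h (fst (fst z))) * ennreal ((norm (fst (fst z) - snd (fst z)))\<^sup>2)
              \<le> ennreal ((norm (fst (fst z) - snd (fst z)))\<^sup>2)"
            using h[of "fst (fst z)"] by (simp add: ennreal_mult[symmetric] ennreal_leI mult_left_le_one_le)
          ultimately show "ennreal (h (fst (fst z))) * ennreal ((norm (fst (fst z) - snd (fst z)))\<^sup>2)
            + ennreal (1 - h (fst (fst z))) * ennreal ((norm (snd z - snd (fst z)))\<^sup>2)
            \<le> ennreal ((norm (fst (fst z) - snd (fst z)))\<^sup>2) + ennreal (1 - h (fst (fst z))) * ennreal (?D\<^sup>2)"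
            by (intro add_mono mult_left_mono ennreal_leI) auto
        qed
        also have "\<dots> = (\<integral>\<^sup>+z. ennreal ((norm (fst (fst z) - snd (fst z)))\<^sup>2) \<partial>(\<pi> \<Otimes>\<^sub>M \<rho>))
            + (\<integral>\<^sup>+z. ennreal (1 - h (fst (fst z))) \<partial>(\<pi> \<Otimes>\<^sub>M \<rho>)) * ennreal (?D\<^sup>2)"
          using m3 by (simp add: nn_integral_add nn_integral_multc)
        also have "(\<integral>\<^sup>+z. ennreal ((norm (fst (fst z) - snd (fst z)))\<^sup>2) \<partial>(\<pi> \<Otimes>\<^sub>M \<rho>)) = transport_cost \<pi>"
          unfolding transport_cost_def by (subst r.nn_integral_fst[symmetric, OF m3]) (simp add: r.emeasure_space_1)
        also have "(\<integral>\<^sup>+z. ennreal (1 - h (fst (fst z))) \<partial>(\<pi> \<Otimes>\<^sub>M \<rho>)) = ennreal d"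
          by (subst r.nn_integral_fst[symmetric]) (simp_all add: r.emeasure_space_1 h1)
        also have "transport_cost \<pi> + ennreal d * ennreal (?D\<^sup>2) \<le> ennreal ((W2 \<phi> \<xi> + e)\<^sup>2) + ennreal d * ennreal (?D\<^sup>2)"
          by (intro add_right_mono p)
        also have "\<dots> = ennreal ((W2 \<phi> \<xi> + e)\<^sup>2 + ?D\<^sup>2 * d)"
          using d by (simp add: ennreal_mult mult.commute)
        finally show "(\<integral>\<^sup>+z. ennreal (h (fst (fst z))) * ennreal ((norm (fst (fst z) - snd (fst z)))\<^sup>2)
            + ennreal (1 - h (fst (fst z))) * ennreal ((norm (snd z - snd (fst z)))\<^sup>2) \<partial>(\<pi> \<Otimes>\<^sub>M \<rho>))
          \<le> ennreal ((W2 \<phi> \<xi> + e)\<^sup>2 + ?D\<^sup>2 * d)" .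
      next
        show "0 \<le> (W2 \<phi> \<xi> + e)\<^sup>2 + ?D\<^sup>2 * d" using d by simp
      qed measurable
    qed
    then have "\<forall>\<^sub>F e in at_right 0. (W2 \<psi> \<xi>)\<^sup>2 \<le> (W2 \<phi> \<xi> + e)\<^sup>2 + ?D\<^sup>2 * d"
      using eventually_at_right_less[of "0::real"] by (auto elim: eventually_mono)
    moreover have "((\<lambda>e. (W2 \<phi> \<xi> + e)\<^sup>2 + ?D\<^sup>2 * d) \<longlongrightarrow> (W2 \<phi> \<xi> + 0)\<^sup>2 + ?D\<^sup>2 * d) (at_right 0)"
      by (intro tendsto_intros)
    ultimately show ?thesis
      using tendsto_lowerbound[of _ _ "at_right (0::real)"] by fastforce
  qed
  then show ?thesis by (simp add: \<phi>_def \<psi>_def)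
qed

end

section \<open>Borel sets of totally bounded metric spaces\<close>

text \<open>Isolates what is needed from the Wasserstein space for measurability: the sets of
  \<open>M\<close> are its Borel sets, and finite nets at every scale give a countable family of
  sets fine enough for products.\<close>

locale totally_bounded_metric = Metric_space X d for X :: "'a set" and d :: "'a \<Rightarrow> 'a \<Rightarrow> real" +
  fixes M :: "'a measure"
  assumes sets_M: "sets M = sets (metric_borel X d)"
    and net: "\<And>r. 0 < r \<Longrightarrow> \<exists>F\<subseteq>X. finite F \<and> (\<forall>x\<in>X. \<exists>y\<in>F. d y x < r)"
begin

lemma sets_metric_borel: "sets (metric_borel X d) = sigma_sets X {U. openin mtopology U}"
  unfolding metric_borel_def by (rule sets_measure_of) (auto simp: openin_mtopology)

lemma space_M: "space M = X"
  using sets_eq_imp_space_eq[OF sets_M] by (simp add: metric_borel_def space_measure_of_conv)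

lemma openin_sets: "openin mtopology U \<Longrightarrow> U \<in> sets M"
  unfolding sets_M sets_metric_borel by auto

lemma dist_measurable: "x \<in> X \<Longrightarrow> (\<lambda>y. d x y) \<in> borel_measurable M"
proof (rule borel_measurableI_less)
  fix r assume "x \<in> X"
  then have "{y \<in> space M. d x y < r} = mball x r" by (auto simp: space_M)
  then show "{y \<in> space M. d x y < r} \<in> sets M" using openin_sets[OF openin_mball] by simp
qed

text \<open>Plays the role of a countable base: balls of radius \<open>1 / (n + 1)\<close> around
  finite nets, the ball being found with \<open>x\<close> inside it rather than at its
  center.\<close>

lemma countable_network:
  "\<exists>C. countable C \<and> C \<subseteq> sets M \<and> (\<forall>x\<in>X. \<forall>r>0. \<exists>S\<in>C. x \<in> S \<and> S \<subseteq> mball x r)"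
proof -
  have "\<exists>F\<subseteq>X. finite F \<and> (\<forall>x\<in>X. \<exists>y\<in>F. d y x < 1 / real (Suc n))" for n
    by (rule net) simp
  then obtain F where F: "\<And>n. F n \<subseteq> X" "\<And>n. finite (F n)"
    "\<And>n x. x \<in> X \<Longrightarrow> \<exists>y\<in>F n. d y x < 1 / real (Suc n)" by metis
  let ?C = "\<Union>n. (\<lambda>y. mball y (1 / real (Suc n))) ` F n"
  show ?thesis
  proof (intro exI[of _ ?C] conjI ballI allI impI)
    show "countable ?C" using F(2) by (intro countable_UN) (auto intro: countable_finite)
    show "?C \<subseteq> sets M" using openin_sets[OF openin_mball] by auto
    fix x and r :: real assume x: "x \<in> X" and r: "0 < r"
    obtain n where n: "1 / real (Suc n) < r / 2"
      using reals_Archimedean[of "r/2"] r by (auto simp: inverse_eq_divide)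
    obtain y where y: "y \<in> F n" "d y x < 1 / real (Suc n)" using F(3)[OF x] by blast
    then have yX: "y \<in> X" using F(1) by blast
    have "mball y (1 / real (Suc n)) \<subseteq> mball x r"
    proof
      fix z assume "z \<in> mball y (1 / real (Suc n))"
      then have z: "z \<in> X" "d y z < 1 / real (Suc n)" by auto
      have "d x z \<le> d y x + d y z" using triangle[OF x yX z(1)] by (simp add: commute)
      also have "\<dots> < r" using y(2) z(2) n by simp
      finally show "z \<in> mball x r" using x z by simp
    qed
    moreover have "x \<in> mball y (1 / real (Suc n))" using x y yX by simp
    ultimately show "\<exists>S\<in>?C. x \<in> S \<and> S \<subseteq> mball x r" using y(1) by blast
  qed
qed

text \<open>Distinct points lie in disjoint members of the network, so the complement of the
  diagonal is a countable union of measurable rectangles. The constant pseudometric is a multiple of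
  its indicator.\<close>

lemma off_diagonal_sets: "{z \<in> space (M \<Otimes>\<^sub>M M). fst z \<noteq> snd z} \<in> sets (M \<Otimes>\<^sub>M M)"
proof -
  obtain C where C: "countable C" "C \<subseteq> sets M"
    and net: "\<forall>x\<in>X. \<forall>r>0. \<exists>S\<in>C. x \<in> S \<and> S \<subseteq> mball x r"
    using countable_network by (elim exE conjE)
  let ?I = "{p \<in> C \<times> C. fst p \<inter> snd p = {}}"
  have "{z \<in> space (M \<Otimes>\<^sub>M M). fst z \<noteq> snd z} = (\<Union>p\<in>?I. fst p \<times> snd p)"
  proof (intro equalityI subsetI)
    fix z assume "z \<in> {z \<in> space (M \<Otimes>\<^sub>M M). fst z \<noteq> snd z}"
    then obtain x y where z: "z = (x, y)" "x \<in> X" "y \<in> X" "x \<noteq> y"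
      by (auto simp: space_pair_measure space_M)
    then have r: "0 < d x y / 2" using zero nonneg[of x y] by (auto simp: less_le)
    obtain S T where S: "S \<in> C" "x \<in> S" "S \<subseteq> mball x (d x y / 2)"
      and T: "T \<in> C" "y \<in> T" "T \<subseteq> mball y (d x y / 2)"
      using net z(2,3) r by meson
    have "S \<inter> T = {}"
    proof (rule ccontr)
      assume "S \<inter> T \<noteq> {}"
      then obtain w where "w \<in> mball x (d x y / 2)" "w \<in> mball y (d x y / 2)" using S T by blast
      then have "w \<in> X" "d x w < d x y / 2" "d w y < d x y / 2" by (auto simp: commute)
      then show False using triangle[OF z(2) \<open>w \<in> X\<close> z(3)] by simp
    qed
    then show "z \<in> (\<Union>p\<in>?I. fst p \<times> snd p)"
      using S T z by (intro UN_I[of "(S, T)"]) auto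
  next
    fix z assume "z \<in> (\<Union>p\<in>?I. fst p \<times> snd p)"
    then obtain S T where ST: "S \<in> C" "T \<in> C" "S \<inter> T = {}" "fst z \<in> S" "snd z \<in> T" by auto
    then have "S \<subseteq> space M" "T \<subseteq> space M" using C(2) sets.sets_into_space by blast+
    then show "z \<in> {z \<in> space (M \<Otimes>\<^sub>M M). fst z \<noteq> snd z}"
      using ST by (auto simp: space_pair_measure mem_Times_iff)
  qed
  also have "\<dots> \<in> sets (M \<Otimes>\<^sub>M M)"
  proof (rule sets.countable_UN'')
    show "countable ?I" by (rule countable_subset[OF _ countable_SIGMA[OF C(1) C(1)]]) auto
    show "fst p \<times> snd p \<in> sets (M \<Otimes>\<^sub>M M)" if "p \<in> ?I" for p
      using that C(2) by (intro pair_measureI) auto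
  qed
  finally show ?thesis .
qed

text \<open>The second hypothesis is openness in the maximum metric. Around each point a box with
  sides in the countable network fits into \<open>V\<close>, and there are only countably many such
  boxes.\<close>

lemma open_box_sets:
  fixes n :: nat
  assumes V: "V \<subseteq> ({..<n} \<rightarrow>\<^sub>E X)"
    and op: "\<And>x. x \<in> V \<Longrightarrow> \<exists>r>0. \<forall>y\<in>{..<n} \<rightarrow>\<^sub>E X. (\<forall>i<n. d (x i) (y i) < r) \<longrightarrow> y \<in> V"
  shows "V \<in> sets (PiM {..<n} (\<lambda>_. M))"
proof -
  obtain C where C: "countable C" "C \<subseteq> sets M"
    and net: "\<forall>x\<in>X. \<forall>r>0. \<exists>S\<in>C. x \<in> S \<and> S \<subseteq> mball x r"
    using countable_network by (elim exE conjE)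
  let ?I = "{S \<in> {..<n} \<rightarrow>\<^sub>E C. PiE {..<n} S \<subseteq> V}"
  have "V = (\<Union>S\<in>?I. PiE {..<n} S)"
  proof (intro equalityI subsetI)
    fix x assume x: "x \<in> V"
    then obtain r where r: "0 < r" "\<forall>y\<in>{..<n} \<rightarrow>\<^sub>E X. (\<forall>i<n. d (x i) (y i) < r) \<longrightarrow> y \<in> V"
      using op by blast
    have xX: "x i \<in> X" if "i < n" for i using x V that by (auto simp: PiE_iff)
    have "\<forall>i\<in>{..<n}. \<exists>S. S \<in> C \<and> x i \<in> S \<and> S \<subseteq> mball (x i) r" using net xX r(1) by blast
    then obtain S where S: "\<And>i. i < n \<Longrightarrow> S i \<in> C \<and> x i \<in> S i \<and> S i \<subseteq> mball (x i) r"
      by (metis lessThan_iff)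
    let ?S = "restrict S {..<n}"
    have "PiE {..<n} ?S \<subseteq> V"
    proof
      fix y assume y: "y \<in> PiE {..<n} ?S"
      then have "y i \<in> mball (x i) r" if "i < n" for i using S[OF that] that by (auto simp: PiE_iff)
      then show "y \<in> V" using r(2) y by (auto simp: PiE_iff)
    qed
    moreover have "?S \<in> {..<n} \<rightarrow>\<^sub>E C" "x \<in> PiE {..<n} ?S"
      using S x V by (auto simp: PiE_iff)
    ultimately show "x \<in> (\<Union>S\<in>?I. PiE {..<n} S)" by blast
  qed auto
  also have "\<dots> \<in> sets (PiM {..<n} (\<lambda>_. M))"
  proof (rule sets.countable_UN'')
    show "countable ?I"
      by (rule countable_subset[OF _ countable_PiE[of "{..<n}" "\<lambda>_. C"]]) (use C in auto)
    show "PiE {..<n} S \<in> sets (PiM {..<n} (\<lambda>_. M))" if "S \<in> ?I" for S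
      using that C(2) by (intro sets_PiM_I_finite) (auto simp: PiE_iff)
  qed
  finally show ?thesis .
qed

end

section \<open>Entropy-regularized minimization over densities\<close>

text \<open>The tangent of \<open>u * ln u\<close> at 1. On nonnegative \<open>u\<close> it bounds
  the entropy integrand below by -1.\<close>

lemma mult_ln_ge_diff:
  fixes u :: real
  assumes "0 \<le> u"
  shows "u - 1 \<le> u * ln u"
proof (cases "u = 0")
  case False
  then have u: "0 < u" using assms by simp
  have "1 - 1 / u \<le> ln u" using ln_le_minus_one[of "1 / u"] u by (simp add: ln_div)
  then have "u * (1 - 1 / u) \<le> u * ln u" using u by (intro mult_left_mono) auto
  then show ?thesis using u by (simp add: right_diff_distrib)
qed simp

text \<open>Apply \<open>ln v \<le> v - 1\<close> to \<open>v = 1 / sqrt u\<close>; the factor 2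
  undoes the square root inside the logarithm.\<close>

lemma abs_mult_ln_le:
  fixes u :: real
  assumes "0 \<le> u" "u \<le> 1"
  shows "\<bar>u * ln u\<bar> \<le> 2 * sqrt u"
proof (cases "u = 0")
  case False
  then have u: "0 < u" using assms by simp
  have "ln (1 / sqrt u) \<le> 1 / sqrt u - 1" using u by (intro ln_le_minus_one) simp
  then have "- ln u \<le> 2 * (1 / sqrt u)" using u by (simp add: ln_div ln_sqrt)
  then have "u * (- ln u) \<le> u * (2 * (1 / sqrt u))" using u by (intro mult_left_mono) auto
  also have "\<dots> = 2 * (u / sqrt u)" by simp
  also have "\<dots> = 2 * sqrt u" by (simp only: real_div_sqrt[OF assms(1)])
  finally show ?thesis using u assms by (simp add: abs_mult abs_of_nonpos)
qed simp

text \<open>\<open>ln\<close> itself is not continuous at 0, but the product is, by the square root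
  bound. This carries the entropy integrand to pointwise limits of densities, including where they
  vanish.\<close>

lemma tendsto_mult_ln:
  fixes u :: "nat \<Rightarrow> real"
  assumes lim: "u \<longlonglongrightarrow> a" and nn: "\<And>n. 0 \<le> u n"
  shows "(\<lambda>n. u n * ln (u n)) \<longlonglongrightarrow> a * ln a"
proof (cases "a = 0")
  case False
  then show ?thesis using lim by (intro tendsto_mult tendsto_ln)
next
  case True
  have "(\<lambda>n. u n * ln (u n)) \<longlonglongrightarrow> 0"
  proof (rule tendsto_0_le[where K=2])
    show "(\<lambda>n. sqrt (u n)) \<longlonglongrightarrow> 0" using tendsto_real_sqrt[OF lim] True by simp
    have "\<forall>\<^sub>F n in sequentially. u n < 1" using order_tendstoD(2)[OF lim, of 1] True by simp
    then show "\<forall>\<^sub>F n in sequentially. norm (u n * ln (u n)) \<le> norm (sqrt (u n)) * 2"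
      by eventually_elim (use nn abs_mult_ln_le in \<open>force simp: less_imp_le mult.commute\<close>)
  qed
  then show ?thesis using True by simp
qed

lemma min_at_1_of_deriv_sign:
  fixes G :: "real \<Rightarrow> real"
  assumes D: "\<And>u. 0 < u \<Longrightarrow> (G has_real_derivative G' u) (at u)"
    and neg: "\<And>u. 0 < u \<Longrightarrow> u \<le> 1 \<Longrightarrow> G' u \<le> 0" and pos: "\<And>u. 1 \<le> u \<Longrightarrow> 0 \<le> G' u"
    and u: "0 < u"
  shows "G 1 \<le> G u"
proof (cases "u \<le> 1")
  case True
  show ?thesis
  proof (rule DERIV_nonpos_imp_nonincreasing[OF True])
    fix x assume "u \<le> x" "x \<le> 1"
    then show "\<exists>y. (G has_real_derivative y) (at x) \<and> y \<le> 0" using D[of x] neg[of x] u by force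
  qed
next
  case False
  then have "1 \<le> u" by simp
  then show ?thesis
  proof (rule DERIV_nonneg_imp_nondecreasing)
    fix x :: real assume "1 \<le> x" "x \<le> u"
    then show "\<exists>y. (G has_real_derivative y) (at x) \<and> 0 \<le> y" using D[of x] pos[of x] by force
  qed
qed

text \<open>\<open>2 * (u - 1) / (u + 1)\<close> is the Pade approximant of \<open>ln\<close> at 1.
  The difference \<open>?H\<close> vanishes at 1 and has derivative \<open>ln u + 1 / u - 1\<close>,
  which is nonnegative, so it changes sign exactly from left to right of 1.\<close>

lemma ln_ge_pade:
  fixes u :: real
  shows "1 \<le> u \<Longrightarrow> 2 * (u - 1) \<le> (u + 1) * ln u"
    and "0 < u \<Longrightarrow> u \<le> 1 \<Longrightarrow> (u + 1) * ln u \<le> 2 * (u - 1)"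
proof -
  let ?H = "\<lambda>u::real. (u + 1) * ln u - 2 * (u - 1)"
  have D: "(?H has_real_derivative (ln u + 1 / u - 1)) (at u)" if "0 < u" for u
    using that by (auto intro!: derivative_eq_intros simp: field_simps)
  have nn: "0 \<le> ln u + 1 / u - 1" if "0 < u" for u :: real
    using ln_le_minus_one[of "1 / u"] that by (simp add: ln_div)
  show "2 * (u - 1) \<le> (u + 1) * ln u" if "1 \<le> u"
  proof -
    have "?H 1 \<le> ?H u"
    proof (rule DERIV_nonneg_imp_nondecreasing[OF that])
      fix x :: real assume "1 \<le> x" "x \<le> u"
      then show "\<exists>y. (?H has_real_derivative y) (at x) \<and> 0 \<le> y" using D[of x] nn[of x] by force
    qed
    then show ?thesis by simp
  qed
  show "(u + 1) * ln u \<le> 2 * (u - 1)" if "0 < u" "u \<le> 1"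
  proof -
    have "?H u \<le> ?H 1"
    proof (rule DERIV_nonneg_imp_nondecreasing[OF that(2)])
      fix x :: real assume "u \<le> x" "x \<le> 1"
      then show "\<exists>y. (?H has_real_derivative y) (at x) \<and> 0 \<le> y" using D[of x] nn[of x] that by force
    qed
    then show ?thesis by simp
  qed
qed

text \<open>The scalar inequality behind Pinsker's. The difference of the two sides vanishes at 1,
  and its derivative is four times the expression of \<open>ln_ge_pade\<close>, so it is minimal
  there.\<close>

lemma pinsker_scalar:
  fixes u :: real
  assumes "0 \<le> u"
  shows "3 * (u - 1)\<^sup>2 \<le> (2 * u + 4) * (u * ln u - u + 1)"
proof (cases "u = 0")
  case False
  then have u: "0 < u" using assms by simp
  let ?G = "\<lambda>u::real. (2 * u + 4) * (u * ln u - u + 1) - 3 * (u - 1)\<^sup>2"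
  have "?G 1 \<le> ?G u"
  proof (rule min_at_1_of_deriv_sign[where G' = "\<lambda>u. 4 * ((u + 1) * ln u - 2 * (u - 1))", OF _ _ _ u])
    fix u :: real assume "0 < u"
    then show "(?G has_real_derivative 4 * ((u + 1) * ln u - 2 * (u - 1))) (at u)"
      by (auto intro!: derivative_eq_intros simp: field_simps power2_eq_square)
  next
    fix u :: real assume "0 < u" "u \<le> 1"
    then show "4 * ((u + 1) * ln u - 2 * (u - 1)) \<le> 0" using ln_ge_pade(2)[of u] by simp
  next
    fix u :: real assume "1 \<le> u"
    then show "0 \<le> 4 * ((u + 1) * ln u - 2 * (u - 1))" using ln_ge_pade(1)[of u] by simp
  qed
  then show ?thesis by simp
qed simp

text \<open>Linearized in the parameter \<open>\<sigma>\<close>, so that integrating yields Pinsker's inequality without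
  Cauchy-Schwarz.\<close>

lemma relative_entropy_ge:
  fixes f m :: real
  assumes "0 \<le> f" "0 < m"
  shows "2 * \<sigma> * \<bar>f - m\<bar> - \<sigma>\<^sup>2 * ((2 * f + 4 * m) / 3) \<le> f * ln f - f * ln m - f + m"
proof -
  define K where "K = f * ln f - f * ln m - f + m"
  define w where "w = (2 * f + 4 * m) / 3"
  have w: "0 < w" using assms by (simp add: w_def)
  \<comment> \<open>By homogeneity the bound reduces to the scalar inequality at the ratio
    \<open>f / m\<close>.\<close>
  have K: "K = m * ((f/m) * ln (f/m) - f/m + 1)"
    using assms by (cases "f = 0") (auto simp: K_def ln_div field_simps)
  have "(f - m)\<^sup>2 = m\<^sup>2 * (f/m - 1)\<^sup>2"
    using assms by (simp add: power_mult_distrib[symmetric] field_simps)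
  also have "\<dots> \<le> m\<^sup>2 * ((2 * (f/m) + 4) * ((f/m) * ln (f/m) - f/m + 1) / 3)"
    using pinsker_scalar[of "f/m"] assms by (intro mult_left_mono) auto
  also have "\<dots> = w * K"
    unfolding K w_def using assms by (simp add: power2_eq_square field_simps)
  finally have sq: "(f - m)\<^sup>2 \<le> w * K" .
  \<comment> \<open>Completing the square: \<open>2 * \<sigma> * a - \<sigma>\<^sup>2 * w\<close> is
    a lower bound for \<open>a\<^sup>2 / w\<close>, linear in both \<open>a\<close> and
    \<open>w\<close>.\<close>
  have "0 \<le> (\<bar>f - m\<bar> - \<sigma> * w)\<^sup>2" by simp
  also have "\<dots> = (f - m)\<^sup>2 - w * (2 * \<sigma> * \<bar>f - m\<bar> - \<sigma>\<^sup>2 * w)"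
    by (simp add: power2_diff power_mult_distrib power2_eq_square algebra_simps)
  finally have "w * (2 * \<sigma> * \<bar>f - m\<bar> - \<sigma>\<^sup>2 * w) \<le> w * K" using sq by simp
  then show ?thesis using w by (simp add: K_def w_def)
qed

text \<open>Both endpoints are compared with the mixture \<open>m\<close> by
  \<open>relative_entropy_ge\<close>; in the weighted sum the terms with \<open>ln m\<close> combine
  to \<open>m * ln m\<close> and the linear terms cancel. Separate parameters are kept because the
  endpoints lie at different distances from \<open>m\<close>.\<close>

lemma mult_ln_strongly_convex:
  fixes f g t :: real
  assumes f: "0 \<le> f" and g: "0 \<le> g" and t: "0 < t" "t < 1"
  defines "m \<equiv> (1 - t) * f + t * g"
  shows "m * ln m + (1 - t) * (2 * \<sigma> * (t * \<bar>f - g\<bar>) - \<sigma>\<^sup>2 * ((2 * f + 4 * m) / 3))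
      + t * (2 * \<tau> * ((1 - t) * \<bar>f - g\<bar>) - \<tau>\<^sup>2 * ((2 * g + 4 * m) / 3))
    \<le> (1 - t) * (f * ln f) + t * (g * ln g)"
proof (cases "m = 0")
  case True
  have "(1 - t) * f = 0" "t * g = 0"
    using True f g t add_nonneg_eq_0_iff[of "(1 - t) * f" "t * g"] by (auto simp: m_def)
  then have "f = 0" "g = 0" using t by auto
  then show ?thesis using True by simp
next
  case False
  have "0 \<le> m" using f g t by (simp add: m_def)
  then have m: "0 < m" using False by simp
  have "f - m = t * (f - g)" "g - m = (1 - t) * (g - f)" by (simp_all add: m_def algebra_simps)
  then have ab: "\<bar>f - m\<bar> = t * \<bar>f - g\<bar>" "\<bar>g - m\<bar> = (1 - t) * \<bar>f - g\<bar>"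
    using t by (simp_all add: abs_mult)
  have "(1 - t) * (2 * \<sigma> * \<bar>f - m\<bar> - \<sigma>\<^sup>2 * ((2 * f + 4 * m) / 3))
      \<le> (1 - t) * (f * ln f - f * ln m - f + m)"
    using t by (intro mult_left_mono relative_entropy_ge f m) auto
  moreover have "t * (2 * \<tau> * \<bar>g - m\<bar> - \<tau>\<^sup>2 * ((2 * g + 4 * m) / 3)) \<le> t * (g * ln g - g * ln m - g + m)"
    using t by (intro mult_left_mono relative_entropy_ge g m) auto
  moreover have "(1 - t) * (f * ln f - f * ln m - f + m) + t * (g * ln g - g * ln m - g + m)
      = (1 - t) * (f * ln f) + t * (g * ln g) - ((1 - t) * f + t * g) * ln m - ((1 - t) * f + t * g) + m"
    by (simp add: algebra_simps)
  ultimately show ?thesis unfolding ab m_def[symmetric] by linarith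
qed

text \<open>Nonnegativity is demanded everywhere, not almost everywhere, so that the scalar entropy
  inequalities apply without exceptional sets.\<close>

definition prob_density :: "'a measure \<Rightarrow> ('a \<Rightarrow> real) \<Rightarrow> bool" where
  "prob_density \<nu> f \<longleftrightarrow> integrable \<nu> f \<and> (\<forall>x. 0 \<le> f x) \<and> (\<integral>x. f x \<partial>\<nu>) = 1"

definition ent_density :: "('a \<Rightarrow> real) \<Rightarrow> 'a \<Rightarrow> real" where
  "ent_density f x = f x * ln (f x)"

lemma ent_density_measurable:
  assumes [measurable]: "f \<in> borel_measurable \<nu>"
  shows "ent_density f \<in> borel_measurable \<nu>"
  unfolding ent_density_def[abs_def] by measurable

lemma ent_density_ge: "0 \<le> f x \<Longrightarrow> -1 \<le> ent_density f x"
  using mult_ln_ge_diff[of "f x"] by (simp add: ent_density_def)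

lemma ext_integral_integrable:
  assumes "integrable M f"
  shows "ext_integral M f = ereal (\<integral>x. f x \<partial>M)"
proof -
  have fin: "(\<integral>\<^sup>+x. ennreal (f x) \<partial>M) \<noteq> \<infinity>" "(\<integral>\<^sup>+x. ennreal (- f x) \<partial>M) \<noteq> \<infinity>"
    using assms by (auto simp: real_integrable_def)
  then obtain a b where ab: "(\<integral>\<^sup>+x. ennreal (f x) \<partial>M) = ennreal a" "0 \<le> a"
      "(\<integral>\<^sup>+x. ennreal (- f x) \<partial>M) = ennreal b" "0 \<le> b"
    by (metis ennreal_cases infinity_ennreal_def)
  then show ?thesis
    by (simp add: ext_integral_def real_lebesgue_integral_def[OF assms] enn2ereal_ennreal)
qed

text \<open>The negative part is at most 1 and the measure is finite, so a failure of integrability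
  can only come from the positive part.\<close>

lemma (in finite_measure) ext_integral_not_integrable:
  assumes f: "f \<in> borel_measurable M" "\<And>x. -1 \<le> f x" and "\<not> integrable M f"
  shows "ext_integral M f = \<infinity>"
proof -
  have "(\<integral>\<^sup>+x. ennreal (- f x) \<partial>M) \<le> (\<integral>\<^sup>+x. 1 \<partial>M)"
    using f(2) by (intro nn_integral_mono) (auto simp: ennreal_le_1 minus_le_iff)
  also have "\<dots> < \<infinity>" by (simp add: emeasure_eq_measure)
  finally have n: "(\<integral>\<^sup>+x. ennreal (- f x) \<partial>M) < \<infinity>" .
  then have p: "(\<integral>\<^sup>+x. ennreal (f x) \<partial>M) = \<infinity>"
    using assms by (auto simp: real_integrable_def)
  obtain b where "(\<integral>\<^sup>+x. ennreal (- f x) \<partial>M) = ennreal b" "0 \<le> b"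
    using n by (metis ennreal_cases infinity_ennreal_def less_irrefl)
  then show ?thesis by (simp add: ext_integral_def p enn2ereal_ennreal)
qed

text \<open>Fatou's lemma as lower semicontinuity; it serves for the L1 distance to the limit of a
  sequence and for the entropy of that limit.\<close>

lemma nn_integral_le_of_AE_tendsto:
  fixes u :: "nat \<Rightarrow> 'a \<Rightarrow> real"
  assumes m: "\<And>k. u k \<in> borel_measurable M" and lim: "AE x in M. (\<lambda>k. u k x) \<longlonglongrightarrow> v x"
    and le: "\<forall>\<^sub>F k in sequentially. (\<integral>\<^sup>+x. ennreal (u k x) \<partial>M) \<le> c"
  shows "(\<integral>\<^sup>+x. ennreal (v x) \<partial>M) \<le> c"
proof -
  have "(\<integral>\<^sup>+x. ennreal (v x) \<partial>M) = (\<integral>\<^sup>+x. liminf (\<lambda>k. ennreal (u k x)) \<partial>M)"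
    using lim
    by (intro nn_integral_cong_AE) (auto elim!: eventually_mono intro!: lim_imp_Liminf[symmetric] tendsto_ennrealI)
  also have "\<dots> \<le> liminf (\<lambda>k. \<integral>\<^sup>+x. ennreal (u k x) \<partial>M)"
    using m by (intro nn_integral_liminf) auto
  also have "\<dots> \<le> limsup (\<lambda>k. \<integral>\<^sup>+x. ennreal (u k x) \<partial>M)" by (rule Liminf_le_Limsup) simp
  also have "\<dots> \<le> c" by (rule Limsup_bounded[OF le])
  finally show ?thesis .
qed

lemma prob_density_mix:
  assumes f: "prob_density \<nu> f" and g: "prob_density \<nu> g" and t: "0 \<le> t" "t \<le> 1"
  shows "prob_density \<nu> (\<lambda>x. (1 - t) * f x + t * g x)"
  using assms by (auto simp: prob_density_def)

section \<open>Strong convexity and minimization of entropy-regularized functionals\<close>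

context finite_measure
begin

text \<open>Integrated form of the pointwise inequality: both weights
  \<open>(2 * f + 4 * m) / 3\<close> and \<open>(2 * g + 4 * m) / 3\<close> have integral 2, so
  optimizing the two parameters turns the linear gain into a squared L1 distance.\<close>

lemma entropy_strongly_convex:
  assumes f: "prob_density M f" and g: "prob_density M g" and t: "0 < t" "t < 1"
    and If: "integrable M (ent_density f)" and Ig: "integrable M (ent_density g)"
  defines "m \<equiv> \<lambda>x. (1 - t) * f x + t * g x"
  shows "integrable M (ent_density m)"
    and "(\<integral>x. ent_density m x \<partial>M) + t * (1 - t) / 2 * (\<integral>x. \<bar>f x - g x\<bar> \<partial>M)\<^sup>2
      \<le> (1 - t) * (\<integral>x. ent_density f x \<partial>M) + t * (\<integral>x. ent_density g x \<partial>M)"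
proof -
  have m: "prob_density M m" unfolding m_def using prob_density_mix[OF f g] t by simp
  have int: "integrable M f" "integrable M g" "integrable M m"
    and one: "(\<integral>x. f x \<partial>M) = 1" "(\<integral>x. g x \<partial>M) = 1" "(\<integral>x. m x \<partial>M) = 1"
    and nn: "\<And>x. 0 \<le> f x" "\<And>x. 0 \<le> g x" "\<And>x. 0 \<le> m x"
    using f g m by (auto simp: prob_density_def)
  let ?d = "\<integral>x. \<bar>f x - g x\<bar> \<partial>M"
  have pt: "ent_density m x + (1 - t) * (2 * \<sigma> * (t * \<bar>f x - g x\<bar>) - \<sigma>\<^sup>2 * ((2 * f x + 4 * m x) / 3))
      + t * (2 * \<tau> * ((1 - t) * \<bar>f x - g x\<bar>) - \<tau>\<^sup>2 * ((2 * g x + 4 * m x) / 3))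
    \<le> (1 - t) * ent_density f x + t * ent_density g x" for x \<sigma> \<tau>
    using mult_ln_strongly_convex[OF nn(1)[of x] nn(2)[of x] t] by (simp add: ent_density_def m_def)
  \<comment> \<open>Convexity bounds the entropy integrand of the mixture above by those of the
    endpoints, and -1 bounds it below.\<close>
  show Im: "integrable M (ent_density m)"
  proof (rule Bochner_Integration.integrable_bound)
    show "integrable M (\<lambda>x. 1 + (\<bar>ent_density f x\<bar> + \<bar>ent_density g x\<bar>))"
      using If Ig by auto
    show "ent_density m \<in> borel_measurable M"
      using int by (intro ent_density_measurable) auto
    show "AE x in M. norm (ent_density m x) \<le> norm (1 + (\<bar>ent_density f x\<bar> + \<bar>ent_density g x\<bar>))"
    proof (rule AE_I2)
      fix x
      have "ent_density m x \<le> (1 - t) * ent_density f x + t * ent_density g x"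
        using pt[of x 0 0] by simp
      also have "\<dots> \<le> 1 * \<bar>ent_density f x\<bar> + 1 * \<bar>ent_density g x\<bar>"
      proof -
        have "c * a \<le> 1 * \<bar>a\<bar>" if "0 \<le> c" "c \<le> 1" for c a :: real
          using that by (intro order_trans[OF mult_left_mono[OF abs_ge_self] mult_right_mono]) auto
        then show ?thesis using t by (intro add_mono) auto
      qed
      finally show "norm (ent_density m x) \<le> norm (1 + (\<bar>ent_density f x\<bar> + \<bar>ent_density g x\<bar>))"
        using ent_density_ge[of m x] nn(3)[of x] by auto
    qed
  qed
  \<comment> \<open>Maximizers of \<open>2 * \<sigma> * A - 2 * \<sigma>\<^sup>2\<close> for
    \<open>A = t * ?d\<close> and \<open>A = (1 - t) * ?d\<close>, the L1 distances of the endpoints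
    from the mixture.\<close>
  let ?s = "t * ?d / 2" and ?u = "(1 - t) * ?d / 2"
  have "(\<integral>x. ent_density m x + (1 - t) * (2 * ?s * (t * \<bar>f x - g x\<bar>) - ?s\<^sup>2 * ((2 * f x + 4 * m x) / 3))
      + t * (2 * ?u * ((1 - t) * \<bar>f x - g x\<bar>) - ?u\<^sup>2 * ((2 * g x + 4 * m x) / 3)) \<partial>M)
    \<le> (\<integral>x. (1 - t) * ent_density f x + t * ent_density g x \<partial>M)"
    using If Ig Im int by (intro integral_mono pt) auto
  also have "(\<integral>x. ent_density m x + (1 - t) * (2 * ?s * (t * \<bar>f x - g x\<bar>) - ?s\<^sup>2 * ((2 * f x + 4 * m x) / 3))
      + t * (2 * ?u * ((1 - t) * \<bar>f x - g x\<bar>) - ?u\<^sup>2 * ((2 * g x + 4 * m x) / 3)) \<partial>M)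
    = (\<integral>x. ent_density m x \<partial>M) + (1 - t) * (2 * ?s * (t * ?d) - ?s\<^sup>2 * 2)
      + t * (2 * ?u * ((1 - t) * ?d) - ?u\<^sup>2 * 2)"
  proof -
    have "(\<integral>x. ent_density m x + (1 - t) * (\<sigma> * (t * \<bar>f x - g x\<bar>) - \<sigma>' * ((2 * f x + 4 * m x) / 3))
        + t * (\<tau> * ((1 - t) * \<bar>f x - g x\<bar>) - \<tau>' * ((2 * g x + 4 * m x) / 3)) \<partial>M)
      = (\<integral>x. ent_density m x \<partial>M) + (1 - t) * (\<sigma> * (t * ?d) - \<sigma>' * 2) + t * (\<tau> * ((1 - t) * ?d) - \<tau>' * 2)"
      for \<sigma> \<sigma>' \<tau> \<tau>' using Im int one by (simp add: mult.commute[of _ 2])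
    then show ?thesis .
  qed
  also have "\<dots> = (\<integral>x. ent_density m x \<partial>M) + t * (1 - t) / 2 * ?d\<^sup>2"
  proof -
    have "(1 - t) * (2 * (t * d / 2) * (t * d) - (t * d / 2)\<^sup>2 * 2)
      + t * (2 * ((1 - t) * d / 2) * ((1 - t) * d) - ((1 - t) * d / 2)\<^sup>2 * 2) = t * (1 - t) / 2 * d\<^sup>2" for d :: real
      by (simp add: power2_eq_square field_simps)
    from this[of ?d] show ?thesis by linarith
  qed
  finally show "(\<integral>x. ent_density m x \<partial>M) + t * (1 - t) / 2 * ?d\<^sup>2
      \<le> (1 - t) * (\<integral>x. ent_density f x \<partial>M) + t * (\<integral>x. ent_density g x \<partial>M)"
    using If Ig by simp
qed

text \<open>Competitors with nonintegrable entropy have infinite risk; on the remaining ones the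
  whole problem is real-valued.\<close>

definition finite_entropy :: "('a \<Rightarrow> real) \<Rightarrow> bool" where
  "finite_entropy f \<longleftrightarrow> prob_density M f \<and> integrable M (ent_density f)"

definition reg_value :: "(('a \<Rightarrow> real) \<Rightarrow> real) \<Rightarrow> real \<Rightarrow> ('a \<Rightarrow> real) \<Rightarrow> real" where
  "reg_value F lam f = F f + lam * (\<integral>x. ent_density f x \<partial>M)"

lemma reg_value_strongly_convex:
  assumes conv: "F (\<lambda>x. (1 - t) * f x + t * g x) \<le> (1 - t) * F f + t * F g"
    and f: "finite_entropy f" and g: "finite_entropy g" and t: "0 < t" "t < 1" and lam: "0 < lam"
  shows "finite_entropy (\<lambda>x. (1 - t) * f x + t * g x)"
    and "reg_value F lam (\<lambda>x. (1 - t) * f x + t * g x) + lam * (t * (1 - t) / 2 * (\<integral>x. \<bar>f x - g x\<bar> \<partial>M)\<^sup>2)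
      \<le> (1 - t) * reg_value F lam f + t * reg_value F lam g"
proof -
  note sc = entropy_strongly_convex[OF _ _ t, of f g]
  show "finite_entropy (\<lambda>x. (1 - t) * f x + t * g x)"
    using sc(1) f g t prob_density_mix[of M f g t] by (simp add: finite_entropy_def)
  have "lam * ((\<integral>x. ent_density (\<lambda>x. (1 - t) * f x + t * g x) x \<partial>M) + t * (1 - t) / 2 * (\<integral>x. \<bar>f x - g x\<bar> \<partial>M)\<^sup>2)
    \<le> lam * ((1 - t) * (\<integral>x. ent_density f x \<partial>M) + t * (\<integral>x. ent_density g x \<partial>M))"
    using sc(2) f g lam by (intro mult_left_mono) (auto simp: finite_entropy_def)
  then show "reg_value F lam (\<lambda>x. (1 - t) * f x + t * g x) + lam * (t * (1 - t) / 2 * (\<integral>x. \<bar>f x - g x\<bar> \<partial>M)\<^sup>2)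
      \<le> (1 - t) * reg_value F lam f + t * reg_value F lam g"
    using conv by (simp add: reg_value_def algebra_simps)
qed

text \<open>Along the segment from the minimizer \<open>f\<close> to \<open>g\<close> strong
  convexity leaves a gain of order \<open>t\<close>; dividing by \<open>t\<close> and letting
  \<open>t\<close> tend to 0 gives the full constant \<open>lam / 2\<close>.\<close>

lemma reg_value_growth:
  assumes conv: "\<And>t. 0 < t \<Longrightarrow> t < 1 \<Longrightarrow> F (\<lambda>x. (1 - t) * f x + t * g x) \<le> (1 - t) * F f + t * F g"
    and f: "finite_entropy f" and g: "finite_entropy g" and lam: "0 < lam"
    and min: "\<And>k. finite_entropy k \<Longrightarrow> reg_value F lam f \<le> reg_value F lam k"
  shows "reg_value F lam f + lam / 2 * (\<integral>x. \<bar>f x - g x\<bar> \<partial>M)\<^sup>2 \<le> reg_value F lam g"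
proof -
  let ?d = "\<integral>x. \<bar>f x - g x\<bar> \<partial>M"
  have "reg_value F lam f + lam * ((1 - t) / 2 * ?d\<^sup>2) \<le> reg_value F lam g" if t: "0 < t" "t < 1" for t
  proof -
    have "reg_value F lam f + lam * (t * (1 - t) / 2 * ?d\<^sup>2) \<le> (1 - t) * reg_value F lam f + t * reg_value F lam g"
      using reg_value_strongly_convex[OF conv[OF t] f g t lam] min by fastforce
    then have "t * (reg_value F lam f + lam * ((1 - t) / 2 * ?d\<^sup>2)) \<le> t * reg_value F lam g"
      by (simp add: algebra_simps)
    then show ?thesis using t by simp
  qed
  then have ev: "\<forall>\<^sub>F t in at_right 0. reg_value F lam f + lam * ((1 - t) / 2 * ?d\<^sup>2) \<le> reg_value F lam g"
    unfolding eventually_at_right_field by (intro exI[of _ 1]) auto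
  have "((\<lambda>t. reg_value F lam f + lam * ((1 - t) / 2 * ?d\<^sup>2)) \<longlongrightarrow> reg_value F lam f + lam * ((1 - 0) / 2 * ?d\<^sup>2)) (at_right 0)"
    by (intro tendsto_intros) auto
  from tendsto_upperbound[OF this ev] show ?thesis by simp
qed

lemma ex_finite_entropy:
  assumes "0 < measure M (space M)"
  shows "\<exists>f. finite_entropy f"
  using assms
  by (intro exI[of _ "\<lambda>_. 1 / measure M (space M)"]) (simp add: finite_entropy_def prob_density_def ent_density_def[abs_def])

lemma integral_entropy_ge:
  assumes "finite_entropy f"
  shows "- measure M (space M) \<le> (\<integral>x. ent_density f x \<partial>M)"
proof -
  have "(\<integral>x. -1 \<partial>M) \<le> (\<integral>x. ent_density f x \<partial>M)"
    using assms by (intro integral_mono) (auto simp: finite_entropy_def prob_density_def intro!: ent_density_ge)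
  then show ?thesis by simp
qed

text \<open>By strong convexity a minimizing sequence is Cauchy in \<open>L\<^sup>1\<close>, so no compactness is needed.\<close>

lemma ex_reg_minimizer:
  assumes nonneg: "\<And>f. prob_density M f \<Longrightarrow> 0 \<le> F f"
    and lip: "\<And>f g. prob_density M f \<Longrightarrow> prob_density M g \<Longrightarrow> \<bar>F f - F g\<bar> \<le> L * (\<integral>x. \<bar>f x - g x\<bar> \<partial>M)"
    and conv: "\<And>f g t. prob_density M f \<Longrightarrow> prob_density M g \<Longrightarrow> 0 < t \<Longrightarrow> t < 1 \<Longrightarrow>
      F (\<lambda>x. (1 - t) * f x + t * g x) \<le> (1 - t) * F f + t * F g"
    and lam: "0 < lam" and pos: "0 < measure M (space M)"
  shows "\<exists>f. finite_entropy f \<and> (\<forall>g. finite_entropy g \<longrightarrow> reg_value F lam f \<le> reg_value F lam g)"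
proof -
  let ?V = "reg_value F lam"
  define I where "I = (INF f\<in>Collect finite_entropy. ?V f)"
  have bdd: "bdd_below (?V ` Collect finite_entropy)"
  proof (rule bdd_belowI2)
    fix f assume "f \<in> Collect finite_entropy"
    then have f: "finite_entropy f" by simp
    have "lam * (- measure M (space M)) \<le> lam * (\<integral>x. ent_density f x \<partial>M)"
      using integral_entropy_ge[OF f] lam by (intro mult_left_mono) auto
    then show "lam * (- measure M (space M)) \<le> ?V f"
      using nonneg[of f] f by (simp add: reg_value_def finite_entropy_def)
  qed
  have I_le: "I \<le> ?V f" if "finite_entropy f" for f
    unfolding I_def using bdd that by (intro cINF_lower) auto
  have "\<exists>f. finite_entropy f \<and> ?V f < I + 1 / real (Suc n)" for n
  proof -
    have "Inf (?V ` Collect finite_entropy) < I + 1 / real (Suc n)" by (simp add: I_def)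
    then show ?thesis using ex_finite_entropy[OF pos] by (subst (asm) cInf_less_iff[OF _ bdd]) auto
  qed
  then obtain s where s: "\<And>n. finite_entropy (s n)" "\<And>n. ?V (s n) < I + 1 / real (Suc n)" by metis
  have sd: "prob_density M (s n)" "integrable M (s n)" "integrable M (ent_density (s n))" "0 \<le> s n x" for n x
    using s(1)[of n] by (auto simp: finite_entropy_def prob_density_def)
  let ?d = "\<lambda>i j. \<integral>x. \<bar>s i x - s j x\<bar> \<partial>M"
  \<comment> \<open>Midpoints of almost-minimizers are competitors, so their value is at least
    \<open>I\<close>. At \<open>t = 1 / 2\<close> the convexity gain has the factor
    \<open>1 / 8\<close>.\<close>
  have close: "lam / 8 * (?d i j)\<^sup>2 < 1 / real (Suc N)" if "N \<le> i" "N \<le> j" for i j N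
  proof -
    note sc = reg_value_strongly_convex[OF conv[OF sd(1)[of i] sd(1)[of j]] s(1)[of i] s(1)[of j] _ _ lam, of "1/2"]
    have "I + lam * ((1/2) * (1 - 1/2) / 2 * (?d i j)\<^sup>2) \<le> (1 - 1/2) * ?V (s i) + 1/2 * ?V (s j)"
      using sc I_le[OF sc(1)] by simp
    moreover have "?V (s i) < I + 1 / real (Suc N)" "?V (s j) < I + 1 / real (Suc N)"
      using s(2)[of i] s(2)[of j] that
      by (smt (verit) frac_le of_nat_0_less_iff of_nat_le_iff Suc_le_mono zero_less_Suc)+
    ultimately show ?thesis by simp
  qed
  have cauchy: "\<exists>N. \<forall>i\<ge>N. \<forall>j\<ge>N. ?d i j < e" if e: "0 < e" for e
  proof -
    obtain N where N: "1 / real (Suc N) < lam / 8 * e\<^sup>2"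
      using reals_Archimedean[of "lam / 8 * e\<^sup>2"] lam e by (auto simp: inverse_eq_divide)
    have "?d i j < e" if "N \<le> i" "N \<le> j" for i j
    proof -
      have "lam / 8 * (?d i j)\<^sup>2 < lam / 8 * e\<^sup>2" using close[OF that] N by simp
      then have "(?d i j)\<^sup>2 < e\<^sup>2" using lam by simp
      then show ?thesis using e by (simp add: power_less_imp_less_base)
    qed
    then show ?thesis by blast
  qed
  \<comment> \<open>An L1 Cauchy sequence converges almost everywhere only along a subsequence,
    which supplies a pointwise candidate for the limit.\<close>
  obtain r where r: "strict_mono r" "AE x in M. Cauchy (\<lambda>i. s (r i) x)"
    using cauchy_L1_AE_cauchy_subseq[of M s] sd(2) cauchy by auto
  define f where "f x = lim (\<lambda>i. s (r i) x)" for x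
  have f_m: "f \<in> borel_measurable M" unfolding f_def using sd(2) by (intro borel_measurable_lim_metric) auto
  have f_lim: "AE x in M. (\<lambda>i. s (r i) x) \<longlonglongrightarrow> f x"
    using r(2) by eventually_elim (simp add: f_def Cauchy_convergent_iff convergent_LIMSEQ_iff)
  \<comment> \<open>Fatou in the index \<open>k\<close> turns the Cauchy estimate into L1
    convergence to the pointwise limit.\<close>
  have L1: "(\<integral>\<^sup>+x. ennreal \<bar>f x - s (r n) x\<bar> \<partial>M) \<le> ennreal e"
    if e: "0 < e" and N: "\<forall>i\<ge>N. \<forall>j\<ge>N. ?d i j < e" and n: "N \<le> n" for e N n
  proof (rule nn_integral_le_of_AE_tendsto[where u="\<lambda>k x. \<bar>s (r k) x - s (r n) x\<bar>"])
    show "(\<lambda>x. \<bar>s (r k) x - s (r n) x\<bar>) \<in> borel_measurable M" for k using sd(2) by auto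
    show "AE x in M. (\<lambda>k. \<bar>s (r k) x - s (r n) x\<bar>) \<longlonglongrightarrow> \<bar>f x - s (r n) x\<bar>"
      using f_lim by eventually_elim (intro tendsto_intros)
    have "(\<integral>\<^sup>+x. ennreal \<bar>s (r k) x - s (r n) x\<bar> \<partial>M) \<le> ennreal e" if "N \<le> k" for k
    proof -
      have "N \<le> r k" "N \<le> r n" using strict_mono_imp_increasing[OF r(1)] n that le_trans by blast+
      then have "?d (r k) (r n) \<le> e" using N by (simp add: less_imp_le)
      moreover have "(\<integral>\<^sup>+x. ennreal \<bar>s (r k) x - s (r n) x\<bar> \<partial>M) = ennreal (?d (r k) (r n))"
        using sd(2) by (intro nn_integral_eq_integral) auto
      ultimately show ?thesis by (simp add: ennreal_leI)
    qed
    then show "\<forall>\<^sub>F k in sequentially. (\<integral>\<^sup>+x. ennreal \<bar>s (r k) x - s (r n) x\<bar> \<partial>M) \<le> ennreal e"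
      unfolding eventually_sequentially by blast
  qed
  obtain N1 where N1: "\<forall>i\<ge>N1. \<forall>j\<ge>N1. ?d i j < 1" using cauchy[of 1] by auto
  have diff_int: "integrable M (\<lambda>x. f x - s (r n) x)" if "N1 \<le> n" for n
    using L1[OF _ N1 that] f_m sd(2)[of "r n"]
    by (intro integrableI_bounded) (auto intro: le_less_trans)
  have f_int: "integrable M f"
    using Bochner_Integration.integrable_add[OF diff_int[OF order_refl] sd(2)[of "r N1"]] by simp
  have L1_lim: "(\<lambda>n. \<integral>x. \<bar>f x - s (r n) x\<bar> \<partial>M) \<longlonglongrightarrow> 0"
  proof (rule LIMSEQ_I)
    fix e :: real assume e: "0 < e"
    obtain N where N: "\<forall>i\<ge>N. \<forall>j\<ge>N. ?d i j < e/2" using cauchy[of "e/2"] e by auto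
    have "norm ((\<integral>x. \<bar>f x - s (r n) x\<bar> \<partial>M) - 0) < e" if "N \<le> n" for n
    proof -
      have "ennreal (\<integral>x. \<bar>f x - s (r n) x\<bar> \<partial>M) \<le> ennreal (e/2)"
        using L1[OF _ N that] e f_int sd(2)[of "r n"] by (subst nn_integral_eq_integral[symmetric]) auto
      then show ?thesis using e by simp
    qed
    then show "\<exists>no. \<forall>n\<ge>no. norm ((\<integral>x. \<bar>f x - s (r n) x\<bar> \<partial>M) - 0) < e" by blast
  qed
  have f1: "(\<integral>x. f x \<partial>M) = 1"
  proof -
    have "\<bar>(\<integral>x. f x \<partial>M) - 1\<bar> \<le> (\<integral>x. \<bar>f x - s (r n) x\<bar> \<partial>M)" for n
    proof -
      have "(\<integral>x. f x \<partial>M) - 1 = (\<integral>x. f x - s (r n) x \<partial>M)"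
        using f_int sd(1)[of "r n"] by (simp add: prob_density_def)
      then show ?thesis using integral_abs_bound[of M "\<lambda>x. f x - s (r n) x"] by simp
    qed
    then have "\<bar>(\<integral>x. f x \<partial>M) - 1\<bar> \<le> 0" by (intro LIMSEQ_le_const[OF L1_lim]) auto
    then show ?thesis by simp
  qed
  \<comment> \<open>Nonnegativity of the limit is known only almost everywhere, while
    \<open>prob_density\<close> requires it everywhere.\<close>
  define k where "k x = max 0 (f x)" for x
  have f0: "AE x in M. f x = k x"
    using f_lim
  proof eventually_elim
    case (elim x)
    have "0 \<le> f x" using elim sd(4) by (intro LIMSEQ_le_const[OF elim]) auto
    then show ?case by (simp add: k_def)
  qed
  have k_m: "k \<in> borel_measurable M" unfolding k_def using f_m by auto
  have k: "prob_density M k"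
    unfolding prob_density_def
  proof (intro conjI allI)
    show "integrable M k" using f_int f_m f0 k_m integrable_cong_AE[of f M k] by auto
    show "(\<integral>x. k x \<partial>M) = 1" using f1 f_m f0 k_m integral_cong_AE[of f M k] by auto
  qed (simp add: k_def)
  have k_L1: "(\<lambda>n. \<integral>x. \<bar>k x - s (r n) x\<bar> \<partial>M) \<longlonglongrightarrow> 0"
  proof -
    have "(\<integral>x. \<bar>f x - s (r n) x\<bar> \<partial>M) = (\<integral>x. \<bar>k x - s (r n) x\<bar> \<partial>M)" for n
      using f0 f_m k_m sd(2)[of "r n"] by (intro integral_cong_AE) (auto elim: eventually_mono)
    then show ?thesis using L1_lim by simp
  qed
  have k_lim: "AE x in M. (\<lambda>i. s (r i) x) \<longlonglongrightarrow> k x"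
    using f_lim f0 by eventually_elim simp
  have F_lim: "(\<lambda>n. F (s (r n))) \<longlonglongrightarrow> F k"
  proof (rule LIM_zero_cancel, rule tendsto_0_le[where K=L])
    show "(\<lambda>n. \<integral>x. \<bar>k x - s (r n) x\<bar> \<partial>M) \<longlonglongrightarrow> 0" by (rule k_L1)
    show "\<forall>\<^sub>F n in sequentially. norm (F (s (r n)) - F k) \<le> norm (\<integral>x. \<bar>k x - s (r n) x\<bar> \<partial>M) * L"
      using lip[OF k sd(1)] by (intro always_eventually allI) (simp add: abs_minus_commute mult.commute)
  qed
  have V_lim: "(\<lambda>n. I + 1 / real (Suc (r n))) \<longlonglongrightarrow> I"
  proof -
    have "(\<lambda>n. 1 / real (Suc n)) \<longlonglongrightarrow> 0" by (rule LIMSEQ_Suc[OF lim_1_over_n])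
    from LIMSEQ_subseq_LIMSEQ[OF this r(1)] have "(\<lambda>n. 1 / real (Suc (r n))) \<longlonglongrightarrow> 0" by (simp add: comp_def)
    then show ?thesis using tendsto_add[OF tendsto_const[of I]] by fastforce
  qed
  \<comment> \<open>The shift by 1 makes the entropy integrands nonnegative, as Fatou requires; the
    measure is finite, so it can be undone.\<close>
  have ent_lim: "AE x in M. (\<lambda>n. ent_density (s (r n)) x + 1) \<longlonglongrightarrow> ent_density k x + 1"
    using k_lim
  proof eventually_elim
    case (elim x)
    show ?case
      unfolding ent_density_def by (intro tendsto_add tendsto_const tendsto_mult_ln[OF elim] sd(4))
  qed
  let ?m = "measure M (space M)"
  \<comment> \<open>The values approach \<open>I\<close> and \<open>F\<close> converges, so the
    entropies along the subsequence are eventually at most \<open>(I - F k + e) / lam\<close>; Fatou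
    passes this to \<open>k\<close>.\<close>
  have ent: "(\<integral>\<^sup>+x. ennreal (ent_density k x + 1) \<partial>M) \<le> ennreal ((I - F k + e) / lam + ?m)" if e: "0 < e" for e
  proof (rule nn_integral_le_of_AE_tendsto[OF _ ent_lim])
    show "(\<lambda>x. ent_density (s (r n)) x + 1) \<in> borel_measurable M" for n
      using sd(3)[of "r n"] by auto
    have "(\<lambda>n. (I + 1 / real (Suc (r n))) - F (s (r n))) \<longlonglongrightarrow> I - F k"
      by (intro tendsto_diff V_lim F_lim)
    then have "\<forall>\<^sub>F n in sequentially. (I + 1 / real (Suc (r n))) - F (s (r n)) < I - F k + e"
      using e by (intro order_tendstoD) auto
    then show "\<forall>\<^sub>F n in sequentially. (\<integral>\<^sup>+x. ennreal (ent_density (s (r n)) x + 1) \<partial>M)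
        \<le> ennreal ((I - F k + e) / lam + ?m)"
    proof eventually_elim
      case (elim n)
      have "lam * (\<integral>x. ent_density (s (r n)) x \<partial>M) \<le> I - F k + e"
        using elim s(2)[of "r n"] by (simp add: reg_value_def)
      then have le: "(\<integral>x. ent_density (s (r n)) x \<partial>M) \<le> (I - F k + e) / lam"
        using lam by (simp add: pos_le_divide_eq mult.commute)
      have "(\<integral>\<^sup>+x. ennreal (ent_density (s (r n)) x + 1) \<partial>M) = ennreal (\<integral>x. ent_density (s (r n)) x + 1 \<partial>M)"
      proof (rule nn_integral_eq_integral)
        show "AE x in M. 0 \<le> ent_density (s (r n)) x + 1"
        proof (rule AE_I2)
          fix x show "0 \<le> ent_density (s (r n)) x + 1"
            using ent_density_ge[of "s (r n)" x, OF sd(4)] by linarith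
        qed
      qed (use sd(3)[of "r n"] in auto)
      also have "(\<integral>x. ent_density (s (r n)) x + 1 \<partial>M) = (\<integral>x. ent_density (s (r n)) x \<partial>M) + ?m"
        using sd(3)[of "r n"] by simp
      also note le
      finally show ?case by (simp add: ennreal_leI)
    qed
  qed
  have k_ent_m: "ent_density k \<in> borel_measurable M" by (rule ent_density_measurable[OF k_m])
  have k_ge: "0 \<le> ent_density k x + 1" for x
    using ent_density_ge[of k x] k by (simp add: prob_density_def)
  have "integrable M (\<lambda>x. ent_density k x + 1)"
    using ent[of 1] k_ent_m k_ge by (intro integrableI_nonneg) (auto intro: le_less_trans)
  from Bochner_Integration.integrable_diff[OF this, of "\<lambda>_. 1"]
  have k_ent: "integrable M (ent_density k)" by simp
  then have kf: "finite_entropy k" using k by (simp add: finite_entropy_def)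
  have "?V k \<le> I + e" if e: "0 < e" for e
  proof -
    have "ennreal (\<integral>x. ent_density k x + 1 \<partial>M) \<le> ennreal ((I - F k + e) / lam + ?m)"
      using ent[OF e] k_ent k_ge by (subst nn_integral_eq_integral[symmetric]) auto
    \<comment> \<open>\<open>ennreal\<close> truncates negative reals to 0, so the bound can be read
      back in the reals only once its right side is known to be nonnegative.\<close>
    moreover have "- ?m \<le> (I - F k + e) / lam"
    proof -
      have ev: "\<forall>\<^sub>F n in sequentially. (I + 1 / real (Suc (r n))) - F (s (r n)) < I - F k + e"
        using e tendsto_diff[OF V_lim F_lim] by (intro order_tendstoD) auto
      then obtain n where n: "(I + 1 / real (Suc (r n))) - F (s (r n)) < I - F k + e"
        by (metis (no_types, lifting) eventually_sequentially le_refl)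
      have "lam * (- ?m) \<le> lam * (\<integral>x. ent_density (s (r n)) x \<partial>M)"
        using integral_entropy_ge[OF s(1)] lam by (intro mult_left_mono) auto
      also have "\<dots> \<le> I - F k + e" using n s(2)[of "r n"] by (simp add: reg_value_def)
      finally show ?thesis using lam by (simp add: field_simps)
    qed
    ultimately have "(\<integral>x. ent_density k x + 1 \<partial>M) \<le> (I - F k + e) / lam + ?m"
      by (simp add: ennreal_le_iff)
    then have "(\<integral>x. ent_density k x \<partial>M) \<le> (I - F k + e) / lam" using k_ent by simp
    then show ?thesis using lam by (simp add: reg_value_def field_simps)
  qed
  then have "?V k \<le> I" by (rule field_le_epsilon)
  then show ?thesis using kf I_le by (meson order_trans)
qed

end

section \<open>Entropy-regularized risks on the Wasserstein space\<close>

lemma lipschitz_half_square: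
  fixes a b D :: real
  assumes "0 \<le> a" "a \<le> D" "0 \<le> b" "b \<le> D"
  shows "\<bar>a\<^sup>2 / 2 - b\<^sup>2 / 2\<bar> \<le> D * \<bar>a - b\<bar>"
proof -
  have "a\<^sup>2 / 2 - b\<^sup>2 / 2 = (a + b) / 2 * (a - b)" by (simp add: power2_eq_square field_simps)
  then have "\<bar>a\<^sup>2 / 2 - b\<^sup>2 / 2\<bar> = \<bar>(a + b) / 2\<bar> * \<bar>a - b\<bar>" by (simp only: abs_mult)
  also have "\<bar>(a + b) / 2\<bar> * \<bar>a - b\<bar> = (a + b) / 2 * \<bar>a - b\<bar>" using assms by simp
  also have "\<dots> \<le> D * \<bar>a - b\<bar>" using assms by (intro mult_right_mono) auto
  finally show ?thesis .
qed

locale entropic_domain = bounded_domain \<Omega> for \<Omega> :: "(real ^ 'n) set" +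
  assumes lebesgue: "\<Omega> \<in> sets lebesgue" and pos: "0 < emeasure lebesgue \<Omega>"
begin

lemma subalgebra_borel_on: "subalgebra (lebesgue_on \<Omega>) borel_on"
  unfolding subalgebra_def
proof
  show "space borel_on = space (lebesgue_on \<Omega>)" by (simp add: space_restrict_space)
  have "sets borel \<subseteq> sets (lebesgue :: (real ^ 'n) measure)"
    using sets_completionI_sets[of _ lborel] by (metis sets_lborel subsetI)
  then show "sets borel_on \<subseteq> sets (lebesgue_on \<Omega>)"
    unfolding sets_restrict_space by (rule image_mono)
qed

lemma sets_leb [measurable_cong]: "sets (leb \<Omega>) = sets borel_on"
  unfolding leb_def by (rule sets_restr_to_subalg[OF subalgebra_borel_on])

lemma space_leb: "space (leb \<Omega>) = \<Omega>"
  using sets_eq_imp_space_eq[OF sets_leb] by (simp add: space_restrict_space)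

lemma emeasure_leb_space: "emeasure (leb \<Omega>) \<Omega> = emeasure lebesgue \<Omega>"
proof -
  \<comment> \<open>\<open>\<Omega>\<close> need not be a Borel set of the ambient space, but it is
    the whole space of \<open>borel_on\<close>.\<close>
  have "\<Omega> \<in> sets borel_on" using sets.top[of borel_on] by (simp add: space_restrict_space)
  then have "emeasure (leb \<Omega>) \<Omega> = emeasure (lebesgue_on \<Omega>) \<Omega>"
    unfolding leb_def by (rule emeasure_restr_to_subalg[OF subalgebra_borel_on])
  also have "\<dots> = emeasure lebesgue \<Omega>"
    using lebesgue by (intro emeasure_restrict_space) auto
  finally show ?thesis .
qed

lemma emeasure_lebesgue_finite: "emeasure lebesgue \<Omega> < \<infinity>"
  using bounded_set_imp_lmeasurable[OF bounded lebesgue] by (auto simp: fmeasurable_def)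

sublocale leb: finite_measure "leb \<Omega>"
  using emeasure_lebesgue_finite by (intro finite_measureI) (simp add: space_leb emeasure_leb_space)

lemma measure_leb_pos: "0 < measure (leb \<Omega>) (space (leb \<Omega>))"
proof -
  have "0 < ennreal (measure (leb \<Omega>) \<Omega>)"
    using pos unfolding emeasure_leb_space[symmetric] leb.emeasure_eq_measure .
  then show ?thesis by (simp add: space_leb)
qed

text \<open>A nonempty set of diameter 0 is a single point, which is a null set. Positivity is
  needed to divide by the diameter and to have a positive constant in A5.\<close>

lemma diameter_pos: "0 < diameter \<Omega>"
proof (rule ccontr)
  assume "\<not> 0 < diameter \<Omega>"
  then have 0: "diameter \<Omega> = 0" using diameter_nonneg by simp
  have "\<Omega> \<noteq> {}" using pos by auto
  then obtain x where x: "x \<in> \<Omega>" by blast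
  have "\<Omega> \<subseteq> {x}"
  proof
    fix y assume "y \<in> \<Omega>"
    then have "norm (y - x) \<le> 0" using dist_le_diameter[OF _ x] 0 by simp
    then show "y \<in> {x}" by simp
  qed
  then have "emeasure lebesgue \<Omega> \<le> emeasure lebesgue {x}" by (intro emeasure_mono) auto
  then show False using pos by simp
qed

section \<open>Correspondence between absolutely continuous measures and densities\<close>

definition of_density :: "(real ^ 'n \<Rightarrow> real) \<Rightarrow> (real ^ 'n) measure" where
  "of_density f = density (leb \<Omega>) (\<lambda>x. ennreal (f x))"

lemma P2ac_P2: "\<phi> \<in> P2ac \<Omega> \<Longrightarrow> \<phi> \<in> P2 \<Omega>"
  by (simp add: P2ac_def)

lemma dens_nonneg: "0 \<le> dens \<Omega> \<phi> x"
  by (simp add: dens_def)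

lemma of_density_dens:
  assumes "\<phi> \<in> P2ac \<Omega>"
  shows "of_density (dens \<Omega> \<phi>) = \<phi>"
proof -
  interpret p: prob_space \<phi> using P2_prob[OF P2ac_P2[OF assms]] .
  have ac: "absolutely_continuous (leb \<Omega>) \<phi>" using assms by (simp add: P2ac_def)
  have s: "sets \<phi> = sets (leb \<Omega>)" using P2_sets[OF P2ac_P2[OF assms]] sets_leb by simp
  have "AE x in leb \<Omega>. RN_deriv (leb \<Omega>) \<phi> x \<noteq> \<infinity>"
    by (rule leb.RN_deriv_finite[OF p.sigma_finite_measure_axioms ac s])
  then have "AE x in leb \<Omega>. ennreal (dens \<Omega> \<phi> x) = RN_deriv (leb \<Omega>) \<phi> x"
    by eventually_elim (simp add: dens_def less_top)
  then have "of_density (dens \<Omega> \<phi>) = density (leb \<Omega>) (RN_deriv (leb \<Omega>) \<phi>)"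
    unfolding of_density_def by (intro density_cong) (auto simp: dens_def)
  also have "\<dots> = \<phi>" by (rule leb.density_RN_deriv[OF ac s])
  finally show ?thesis .
qed

lemma dens_measurable: "dens \<Omega> \<phi> \<in> borel_measurable (leb \<Omega>)"
  unfolding dens_def[abs_def] by measurable

lemma prob_density_dens:
  assumes "\<phi> \<in> P2ac \<Omega>"
  shows "prob_density (leb \<Omega>) (dens \<Omega> \<phi>)"
proof -
  interpret p: prob_space \<phi> using P2_prob[OF P2ac_P2[OF assms]] .
  note dens_measurable[measurable]
  have "(\<integral>\<^sup>+x. ennreal (dens \<Omega> \<phi> x) \<partial>leb \<Omega>) = emeasure (of_density (dens \<Omega> \<phi>)) (space (leb \<Omega>))"
    unfolding of_density_def by (subst emeasure_density) (auto intro!: nn_integral_cong)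
  also have "\<dots> = 1"
    unfolding of_density_dens[OF assms] using p.emeasure_space_1 P2_space[OF P2ac_P2[OF assms]] by (simp add: space_leb)
  finally have 1: "(\<integral>\<^sup>+x. ennreal (dens \<Omega> \<phi> x) \<partial>leb \<Omega>) = 1" .
  then have i: "integrable (leb \<Omega>) (dens \<Omega> \<phi>)"
    by (intro integrableI_nonneg) (auto simp: dens_nonneg dens_measurable)
  moreover have "(\<integral>x. dens \<Omega> \<phi> x \<partial>leb \<Omega>) = 1"
    using 1 nn_integral_eq_integral[OF i] by (simp add: dens_nonneg)
  ultimately show ?thesis by (simp add: prob_density_def dens_nonneg)
qed

lemma of_density_P2ac:
  assumes "prob_density (leb \<Omega>) f"
  shows "of_density f \<in> P2ac \<Omega>"
proof -
  have f: "f \<in> borel_measurable (leb \<Omega>)" "integrable (leb \<Omega>) f" "\<And>x. 0 \<le> f x" "(\<integral>x. f x \<partial>leb \<Omega>) = 1"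
    using assms by (auto simp: prob_density_def)
  note f(1)[measurable]
  have "emeasure (of_density f) (space (leb \<Omega>)) = (\<integral>\<^sup>+x. ennreal (f x) \<partial>leb \<Omega>)"
    unfolding of_density_def by (subst emeasure_density) (auto intro!: nn_integral_cong)
  also have "\<dots> = 1" using f by (subst nn_integral_eq_integral) auto
  finally have "prob_space (of_density f)" by (intro prob_spaceI) (simp add: of_density_def)
  moreover have "sets (of_density f) = sets borel_on" by (simp add: of_density_def sets_leb)
  moreover have "absolutely_continuous (leb \<Omega>) (of_density f)"
    unfolding of_density_def by (rule absolutely_continuousI_density) measurable
  ultimately show ?thesis by (simp add: P2ac_def P2I)
qed

lemma dens_of_density:
  assumes "prob_density (leb \<Omega>) f"
  shows "AE x in leb \<Omega>. dens \<Omega> (of_density f) x = f x"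
proof -
  have f: "f \<in> borel_measurable (leb \<Omega>)" "\<And>x. 0 \<le> f x"
    using assms by (auto simp: prob_density_def)
  have "AE x in leb \<Omega>. ennreal (f x) = RN_deriv (leb \<Omega>) (of_density f) x"
    by (rule leb.RN_deriv_unique) (use f in \<open>auto simp: of_density_def\<close>)
  then show ?thesis
  proof eventually_elim
    case (elim x)
    then show ?case unfolding dens_def elim[symmetric] using f(2) by simp
  qed
qed

lemma tv_of_density:
  assumes "prob_density (leb \<Omega>) f" "prob_density (leb \<Omega>) g"
  shows "tv \<Omega> (of_density f) (of_density g) = (\<integral>x. \<bar>f x - g x\<bar> \<partial>leb \<Omega>) / 2"
proof -
  have "(\<integral>x. \<bar>dens \<Omega> (of_density f) x - dens \<Omega> (of_density g) x\<bar> \<partial>leb \<Omega>) = (\<integral>x. \<bar>f x - g x\<bar> \<partial>leb \<Omega>)"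
  proof (rule integral_cong_AE)
    show "AE x in leb \<Omega>. \<bar>dens \<Omega> (of_density f) x - dens \<Omega> (of_density g) x\<bar> = \<bar>f x - g x\<bar>"
      using dens_of_density[OF assms(1)] dens_of_density[OF assms(2)] by eventually_elim simp
  qed (use dens_measurable assms in \<open>auto simp: prob_density_def\<close>)
  then show ?thesis by (simp add: tv_def)
qed

lemma tv_nonneg: "0 \<le> tv \<Omega> \<phi> \<psi>"
  by (simp add: tv_def)

lemma tv_commute: "tv \<Omega> \<phi> \<psi> = tv \<Omega> \<psi> \<phi>"
  by (simp add: tv_def abs_minus_commute)

lemma tv_metric: "Metric_space (P2ac \<Omega>) (tv \<Omega>)"
proof
  fix x y z
  assume x: "x \<in> P2ac \<Omega>" and y: "y \<in> P2ac \<Omega>"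
  note int = prob_density_dens[unfolded prob_density_def, THEN conjunct1]
  show "(tv \<Omega> x y = 0) = (x = y)"
  proof
    assume "tv \<Omega> x y = 0"
    then have "AE t in leb \<Omega>. \<bar>dens \<Omega> x t - dens \<Omega> y t\<bar> = 0"
      using integral_nonneg_eq_0_iff_AE[of "leb \<Omega>" "\<lambda>t. \<bar>dens \<Omega> x t - dens \<Omega> y t\<bar>"] int[OF x] int[OF y]
      by (simp add: tv_def)
    then have "of_density (dens \<Omega> x) = of_density (dens \<Omega> y)"
      unfolding of_density_def using dens_measurable by (intro density_cong) auto
    then show "x = y" using of_density_dens x y by simp
  qed (simp add: tv_def)
  assume z: "z \<in> P2ac \<Omega>"
  have "(\<integral>t. \<bar>dens \<Omega> x t - dens \<Omega> z t\<bar> \<partial>leb \<Omega>)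
      \<le> (\<integral>t. \<bar>dens \<Omega> x t - dens \<Omega> y t\<bar> + \<bar>dens \<Omega> y t - dens \<Omega> z t\<bar> \<partial>leb \<Omega>)"
    using int[OF x] int[OF y] int[OF z] by (intro integral_mono) auto
  also have "\<dots> = (\<integral>t. \<bar>dens \<Omega> x t - dens \<Omega> y t\<bar> \<partial>leb \<Omega>) + (\<integral>t. \<bar>dens \<Omega> y t - dens \<Omega> z t\<bar> \<partial>leb \<Omega>)"
    using int[OF x] int[OF y] int[OF z] by simp
  finally show "tv \<Omega> x z \<le> tv \<Omega> x y + tv \<Omega> y z" by (simp add: tv_def)
qed (auto simp: tv_nonneg tv_commute)

text \<open>The convex combination of two measures, formed on densities because the entropy is
  computed there.\<close>

definition mixture :: "real \<Rightarrow> (real ^ 'n) measure \<Rightarrow> (real ^ 'n) measure \<Rightarrow> (real ^ 'n) measure" where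
  "mixture t \<phi> \<psi> = of_density (\<lambda>x. (1 - t) * dens \<Omega> \<phi> x + t * dens \<Omega> \<psi> x)"

lemma mixture_P2ac:
  assumes "\<phi> \<in> P2ac \<Omega>" "\<psi> \<in> P2ac \<Omega>" "0 \<le> t" "t \<le> 1"
  shows "mixture t \<phi> \<psi> \<in> P2ac \<Omega>"
  unfolding mixture_def using assms by (intro of_density_P2ac prob_density_mix prob_density_dens)

lemma neg_entropy_P2ac:
  assumes "\<phi> \<in> P2ac \<Omega>"
  shows "neg_entropy \<Omega> \<phi> = (if leb.finite_entropy (dens \<Omega> \<phi>)
    then ereal (\<integral>x. ent_density (dens \<Omega> \<phi>) x \<partial>leb \<Omega>) else \<infinity>)"
proof -
  have "neg_entropy \<Omega> \<phi> = ext_integral (leb \<Omega>) (ent_density (dens \<Omega> \<phi>))"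
    using assms by (simp add: neg_entropy_def P2ac_def ent_density_def[abs_def])
  moreover have "ent_density (dens \<Omega> \<phi>) \<in> borel_measurable (leb \<Omega>)"
    by (rule ent_density_measurable[OF dens_measurable])
  ultimately show ?thesis
    using ext_integral_integrable[of "leb \<Omega>" "ent_density (dens \<Omega> \<phi>)"]
      leb.ext_integral_not_integrable[of "ent_density (dens \<Omega> \<phi>)"]
      prob_density_dens[OF assms] ent_density_ge[of "dens \<Omega> \<phi>", OF dens_nonneg]
    by (auto simp: leb.finite_entropy_def)
qed

text \<open>Quadratic growth with constant \<open>2 * lam\<close>, which is \<open>lam / 2\<close>
  times the square of the factor 2 between L1 distance and \<open>tv\<close>. A1, A2 and A4 all
  follow from this property of the two risks.\<close>

definition has_sharp_minimizer :: "real \<Rightarrow> ((real ^ 'n) measure \<Rightarrow> ereal) \<Rightarrow> (real ^ 'n) measure \<Rightarrow> bool" where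
  "has_sharp_minimizer lam J \<phi> \<longleftrightarrow> \<phi> \<in> P2ac \<Omega> \<and> \<bar>J \<phi>\<bar> \<noteq> \<infinity> \<and>
     (\<forall>\<psi>\<in>P2ac \<Omega>. J \<phi> + ereal (2 * lam * (tv \<Omega> \<psi> \<phi>)\<^sup>2) \<le> J \<psi>)"

text \<open>Transfers the minimization over densities to measures. Keeping the loss term
  \<open>F\<close> abstract covers the expectation under \<open>\<mu>\<close> and the sample mean at
  once.\<close>

lemma ex_sharp_minimizer:
  assumes lam: "0 < lam"
    and nonneg: "\<And>\<phi>. \<phi> \<in> P2ac \<Omega> \<Longrightarrow> 0 \<le> F \<phi>"
    and lip: "\<And>\<phi> \<psi>. \<phi> \<in> P2ac \<Omega> \<Longrightarrow> \<psi> \<in> P2ac \<Omega> \<Longrightarrow> \<bar>F \<phi> - F \<psi>\<bar> \<le> L * tv \<Omega> \<phi> \<psi>"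
    and conv: "\<And>\<phi> \<psi> t. \<phi> \<in> P2ac \<Omega> \<Longrightarrow> \<psi> \<in> P2ac \<Omega> \<Longrightarrow> 0 < t \<Longrightarrow> t < 1 \<Longrightarrow>
      F (mixture t \<phi> \<psi>) \<le> (1 - t) * F \<phi> + t * F \<psi>"
    and J: "\<And>\<phi>. \<phi> \<in> P2ac \<Omega> \<Longrightarrow> J \<phi> = ereal (F \<phi>) + ereal lam * neg_entropy \<Omega> \<phi>"
  shows "\<exists>\<phi>. has_sharp_minimizer lam J \<phi>"
proof -
  let ?G = "\<lambda>f. F (of_density f)"
  have G_lip: "\<bar>?G f - ?G g\<bar> \<le> L / 2 * (\<integral>x. \<bar>f x - g x\<bar> \<partial>leb \<Omega>)"
    if "prob_density (leb \<Omega>) f" "prob_density (leb \<Omega>) g" for f g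
    using lip[OF of_density_P2ac[OF that(1)] of_density_P2ac[OF that(2)]] tv_of_density[OF that] by simp
  have G_conv: "?G (\<lambda>x. (1 - t) * f x + t * g x) \<le> (1 - t) * ?G f + t * ?G g"
    if f: "prob_density (leb \<Omega>) f" and g: "prob_density (leb \<Omega>) g" and t: "0 < t" "t < 1" for f g t
  proof -
    have "mixture t (of_density f) (of_density g) = of_density (\<lambda>x. (1 - t) * f x + t * g x)"
      unfolding mixture_def of_density_def[of "\<lambda>x. (1 - t) * f x + t * g x"]
        of_density_def[of "\<lambda>x. (1 - t) * dens \<Omega> (of_density f) x + t * dens \<Omega> (of_density g) x"]
    proof (rule density_cong)
      show "AE x in leb \<Omega>. ennreal ((1 - t) * dens \<Omega> (of_density f) x + t * dens \<Omega> (of_density g) x)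
          = ennreal ((1 - t) * f x + t * g x)"
        using dens_of_density[OF f] dens_of_density[OF g] by eventually_elim simp
    qed (use f g dens_measurable in \<open>auto simp: prob_density_def\<close>)
    then show ?thesis using conv[OF of_density_P2ac[OF f] of_density_P2ac[OF g] t] by simp
  qed
  have "\<exists>f. leb.finite_entropy f \<and> (\<forall>g. leb.finite_entropy g \<longrightarrow> leb.reg_value ?G lam f \<le> leb.reg_value ?G lam g)"
  proof (rule leb.ex_reg_minimizer[where F="?G" and L="L / 2"])
    show "0 \<le> ?G f" if "prob_density (leb \<Omega>) f" for f by (rule nonneg[OF of_density_P2ac[OF that]])
  qed (fact G_lip G_conv lam measure_leb_pos)+
  then obtain f where f: "leb.finite_entropy f"
      "\<And>g. leb.finite_entropy g \<Longrightarrow> leb.reg_value ?G lam f \<le> leb.reg_value ?G lam g"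
    by (elim exE conjE) simp
  have fd: "prob_density (leb \<Omega>) f" using f(1) by (simp add: leb.finite_entropy_def)
  have J_val: "J \<phi> = ereal (leb.reg_value ?G lam (dens \<Omega> \<phi>))"
    if "\<phi> \<in> P2ac \<Omega>" "leb.finite_entropy (dens \<Omega> \<phi>)" for \<phi>
    using that J neg_entropy_P2ac of_density_dens by (simp add: leb.reg_value_def)
  define \<phi> where "\<phi> = of_density f"
  have phi: "\<phi> \<in> P2ac \<Omega>" unfolding \<phi>_def by (rule of_density_P2ac[OF fd])
  \<comment> \<open>The Radon-Nikodym derivative of \<open>\<phi>\<close> agrees with
    \<open>f\<close> only almost everywhere, so entropy and value have to be carried over.\<close>
  have ent: "leb.finite_entropy (dens \<Omega> \<phi>)" "leb.reg_value ?G lam (dens \<Omega> \<phi>) = leb.reg_value ?G lam f"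
  proof -
    have m: "ent_density (dens \<Omega> \<phi>) \<in> borel_measurable (leb \<Omega>)" "ent_density f \<in> borel_measurable (leb \<Omega>)"
      using ent_density_measurable[OF dens_measurable] f(1) by (auto simp: leb.finite_entropy_def)
    have ae: "AE x in leb \<Omega>. ent_density (dens \<Omega> \<phi>) x = ent_density f x"
      using dens_of_density[OF fd] unfolding \<phi>_def by eventually_elim (simp add: ent_density_def)
    show "leb.finite_entropy (dens \<Omega> \<phi>)"
      using integrable_cong_AE[OF m ae] f(1) prob_density_dens[OF phi] by (simp add: leb.finite_entropy_def)
    show "leb.reg_value ?G lam (dens \<Omega> \<phi>) = leb.reg_value ?G lam f"
      using integral_cong_AE[OF m ae] of_density_dens[OF phi] by (simp add: leb.reg_value_def \<phi>_def)
  qed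
  have "J \<phi> + ereal (2 * lam * (tv \<Omega> \<psi> \<phi>)\<^sup>2) \<le> J \<psi>" if psi: "\<psi> \<in> P2ac \<Omega>" for \<psi>
  proof (cases "leb.finite_entropy (dens \<Omega> \<psi>)")
    case True
    have "leb.reg_value ?G lam (dens \<Omega> \<phi>) + lam / 2 * (\<integral>x. \<bar>dens \<Omega> \<phi> x - dens \<Omega> \<psi> x\<bar> \<partial>leb \<Omega>)\<^sup>2
        \<le> leb.reg_value ?G lam (dens \<Omega> \<psi>)"
      by (rule leb.reg_value_growth[OF G_conv[OF prob_density_dens[OF phi] prob_density_dens[OF psi]] ent(1) True lam])
        (use f(2) ent(2) in auto)
    also have "(\<integral>x. \<bar>dens \<Omega> \<phi> x - dens \<Omega> \<psi> x\<bar> \<partial>leb \<Omega>) = 2 * tv \<Omega> \<psi> \<phi>"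
      unfolding tv_commute[of \<psi> \<phi>] by (simp add: tv_def)
    finally show ?thesis using J_val[OF phi ent(1)] J_val[OF psi True] by (simp add: power_mult_distrib)
  next
    case False
    then have "J \<psi> = \<infinity>" using J[OF psi] neg_entropy_P2ac[OF psi] lam by simp
    then show ?thesis by simp
  qed
  then have "has_sharp_minimizer lam J \<phi>"
    using phi J_val[OF phi ent(1)] by (simp add: has_sharp_minimizer_def)
  then show ?thesis ..
qed

section \<open>Regularity of the loss in the model and in the data point\<close>

lemma W2_loss_nonneg: "0 \<le> W2_loss \<phi> \<xi>"
  by (simp add: W2_loss_def)

lemma W2_loss_le: "\<phi> \<in> P2 \<Omega> \<Longrightarrow> \<xi> \<in> P2 \<Omega> \<Longrightarrow> W2_loss \<phi> \<xi> \<le> (diameter \<Omega>)\<^sup>2 / 2"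
  using W2_sq_le_diameter by (simp add: W2_loss_def)

lemma W2_loss_tv:
  assumes "\<phi> \<in> P2ac \<Omega>" "\<psi> \<in> P2ac \<Omega>" "\<xi> \<in> P2 \<Omega>"
  shows "\<bar>W2_loss \<phi> \<xi> - W2_loss \<psi> \<xi>\<bar> \<le> (diameter \<Omega>)\<^sup>2 / 2 * tv \<Omega> \<phi> \<psi>"
proof -
  have le: "(W2 \<psi> \<xi>)\<^sup>2 \<le> (W2 \<phi> \<xi>)\<^sup>2 + (diameter \<Omega>)\<^sup>2 * tv \<Omega> \<phi> \<psi>"
    if "\<phi> \<in> P2ac \<Omega>" "\<psi> \<in> P2ac \<Omega>" for \<phi> \<psi>
    using W2_sq_le_tv[OF assms(3) sets_leb, of "dens \<Omega> \<phi>" "dens \<Omega> \<psi>"] prob_density_dens[OF that(1)] prob_density_dens[OF that(2)]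
      of_density_dens[OF that(1)] of_density_dens[OF that(2)]
    by (simp add: prob_density_def of_density_def tv_def)
  show ?thesis
    using le[OF assms(1,2)] le[OF assms(2,1)] unfolding tv_commute[of \<psi> \<phi>] by (simp add: W2_loss_def abs_if)
qed

lemma W2_loss_mixture:
  assumes "\<phi> \<in> P2ac \<Omega>" "\<psi> \<in> P2ac \<Omega>" "\<xi> \<in> P2 \<Omega>" and t: "0 < t" "t < 1"
  shows "W2_loss (mixture t \<phi> \<psi>) \<xi> \<le> (1 - t) * W2_loss \<phi> \<xi> + t * W2_loss \<psi> \<xi>"
proof -
  note dens_measurable[measurable]
  have "(W2 (mixture t \<phi> \<psi>) \<xi>)\<^sup>2 \<le> (1 - t) * (W2 \<phi> \<xi>)\<^sup>2 + t * (W2 \<psi> \<xi>)\<^sup>2"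
  proof (rule W2_sq_convex[OF P2ac_P2[OF assms(1)] P2ac_P2[OF assms(2)] assms(3)])
    show "mixture t \<phi> \<psi> \<in> P2 \<Omega>" using mixture_P2ac[OF assms(1,2), of t] t P2ac_P2 by simp
    fix A assume "A \<in> sets borel_on"
    then have A[measurable]: "A \<in> sets (leb \<Omega>)" by (simp add: sets_leb)
    have "emeasure (mixture t \<phi> \<psi>) A
        = (\<integral>\<^sup>+x. ennreal ((1 - t) * dens \<Omega> \<phi> x + t * dens \<Omega> \<psi> x) * indicator A x \<partial>leb \<Omega>)"
      unfolding mixture_def of_density_def by (rule emeasure_density) measurable
    also have "\<dots> = (\<integral>\<^sup>+x. ennreal (1 - t) * (ennreal (dens \<Omega> \<phi> x) * indicator A x)
        + ennreal t * (ennreal (dens \<Omega> \<psi> x) * indicator A x) \<partial>leb \<Omega>)"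
      using t dens_nonneg by (intro nn_integral_cong) (simp add: ennreal_mult distrib_right mult.assoc)
    also have "\<dots> = ennreal (1 - t) * (\<integral>\<^sup>+x. ennreal (dens \<Omega> \<phi> x) * indicator A x \<partial>leb \<Omega>)
        + ennreal t * (\<integral>\<^sup>+x. ennreal (dens \<Omega> \<psi> x) * indicator A x \<partial>leb \<Omega>)"
      by (simp add: nn_integral_add nn_integral_cmult)
    also have "(\<integral>\<^sup>+x. ennreal (dens \<Omega> \<phi> x) * indicator A x \<partial>leb \<Omega>) = emeasure (of_density (dens \<Omega> \<phi>)) A"
      unfolding of_density_def by (subst emeasure_density) auto
    also have "(\<integral>\<^sup>+x. ennreal (dens \<Omega> \<psi> x) * indicator A x \<partial>leb \<Omega>) = emeasure (of_density (dens \<Omega> \<psi>)) A"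
      unfolding of_density_def by (subst emeasure_density) auto
    finally show "emeasure (mixture t \<phi> \<psi>) A = ennreal (1 - t) * emeasure \<phi> A + ennreal t * emeasure \<psi> A"
      using of_density_dens assms by simp
  qed (use t in auto)
  then show ?thesis by (simp add: W2_loss_def)
qed

text \<open>Lipschitz continuity in the data point, where \<open>W2_loss_tv\<close> is about the
  model; it makes the empirical minimizer stable under perturbations of the sample.\<close>

lemma W2_loss_lipschitz:
  assumes "\<phi> \<in> P2 \<Omega>" "\<xi> \<in> P2 \<Omega>" "\<zeta> \<in> P2 \<Omega>"
  shows "\<bar>W2_loss \<phi> \<xi> - W2_loss \<phi> \<zeta>\<bar> \<le> diameter \<Omega> * W2 \<xi> \<zeta>"
proof -
  have "\<bar>W2 \<phi> \<xi> - W2 \<phi> \<zeta>\<bar> \<le> W2 \<xi> \<zeta>"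
    using W2_triangle[OF assms] W2_triangle[OF assms(1,3,2)] W2_commute[of \<xi> \<zeta>] by simp
  then have "diameter \<Omega> * \<bar>W2 \<phi> \<xi> - W2 \<phi> \<zeta>\<bar> \<le> diameter \<Omega> * W2 \<xi> \<zeta>"
    by (intro mult_left_mono diameter_nonneg)
  with lipschitz_half_square[OF W2_nonneg W2_le_diameter[OF assms(1,2)] W2_nonneg W2_le_diameter[OF assms(1,3)]]
  show ?thesis unfolding W2_loss_def by (rule order_trans)
qed

end

text \<open>For \<open>n = 0\<close> the quotient is 0 by convention, which is where
  \<open>0 \<le> c\<close> enters.\<close>

lemma mean_le:
  fixes g :: "nat \<Rightarrow> real"
  assumes "0 \<le> c" "\<And>i. i < n \<Longrightarrow> g i \<le> c"
  shows "(\<Sum>i<n. g i) / real n \<le> c"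
proof (cases "n = 0")
  case False
  have "(\<Sum>i<n. g i) \<le> (\<Sum>i<n. c)" using assms(2) by (intro sum_mono) auto
  then show ?thesis using False by (simp add: pos_divide_le_eq mult.commute)
qed (use assms in simp)

lemma abs_mean_diff_le:
  fixes g h :: "nat \<Rightarrow> real"
  assumes "0 \<le> c" "\<And>i. i < n \<Longrightarrow> \<bar>g i - h i\<bar> \<le> c"
  shows "\<bar>(\<Sum>i<n. g i) / real n - (\<Sum>i<n. h i) / real n\<bar> \<le> c"
proof -
  have "\<bar>(\<Sum>i<n. g i) / real n - (\<Sum>i<n. h i) / real n\<bar> = \<bar>\<Sum>i<n. g i - h i\<bar> / real n"
    by (simp add: sum_subtractf diff_divide_distrib[symmetric])
  also have "\<dots> \<le> (\<Sum>i<n. \<bar>g i - h i\<bar>) / real n" by (intro divide_right_mono sum_abs) auto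
  also have "\<dots> \<le> c" by (rule mean_le[OF assms])
  finally show ?thesis .
qed

lemma prob_at_most_empty: "prob_at_most M {} 0"
  unfolding prob_at_most_def by (intro bexI[of _ "{}"]) auto

lemma vanishing_rate_0: "vanishing_rate (\<lambda>_. 0)"
  by (simp add: vanishing_rate_def)

section \<open>The barycenter problem: unique minimizers and their measurability\<close>

locale barycenter = entropic_domain \<Omega> +
  risk_minimization "P2 \<Omega>" W2 \<mu> "P2ac \<Omega>" "tv \<Omega>" W2_loss lam "neg_entropy \<Omega>"
  for \<Omega> :: "(real ^ 'n) set" and lam :: real and \<mu> :: "(real ^ 'n) measure measure" +
  assumes lam: "0 < lam" and prob_mu: "prob_space \<mu>" and sets_mu: "sets \<mu> = sets (metric_borel (P2 \<Omega>) W2)"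
begin

sublocale W2: totally_bounded_metric "P2 \<Omega>" W2 \<mu>
  by (intro totally_bounded_metric.intro W2_metric totally_bounded_metric_axioms.intro sets_mu W2_totally_bounded)

sublocale mu: prob_space \<mu> by (rule prob_mu)

lemma space_sample_law: "space (sample_law n) = ({..<n} \<rightarrow>\<^sub>E P2 \<Omega>)"
  by (simp add: sample_law_def space_PiM W2.space_M)

lemma integrable_W2_loss:
  assumes "\<phi> \<in> P2 \<Omega>"
  shows "integrable \<mu> (W2_loss \<phi>)"
proof (rule mu.integrable_const_bound[of _ "(diameter \<Omega>)\<^sup>2 / 2"])
  show "AE x in \<mu>. norm (W2_loss \<phi> x) \<le> (diameter \<Omega>)\<^sup>2 / 2"
    using W2_loss_le[OF assms] by (intro AE_I2) (simp add: W2.space_M W2_loss_nonneg abs_of_nonneg)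
  have "(\<lambda>x. W2 \<phi> x) \<in> borel_measurable \<mu>" by (rule W2.dist_measurable[OF assms])
  then show "W2_loss \<phi> \<in> borel_measurable \<mu>" unfolding W2_loss_def[abs_def] by measurable
qed

lemma ex_sharp_minimizer_risk: "\<exists>\<phi>. has_sharp_minimizer lam risk \<phi>"
proof (rule ex_sharp_minimizer[OF lam, where F="\<lambda>\<phi>. \<integral>x. W2_loss \<phi> x \<partial>\<mu>"])
  note int = integrable_W2_loss[OF P2ac_P2]
  fix \<phi> assume phi: "\<phi> \<in> P2ac \<Omega>"
  show "0 \<le> (\<integral>x. W2_loss \<phi> x \<partial>\<mu>)" by (simp add: W2_loss_nonneg)
  show "risk \<phi> = ereal (\<integral>x. W2_loss \<phi> x \<partial>\<mu>) + ereal lam * neg_entropy \<Omega> \<phi>"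
    using ext_integral_integrable[OF int[OF phi]] by (simp add: risk_def)
  fix \<psi> assume psi: "\<psi> \<in> P2ac \<Omega>"
  show "\<bar>(\<integral>x. W2_loss \<phi> x \<partial>\<mu>) - (\<integral>x. W2_loss \<psi> x \<partial>\<mu>)\<bar> \<le> (diameter \<Omega>)\<^sup>2 / 2 * tv \<Omega> \<phi> \<psi>"
  proof -
    have "\<bar>(\<integral>x. W2_loss \<phi> x \<partial>\<mu>) - (\<integral>x. W2_loss \<psi> x \<partial>\<mu>)\<bar> = \<bar>\<integral>x. W2_loss \<phi> x - W2_loss \<psi> x \<partial>\<mu>\<bar>"
      using int[OF phi] int[OF psi] by simp
    also have "\<dots> \<le> (\<integral>x. \<bar>W2_loss \<phi> x - W2_loss \<psi> x\<bar> \<partial>\<mu>)" by (rule integral_abs_bound)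
    also have "\<dots> \<le> (\<integral>x. (diameter \<Omega>)\<^sup>2 / 2 * tv \<Omega> \<phi> \<psi> \<partial>\<mu>)"
      using int[OF phi] int[OF psi] W2_loss_tv[OF phi psi] by (intro integral_mono) (auto simp: W2.space_M)
    finally show ?thesis by (simp add: mu.prob_space)
  qed
  fix t :: real assume t: "0 < t" "t < 1"
  then have mix: "mixture t \<phi> \<psi> \<in> P2ac \<Omega>" using mixture_P2ac[OF phi psi] by simp
  have "(\<integral>x. W2_loss (mixture t \<phi> \<psi>) x \<partial>\<mu>) \<le> (\<integral>x. (1 - t) * W2_loss \<phi> x + t * W2_loss \<psi> x \<partial>\<mu>)"
    using int[OF phi] int[OF psi] int[OF mix] W2_loss_mixture[OF phi psi _ t]
    by (intro integral_mono) (auto simp: W2.space_M)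
  then show "(\<integral>x. W2_loss (mixture t \<phi> \<psi>) x \<partial>\<mu>) \<le> (1 - t) * (\<integral>x. W2_loss \<phi> x \<partial>\<mu>) + t * (\<integral>x. W2_loss \<psi> x \<partial>\<mu>)"
    using int[OF phi] int[OF psi] by simp
qed

lemma ex_sharp_minimizer_emp_risk:
  assumes x: "x \<in> {..<n} \<rightarrow>\<^sub>E P2 \<Omega>"
  shows "\<exists>\<phi>. has_sharp_minimizer lam (emp_risk n x) \<phi>"
proof (rule ex_sharp_minimizer[OF lam, where F="\<lambda>\<phi>. (\<Sum>i<n. W2_loss \<phi> (x i)) / real n"])
  have xi: "x i \<in> P2 \<Omega>" if "i < n" for i using x that by (auto simp: PiE_iff)
  fix \<phi> assume phi: "\<phi> \<in> P2ac \<Omega>"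
  show "0 \<le> (\<Sum>i<n. W2_loss \<phi> (x i)) / real n" by (intro divide_nonneg_nonneg sum_nonneg W2_loss_nonneg) auto
  show "emp_risk n x \<phi> = ereal ((\<Sum>i<n. W2_loss \<phi> (x i)) / real n) + ereal lam * neg_entropy \<Omega> \<phi>"
    by (simp add: emp_risk_def)
  fix \<psi> assume psi: "\<psi> \<in> P2ac \<Omega>"
  show "\<bar>(\<Sum>i<n. W2_loss \<phi> (x i)) / real n - (\<Sum>i<n. W2_loss \<psi> (x i)) / real n\<bar>
      \<le> (diameter \<Omega>)\<^sup>2 / 2 * tv \<Omega> \<phi> \<psi>"
    using W2_loss_tv[OF phi psi xi] tv_nonneg by (intro abs_mean_diff_le) auto
  fix t :: real assume t: "0 < t" "t < 1"
  have "(\<Sum>i<n. W2_loss (mixture t \<phi> \<psi>) (x i)) \<le> (\<Sum>i<n. (1 - t) * W2_loss \<phi> (x i) + t * W2_loss \<psi> (x i))"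
    using W2_loss_mixture[OF phi psi xi t] by (intro sum_mono) auto
  then have "(\<Sum>i<n. W2_loss (mixture t \<phi> \<psi>) (x i)) / real n
      \<le> (\<Sum>i<n. (1 - t) * W2_loss \<phi> (x i) + t * W2_loss \<psi> (x i)) / real n"
    by (rule divide_right_mono) simp
  then show "(\<Sum>i<n. W2_loss (mixture t \<phi> \<psi>) (x i)) / real n
      \<le> (1 - t) * ((\<Sum>i<n. W2_loss \<phi> (x i)) / real n) + t * ((\<Sum>i<n. W2_loss \<psi> (x i)) / real n)"
    by (simp add: sum.distrib sum_distrib_left add_divide_distrib)
qed

lemma sharp_minimizer:
  assumes "has_sharp_minimizer lam J \<phi>"
  shows minimizers_eq: "minimizers J = {\<phi>}"
    and min_value_eq: "min_value J = J \<phi>"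
    and proper: "proper J"
    and sharp_minimizer_unique: "has_sharp_minimizer lam J \<psi> \<Longrightarrow> \<psi> = \<phi>"
proof -
  interpret tv: Metric_space "P2ac \<Omega>" "tv \<Omega>" by (rule tv_metric)
  have phi: "\<phi> \<in> P2ac \<Omega>" and fin: "\<bar>J \<phi>\<bar> \<noteq> \<infinity>"
    and sharp: "\<And>\<psi>. \<psi> \<in> P2ac \<Omega> \<Longrightarrow> J \<phi> + ereal (2 * lam * (tv \<Omega> \<psi> \<phi>)\<^sup>2) \<le> J \<psi>"
    using assms by (auto simp: has_sharp_minimizer_def)
  obtain r where r: "J \<phi> = ereal r" using fin by auto
  have le: "J \<phi> \<le> J \<psi>" if psi: "\<psi> \<in> P2ac \<Omega>" for \<psi>
  proof -
    have "J \<phi> \<le> ereal (r + 2 * lam * (tv \<Omega> \<psi> \<phi>)\<^sup>2)" using lam by (simp add: r)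
    also have "\<dots> \<le> J \<psi>" using sharp[OF psi] by (simp add: r)
    finally show ?thesis .
  qed
  have eq: "\<psi> = \<phi>" if psi: "\<psi> \<in> P2ac \<Omega>" and "J \<psi> \<le> J \<phi>" for \<psi>
  proof -
    have "ereal (r + 2 * lam * (tv \<Omega> \<psi> \<phi>)\<^sup>2) \<le> ereal r"
      using order_trans[OF sharp[OF psi] \<open>J \<psi> \<le> J \<phi>\<close>] by (simp add: r)
    then have "2 * lam * (tv \<Omega> \<psi> \<phi>)\<^sup>2 \<le> 0" by simp
    then have "tv \<Omega> \<psi> \<phi> = 0" using lam by (simp add: mult_le_0_iff)
    then show ?thesis using tv.zero[OF psi phi] by simp
  qed
  show "minimizers J = {\<phi>}" using phi le eq by (auto simp: minimizers_def)
  show "min_value J = J \<phi>"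
    unfolding min_value_def by (intro antisym INF_lower INF_greatest phi le)
  show "proper J"
    unfolding proper_def
  proof
    show "\<forall>\<psi>\<in>P2ac \<Omega>. J \<psi> \<noteq> - \<infinity>" using le r by fastforce
    show "\<exists>\<psi>\<in>P2ac \<Omega>. J \<psi> \<noteq> \<infinity>" using phi r by (intro bexI[of _ \<phi>]) auto
  qed
  show "\<psi> = \<phi>" if "has_sharp_minimizer lam J \<psi>"
  proof (rule eq)
    show psi: "\<psi> \<in> P2ac \<Omega>" using that by (simp add: has_sharp_minimizer_def)
    have "\<bar>J \<psi>\<bar> \<noteq> \<infinity>" using that by (simp add: has_sharp_minimizer_def)
    then obtain r' where r': "J \<psi> = ereal r'" by auto
    have "ereal (r' + 2 * lam * (tv \<Omega> \<phi> \<psi>)\<^sup>2) \<le> J \<phi>"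
      using that phi by (auto simp: has_sharp_minimizer_def r')
    moreover have "J \<psi> \<le> ereal (r' + 2 * lam * (tv \<Omega> \<phi> \<psi>)\<^sup>2)" using lam by (simp add: r')
    ultimately show "J \<psi> \<le> J \<phi>" by (rule order_trans[rotated])
  qed
qed

lemma set_dist_singleton: "set_dist \<psi> {\<phi>} = tv \<Omega> \<psi> \<phi>"
  by (simp add: set_dist_def)

text \<open>Add the growth inequalities of both minimizers, each tested with the other one: the
  entropies cancel, and replacing \<open>x\<close> by \<open>y\<close> changes each of the two
  remaining mean losses by at most \<open>diameter \<Omega> * r\<close>.\<close>

lemma sharp_minimizer_stable:
  assumes n: "1 \<le> n" and x: "x \<in> {..<n} \<rightarrow>\<^sub>E P2 \<Omega>" and y: "y \<in> {..<n} \<rightarrow>\<^sub>E P2 \<Omega>"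
    and phi: "has_sharp_minimizer lam (emp_risk n x) \<phi>" and psi: "has_sharp_minimizer lam (emp_risk n y) \<psi>"
    and r: "0 < r" "\<And>i. i < n \<Longrightarrow> W2 (x i) (y i) < r"
  shows "2 * lam * (tv \<Omega> \<phi> \<psi>)\<^sup>2 \<le> diameter \<Omega> * r"
proof -
  let ?F = "\<lambda>x \<phi>. (\<Sum>i<n. W2_loss \<phi> (x i)) / real n"
  have P: "\<phi> \<in> P2ac \<Omega>" "\<psi> \<in> P2ac \<Omega>" using phi psi by (auto simp: has_sharp_minimizer_def)
  have fin: "\<exists>a. neg_entropy \<Omega> \<zeta> = ereal a" if "\<bar>emp_risk n z \<zeta>\<bar> \<noteq> \<infinity>" for z \<zeta>
    using that lam by (cases "neg_entropy \<Omega> \<zeta>") (auto simp: emp_risk_def)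
  obtain a b where ab: "neg_entropy \<Omega> \<phi> = ereal a" "neg_entropy \<Omega> \<psi> = ereal b"
    using fin phi psi by (meson has_sharp_minimizer_def)
  have "emp_risk n x \<phi> + ereal (2 * lam * (tv \<Omega> \<psi> \<phi>)\<^sup>2) \<le> emp_risk n x \<psi>"
    using phi P by (auto simp: has_sharp_minimizer_def)
  then have 1: "?F x \<phi> + lam * a + 2 * lam * (tv \<Omega> \<phi> \<psi>)\<^sup>2 \<le> ?F x \<psi> + lam * b"
    by (simp add: emp_risk_def ab tv_commute[of \<psi> \<phi>])
  have "emp_risk n y \<psi> + ereal (2 * lam * (tv \<Omega> \<phi> \<psi>)\<^sup>2) \<le> emp_risk n y \<phi>"
    using psi P by (auto simp: has_sharp_minimizer_def)
  then have 2: "?F y \<psi> + lam * b + 2 * lam * (tv \<Omega> \<phi> \<psi>)\<^sup>2 \<le> ?F y \<phi> + lam * a"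
    by (simp add: emp_risk_def ab)
  have close: "\<bar>?F x \<zeta> - ?F y \<zeta>\<bar> \<le> diameter \<Omega> * r" if chi: "\<zeta> \<in> P2ac \<Omega>" for \<zeta>
  proof (rule abs_mean_diff_le)
    show "0 \<le> diameter \<Omega> * r" using diameter_nonneg r by simp
    fix i assume i: "i < n"
    have "\<bar>W2_loss \<zeta> (x i) - W2_loss \<zeta> (y i)\<bar> \<le> diameter \<Omega> * W2 (x i) (y i)"
      using x y i by (intro W2_loss_lipschitz P2ac_P2[OF chi]) (auto simp: PiE_iff)
    also have "\<dots> \<le> diameter \<Omega> * r" using r(2)[OF i] by (intro mult_left_mono diameter_nonneg) simp
    finally show "\<bar>W2_loss \<zeta> (x i) - W2_loss \<zeta> (y i)\<bar> \<le> diameter \<Omega> * r" .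
  qed
  show ?thesis using 1 2 close[OF P(1)] close[OF P(2)] by (simp add: abs_le_iff)
qed

definition selection :: "nat \<Rightarrow> (nat \<Rightarrow> (real ^ 'n) measure) \<Rightarrow> (real ^ 'n) measure" where
  "selection n x = (SOME \<phi>. has_sharp_minimizer lam (emp_risk n x) \<phi>)"

lemma selection:
  "x \<in> {..<n} \<rightarrow>\<^sub>E P2 \<Omega> \<Longrightarrow> has_sharp_minimizer lam (emp_risk n x) (selection n x)"
  unfolding selection_def by (rule someI_ex[OF ex_sharp_minimizer_emp_risk])

text \<open>By stability the selection is continuous in the maximum metric on samples, so preimages
  of open sets are open there and hence measurable by \<open>open_box_sets\<close>.\<close>

lemma selection_measurable:
  assumes n: "1 \<le> n"
  shows "selection n \<in> measurable (sample_law n) (metric_borel (P2ac \<Omega>) (tv \<Omega>))"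
  unfolding metric_borel_def
proof (rule measurable_measure_of)
  interpret tv: Metric_space "P2ac \<Omega>" "tv \<Omega>" by (rule tv_metric)
  show "{U. openin tv.mtopology U} \<subseteq> Pow (P2ac \<Omega>)" by (auto simp: tv.openin_mtopology)
  show "selection n \<in> space (sample_law n) \<rightarrow> P2ac \<Omega>"
    using selection by (auto simp: space_sample_law has_sharp_minimizer_def)
  fix U assume "U \<in> {U. openin tv.mtopology U}"
  then have U: "openin tv.mtopology U" by simp
  let ?V = "selection n -` U \<inter> space (sample_law n)"
  show "?V \<in> sets (sample_law n)"
    unfolding sample_law_def
  proof (rule W2.open_box_sets)
    show "selection n -` U \<inter> space (Pi\<^sub>M {..<n} (\<lambda>_. \<mu>)) \<subseteq> {..<n} \<rightarrow>\<^sub>E P2 \<Omega>"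
      using space_sample_law[of n] by (auto simp: sample_law_def)
    fix x assume "x \<in> selection n -` U \<inter> space (Pi\<^sub>M {..<n} (\<lambda>_. \<mu>))"
    then have x: "selection n x \<in> U" "x \<in> {..<n} \<rightarrow>\<^sub>E P2 \<Omega>"
      using space_sample_law[of n] by (auto simp: sample_law_def)
    obtain e where e: "0 < e" "tv.mball (selection n x) e \<subseteq> U"
      using U x(1) by (auto simp: tv.openin_mtopology)
    \<comment> \<open>Stability at this radius gives a squared total variation of at most
      \<open>e\<^sup>2 / 2\<close>, which is strictly below \<open>e\<^sup>2\<close>.\<close>
    define r where "r = lam * e\<^sup>2 / diameter \<Omega>"
    have r: "0 < r" using lam e(1) diameter_pos by (simp add: r_def)
    have "y \<in> selection n -` U \<inter> space (Pi\<^sub>M {..<n} (\<lambda>_. \<mu>))"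
      if y: "y \<in> {..<n} \<rightarrow>\<^sub>E P2 \<Omega>" and near: "\<forall>i<n. W2 (x i) (y i) < r" for y
    proof -
      have "2 * lam * (tv \<Omega> (selection n x) (selection n y))\<^sup>2 \<le> diameter \<Omega> * r"
        using near by (intro sharp_minimizer_stable[OF n x(2) y selection[OF x(2)] selection[OF y] r]) auto
      also have "\<dots> = lam * e\<^sup>2" using diameter_pos by (simp add: r_def)
      also have "\<dots> < 2 * lam * e\<^sup>2" using lam e(1) by simp
      finally have "(tv \<Omega> (selection n x) (selection n y))\<^sup>2 < e\<^sup>2" using lam by simp
      then have "tv \<Omega> (selection n x) (selection n y) < e" using e(1) by (simp add: power_less_imp_less_base)
      then have "selection n y \<in> U"
        using e(2) selection[OF x(2)] selection[OF y] by (auto simp: has_sharp_minimizer_def)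
      then show ?thesis using y space_sample_law[of n] by (auto simp: sample_law_def)
    qed
    then show "\<exists>r>0. \<forall>y\<in>{..<n} \<rightarrow>\<^sub>E P2 \<Omega>. (\<forall>i<n. W2 (x i) (y i) < r) \<longrightarrow>
        y \<in> selection n -` U \<inter> space (Pi\<^sub>M {..<n} (\<lambda>_. \<mu>))"
      using r by blast
  qed
qed

section \<open>Verification of the assumptions\<close>

lemma A1_holds: A1
  unfolding A1_def
proof (intro conjI allI impI)
  obtain \<phi> where phi: "has_sharp_minimizer lam risk \<phi>" using ex_sharp_minimizer_risk ..
  show "proper risk" "minimizers risk \<noteq> {}" using sharp_minimizer[OF phi] by auto
  fix n :: nat assume n: "1 \<le> n"
  show "AE x in sample_law n. proper (emp_risk n x) \<and> minimizers (emp_risk n x) \<noteq> {}"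
    using sharp_minimizer(1,3)[OF selection] by (intro AE_I2) (auto simp: space_sample_law)
  show "\<exists>T\<in>sample_law n \<rightarrow>\<^sub>M metric_borel (P2ac \<Omega>) (tv \<Omega>). AE x in sample_law n. T x \<in> minimizers (emp_risk n x)"
    using sharp_minimizer(1)[OF selection]
    by (intro bexI[OF _ selection_measurable[OF n]] AE_I2) (auto simp: space_sample_law)
qed

lemma A2_holds:
  assumes tau: "0 < \<tau>" "\<tau> \<le> 2 * lam"
  shows "A2 \<infinity> 2 \<tau>"
  unfolding A2_def
proof (intro conjI ballI impI)
  obtain \<phi> where phi: "has_sharp_minimizer lam risk \<phi>" using ex_sharp_minimizer_risk ..
  have "\<bar>risk \<phi>\<bar> \<noteq> \<infinity>" using phi by (simp add: has_sharp_minimizer_def)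
  then obtain r where r: "risk \<phi> = ereal r" by auto
  show "min_value risk < \<infinity>" using min_value_eq[OF phi] r by simp
  fix \<psi> assume psi: "\<psi> \<in> P2ac \<Omega>"
  have "\<tau> * (tv \<Omega> \<psi> \<phi>)\<^sup>2 \<le> 2 * lam * (tv \<Omega> \<psi> \<phi>)\<^sup>2" using tau by (intro mult_right_mono) auto
  then have "ereal (r + \<tau> * (tv \<Omega> \<psi> \<phi>)\<^sup>2) \<le> ereal (r + 2 * lam * (tv \<Omega> \<psi> \<phi>)\<^sup>2)" by simp
  also have "\<dots> \<le> risk \<psi>" using phi psi by (auto simp: has_sharp_minimizer_def r)
  finally have "ereal (\<tau> * (tv \<Omega> \<psi> \<phi>)\<^sup>2) \<le> risk \<psi> - ereal r"
    by (cases "risk \<psi>") auto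
  then show "ereal (\<tau> * set_dist \<psi> (minimizers risk) powr 2) \<le> risk \<psi> - min_value risk"
    using tv_nonneg[of \<psi> \<phi>] by (simp add: minimizers_eq[OF phi] min_value_eq[OF phi] set_dist_singleton r powr_numeral)
qed (use tau in auto)

lemma A3_holds: "A3 \<infinity> (\<lambda>_. 0)"
  unfolding A3_def by (simp add: prob_at_most_empty vanishing_rate_0)

text \<open>The growth around the minimizer for the sample \<open>x\<close> holds at every
  absolutely continuous measure, in particular at the minimizers for any other sample
  \<open>y\<close>.\<close>

lemma tau_hat_ge:
  assumes x: "x \<in> {..<n} \<rightarrow>\<^sub>E P2 \<Omega>"
  shows "ereal (2 * lam) \<le> tau_hat \<infinity> 2 n x"
  unfolding tau_hat_def
proof (intro INF_greatest)
  let ?J = "emp_risk n x"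
  note phi = selection[OF x]
  let ?\<phi> = "selection n x"
  have "\<bar>?J ?\<phi>\<bar> \<noteq> \<infinity>" using phi by (simp add: has_sharp_minimizer_def)
  then obtain r where r: "?J ?\<phi> = ereal r" by auto
  fix y \<psi> assume "\<psi> \<in> {\<psi> \<in> minimizers (emp_risk n y). risk \<psi> \<le> \<infinity> \<and> set_dist \<psi> (minimizers ?J) \<noteq> 0}"
  then have psi: "\<psi> \<in> P2ac \<Omega>" and d: "tv \<Omega> \<psi> ?\<phi> \<noteq> 0"
    by (auto simp: minimizers_eq[OF phi] set_dist_singleton) (auto simp: minimizers_def)
  have d: "0 < (tv \<Omega> \<psi> ?\<phi>)\<^sup>2" using d by simp
  have "ereal (r + 2 * lam * (tv \<Omega> \<psi> ?\<phi>)\<^sup>2) \<le> ?J \<psi>" using phi psi by (auto simp: has_sharp_minimizer_def r)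
  then have "ereal (2 * lam * (tv \<Omega> \<psi> ?\<phi>)\<^sup>2) \<le> ?J \<psi> - ereal r" by (cases "?J \<psi>") auto
  then have "ereal (2 * lam) \<le> (?J \<psi> - ereal r) / ereal ((tv \<Omega> \<psi> ?\<phi>)\<^sup>2)"
    using d by (cases "?J \<psi>") (auto simp: pos_le_divide_eq)
  then show "ereal (2 * lam) \<le> (?J \<psi> - min_value ?J) / ereal (set_dist \<psi> (minimizers ?J) powr 2)"
    using tv_nonneg[of \<psi> ?\<phi>] by (simp add: minimizers_eq[OF phi] min_value_eq[OF phi] set_dist_singleton r powr_numeral)
qed

lemma A4_holds:
  assumes tau: "\<tau> \<le> 2 * lam"
  shows "A4 \<infinity> 2 \<tau> (\<lambda>_. 0)"
  unfolding A4_def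
proof (intro conjI allI impI vanishing_rate_0)
  fix n :: nat
  have "ereal (\<tau> / 2) \<le> tau_hat \<infinity> 2 n x" if "x \<in> space (sample_law n)" for x
  proof -
    have "ereal (\<tau> / 2) \<le> ereal (2 * lam)" using tau lam by simp
    also have "\<dots> \<le> tau_hat \<infinity> 2 n x" using tau_hat_ge that by (simp add: space_sample_law)
    finally show ?thesis .
  qed
  then have empty: "{x \<in> space (sample_law n). tau_hat \<infinity> 2 n x < ereal (\<tau> / 2)} = {}" by (auto simp: not_less)
  show "prob_at_most (sample_law n) {x \<in> space (sample_law n). tau_hat \<infinity> 2 n x < ereal (\<tau> / 2)} 0"
    unfolding empty by (rule prob_at_most_empty)
qed

section \<open>The constant pseudometric: its norm and the Lipschitz condition on the loss\<close>

lemma const_pseudometric_measurable: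
  "(\<lambda>(x, y). const_pseudometric K x y) \<in> borel_measurable (\<mu> \<Otimes>\<^sub>M \<mu>)"
proof -
  let ?E = "{z \<in> space (\<mu> \<Otimes>\<^sub>M \<mu>). fst z \<noteq> snd z}"
  have "(\<lambda>z. K * indicator ?E z) \<in> borel_measurable (\<mu> \<Otimes>\<^sub>M \<mu>)"
    using W2.off_diagonal_sets by auto
  then show ?thesis
    by (rule measurable_cong[THEN iffD1, rotated]) (auto simp: const_pseudometric_def indicator_def)
qed

text \<open>Off the diagonal the exponential is \<open>exp (K / c)\<close>, on it 1, so its
  expectation is \<open>1 + (exp (K / c) - 1) * p\<close>. This is at most 2 exactly for
  \<open>c \<ge> K / ln (1 + 1 / p)\<close> when \<open>p\<close> is positive.\<close>

lemma pm_norm_const_pseudometric: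
  assumes K: "0 < K"
  defines "p \<equiv> measure (\<mu> \<Otimes>\<^sub>M \<mu>) {z \<in> space (\<mu> \<Otimes>\<^sub>M \<mu>). fst z \<noteq> snd z}"
  shows "pm_norm (const_pseudometric K) = ereal (if p = 0 then 0 else K / ln (1 + 1 / p))"
proof -
  interpret mm: pair_prob_space \<mu> \<mu> ..
  let ?E = "{z \<in> space (\<mu> \<Otimes>\<^sub>M \<mu>). fst z \<noteq> snd z}"
  have p: "0 \<le> p" "p \<le> 1" by (auto simp: p_def)
  have E: "?E \<in> sets (\<mu> \<Otimes>\<^sub>M \<mu>)" by (rule W2.off_diagonal_sets)
  have int: "(\<integral>\<^sup>+w. ennreal (exp (\<bar>case w of (x, y) \<Rightarrow> const_pseudometric K x y\<bar> / c)) \<partial>(\<mu> \<Otimes>\<^sub>M \<mu>))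
      = ennreal (1 + (exp (K / c) - 1) * p)" if c: "0 < c" for c
  proof -
    have k: "0 \<le> exp (K / c) - 1" using K c by simp
    have "(\<integral>\<^sup>+w. ennreal (exp (\<bar>case w of (x, y) \<Rightarrow> const_pseudometric K x y\<bar> / c)) \<partial>(\<mu> \<Otimes>\<^sub>M \<mu>))
        = (\<integral>\<^sup>+w. 1 + ennreal (exp (K / c) - 1) * indicator ?E w \<partial>(\<mu> \<Otimes>\<^sub>M \<mu>))"
    proof (rule nn_integral_cong)
      fix w assume w: "w \<in> space (\<mu> \<Otimes>\<^sub>M \<mu>)"
      have "1 + ennreal (exp (K / c) - 1) = ennreal (exp (K / c))"
        using k by (simp add: ennreal_plus[symmetric] ennreal_1[symmetric] del: ennreal_plus ennreal_1)
      then show "ennreal (exp (\<bar>case w of (x, y) \<Rightarrow> const_pseudometric K x y\<bar> / c))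
          = 1 + ennreal (exp (K / c) - 1) * indicator ?E w"
        using w K by (cases w) (auto simp: const_pseudometric_def)
    qed
    also have "\<dots> = 1 + ennreal (exp (K / c) - 1) * emeasure (\<mu> \<Otimes>\<^sub>M \<mu>) ?E"
      using E by (simp add: nn_integral_add nn_integral_cmult mm.emeasure_space_1)
    also have "\<dots> = ennreal (1 + (exp (K / c) - 1) * p)"
      using k p by (simp add: mm.emeasure_eq_measure p_def[symmetric] ennreal_mult)
    finally show ?thesis .
  qed
  have iff: "(\<integral>\<^sup>+w. ennreal (exp (\<bar>case w of (x, y) \<Rightarrow> const_pseudometric K x y\<bar> / c)) \<partial>(\<mu> \<Otimes>\<^sub>M \<mu>)) \<le> 2
      \<longleftrightarrow> (exp (K / c) - 1) * p \<le> 1" if c: "0 < c" for c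
  proof -
    have "ennreal (1 + (exp (K / c) - 1) * p) \<le> 2 \<longleftrightarrow> ennreal (1 + (exp (K / c) - 1) * p) \<le> ennreal 2" by simp
    also have "\<dots> \<longleftrightarrow> 1 + (exp (K / c) - 1) * p \<le> 2" by (rule ennreal_le_iff) simp
    finally show ?thesis unfolding int[OF c] by simp
  qed
  have norm: "pm_norm (const_pseudometric K) = (INF c\<in>{c. 0 < c \<and> (exp (K / c) - 1) * p \<le> 1}. ereal c)"
    unfolding pm_norm_def psi1_norm_def by (intro INF_cong refl Collect_cong conj_cong iff)
  show ?thesis
  proof (cases "p = 0")
    case True
    \<comment> \<open>If independent draws almost surely coincide, every positive \<open>c\<close>
      is admissible; the infimum is 0 without being attained.\<close>
    have "(INF c\<in>{0<..}. ereal c) = 0"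
    proof (rule antisym)
      show "(INF c\<in>{0<..}. ereal c) \<le> 0"
      proof (rule ereal_le_epsilon2)
        fix e :: real assume "0 < e"
        then show "(INF c\<in>{0<..}. ereal c) \<le> 0 + ereal e" by (intro INF_lower2[of e]) auto
      qed
      show "0 \<le> (INF c\<in>{0<..}. ereal c)" by (intro INF_greatest) auto
    qed
    then show ?thesis unfolding norm using True by (simp add: greaterThan_def)
  next
    case False
    then have p0: "0 < p" using p by simp
    define L where "L = ln (1 + 1 / p)"
    have L: "0 < L" unfolding L_def using p0 by (intro ln_gt_zero) simp
    have "{c. 0 < c \<and> (exp (K / c) - 1) * p \<le> 1} = {K / L..}"
    proof -
      have "(exp (K / c) - 1) * p \<le> 1 \<longleftrightarrow> K / L \<le> c" if c: "0 < c" for c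
      proof -
        have "(exp (K / c) - 1) * p \<le> 1 \<longleftrightarrow> exp (K / c) \<le> 1 + 1 / p" using p0 by (simp add: field_simps)
        also have "\<dots> \<longleftrightarrow> K / c \<le> L" using p0 ln_ge_iff[of "1 + 1 / p" "K / c"] by (simp add: L_def add_pos_pos)
        also have "\<dots> \<longleftrightarrow> K / L \<le> c" using c L by (simp add: field_simps)
        finally show ?thesis .
      qed
      moreover have "0 < c" if "K / L \<le> c" for c
        using less_le_trans[OF divide_pos_pos[OF K L] that] .
      ultimately show ?thesis by auto
    qed
    moreover have "(INF c\<in>{K / L..}. ereal c) = ereal (K / L)"
      by (intro antisym INF_lower INF_greatest) auto
    ultimately show ?thesis unfolding norm using False by (simp add: L_def)
  qed
qed

text \<open>The two loss differences, at \<open>x\<close> and at \<open>y\<close>, each contribute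
  half the squared diameter times \<open>tv\<close>. For \<open>x = y\<close> they cancel exactly,
  matching the zero of the pseudometric on the diagonal. With \<open>\<Upsilon>\<close> the whole
  model space, no minimizer can leave it.\<close>

lemma A5_holds:
  assumes K: "(diameter \<Omega>)\<^sup>2 \<le> K"
  shows "A5 1 (const_pseudometric K) (\<lambda>_. 0)"
  unfolding A5_def
proof (intro conjI vanishing_rate_0 const_pseudometric_measurable)
  have D: "0 < (diameter \<Omega>)\<^sup>2" using diameter_pos by simp
  then have K0: "0 < K" using K by (rule less_le_trans)
  show "pseudometric_on (P2 \<Omega>) (const_pseudometric K)"
    using K0 by (auto simp: pseudometric_on_def const_pseudometric_def)
  show "pm_norm (const_pseudometric K) < \<infinity>" by (simp add: pm_norm_const_pseudometric[OF K0])
  show "\<exists>\<Upsilon>\<subseteq>P2ac \<Omega>. minimizers risk \<subseteq> \<Upsilon> \<and>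
      (\<forall>\<phi>\<in>\<Upsilon>. \<forall>\<psi>\<in>\<Upsilon>. AE x in \<mu>. AE y in \<mu>.
         W2_loss \<phi> x - W2_loss \<psi> x - W2_loss \<phi> y + W2_loss \<psi> y \<le> const_pseudometric K x y * tv \<Omega> \<phi> \<psi> powr 1) \<and>
      (\<forall>n\<ge>1. prob_at_most (sample_law n) {x \<in> space (sample_law n). \<not> minimizers (emp_risk n x) \<subseteq> \<Upsilon>} 0)"
  proof (intro exI[of _ "P2ac \<Omega>"] conjI ballI allI impI)
    show "P2ac \<Omega> \<subseteq> P2ac \<Omega>" "minimizers risk \<subseteq> P2ac \<Omega>" by (auto simp: minimizers_def)
    have empty: "{x \<in> space (sample_law n). \<not> minimizers (emp_risk n x) \<subseteq> P2ac \<Omega>} = {}" for n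
      by (auto simp: minimizers_def)
    show "prob_at_most (sample_law n) {x \<in> space (sample_law n). \<not> minimizers (emp_risk n x) \<subseteq> P2ac \<Omega>} 0" for n
      unfolding empty by (rule prob_at_most_empty)
    fix \<phi> \<psi> assume phi: "\<phi> \<in> P2ac \<Omega>" and psi: "\<psi> \<in> P2ac \<Omega>"
    have "W2_loss \<phi> x - W2_loss \<psi> x - W2_loss \<phi> y + W2_loss \<psi> y \<le> const_pseudometric K x y * tv \<Omega> \<phi> \<psi> powr 1"
      if "x \<in> P2 \<Omega>" "y \<in> P2 \<Omega>" for x y
    proof (cases "x = y")
      case False
      have "W2_loss \<phi> x - W2_loss \<psi> x - W2_loss \<phi> y + W2_loss \<psi> y
          \<le> (diameter \<Omega>)\<^sup>2 / 2 * tv \<Omega> \<phi> \<psi> + (diameter \<Omega>)\<^sup>2 / 2 * tv \<Omega> \<phi> \<psi>"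
        using W2_loss_tv[OF phi psi that(1)] W2_loss_tv[OF phi psi that(2)] unfolding abs_le_iff by linarith
      also have "\<dots> = (diameter \<Omega>)\<^sup>2 * tv \<Omega> \<phi> \<psi>" by simp
      also have "\<dots> \<le> K * tv \<Omega> \<phi> \<psi>" by (intro mult_right_mono K tv_nonneg)
      finally show ?thesis using False tv_nonneg[of \<phi> \<psi>] by (simp add: const_pseudometric_def)
    qed (simp add: const_pseudometric_def)
    then show "AE x in \<mu>. AE y in \<mu>. W2_loss \<phi> x - W2_loss \<psi> x - W2_loss \<phi> y + W2_loss \<psi> y
        \<le> const_pseudometric K x y * tv \<Omega> \<phi> \<psi> powr 1"
      by (intro AE_I2) (simp add: W2.space_M)
  qed
qed simp

lemma assumptions_hold:
  assumes "0 < \<tau>" "\<tau> \<le> 2 * lam" "(diameter \<Omega>)\<^sup>2 \<le> K"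
  shows "assumptions \<infinity> 2 \<tau> 1 (const_pseudometric K) (\<lambda>_. 0) (\<lambda>_. 0) (\<lambda>_. 0)"
  unfolding assumptions_def using assms by (intro conjI A1_holds A2_holds A3_holds A4_holds A5_holds)

end

text \<open>The norm depends on the probability \<open>p\<close> that two independent draws differ:
  with factor \<open>4 * (diameter \<Omega>)\<^sup>2\<close> it equals that number only for
  \<open>p = 1 / (exp 1 - 1)\<close>. Rescaling by \<open>ln 2\<close> brings it below that number
  for every \<open>p\<close>, and A5 persists since it holds for all constants from
  \<open>(diameter \<Omega>)\<^sup>2\<close> on.\<close>

theorem lemma28:
  fixes \<Omega> :: "(real ^ 'n) set" and lam :: real and \<mu> :: "(real ^ 'n) measure measure"
  assumes "bounded \<Omega>" and "\<Omega> \<in> sets lebesgue" and "0 < emeasure lebesgue \<Omega>"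
    and "0 < lam"
    and "prob_space \<mu>" and "sets \<mu> = sets (metric_borel (P2 \<Omega>) W2)"
  shows
    "barycenter_assumptions \<Omega> lam \<mu>
       \<infinity> 2 (2 * lam) 1 (const_pseudometric (4 * (diameter \<Omega>)\<^sup>2)) (\<lambda>_. 0) (\<lambda>_. 0) (\<lambda>_. 0) \<and>
     (1 \<le> lam \<longrightarrow> barycenter_assumptions \<Omega> lam \<mu>
       \<infinity> 2 2 1 (const_pseudometric (4 * (diameter \<Omega>)\<^sup>2)) (\<lambda>_. 0) (\<lambda>_. 0) (\<lambda>_. 0)) \<and>
     (let p = measure (\<mu> \<Otimes>\<^sub>M \<mu>) {z \<in> space (\<mu> \<Otimes>\<^sub>M \<mu>). fst z \<noteq> snd z} in
      risk_minimization.pm_norm \<mu> (const_pseudometric (4 * (diameter \<Omega>)\<^sup>2)) =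
        ereal (if p = 0 then 0 else 4 * (diameter \<Omega>)\<^sup>2 / ln (1 + 1 / p))) \<and>
     barycenter_A5 \<Omega> lam \<mu> 1 (const_pseudometric (4 * ln 2 * (diameter \<Omega>)\<^sup>2)) (\<lambda>_. 0) \<and>
     risk_minimization.pm_norm \<mu> (const_pseudometric (4 * ln 2 * (diameter \<Omega>)\<^sup>2))
       \<le> ereal (4 * (diameter \<Omega>)\<^sup>2)"
proof -
  interpret barycenter \<Omega> lam \<mu>
    using assms by (intro barycenter.intro entropic_domain.intro bounded_domain.intro
        entropic_domain_axioms.intro barycenter_axioms.intro)
  interpret mm: pair_prob_space \<mu> \<mu> ..
  let ?D = "(diameter \<Omega>)\<^sup>2"
  let ?p = "measure (\<mu> \<Otimes>\<^sub>M \<mu>) {z \<in> space (\<mu> \<Otimes>\<^sub>M \<mu>). fst z \<noteq> snd z}"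
  have D: "0 < ?D" using diameter_pos by simp
  \<comment> \<open>Ensures that the rescaled constant \<open>4 * ln 2 * ?D\<close> is still at
    least \<open>?D\<close>, the threshold of \<open>A5_holds\<close>.\<close>
  have "1 / 4 \<le> ln (2 :: real)" using ln2_ge_two_thirds by simp
  then have "1 / 4 * (4 * ?D) \<le> ln 2 * (4 * ?D)" using D by (intro mult_right_mono) auto
  then have K: "?D \<le> 4 * ln 2 * ?D" by (simp add: mult.commute mult.left_commute)
  have "pm_norm (const_pseudometric (4 * ln 2 * ?D)) \<le> ereal (4 * ?D)"
  proof (cases "?p = 0")
    case False
    then have p: "0 < ?p" "?p \<le> 1" using zero_less_measure_iff by auto
    \<comment> \<open>As \<open>?p\<close> is at most 1, the worst case is \<open>?p = 1\<close>,
      where draws almost surely differ; there the factor \<open>ln 2\<close> is cancelled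
      exactly.\<close>
    have "ln 2 \<le> ln (1 + 1 / ?p)" using p by (subst ln_le_cancel_iff) (auto simp: add_pos_pos)
    then have "4 * ln 2 * ?D / ln (1 + 1 / ?p) \<le> 4 * ln 2 * ?D / ln 2"
      using D p by (intro divide_left_mono mult_pos_pos) (auto intro: less_le_trans[of 0 "ln 2"])
    then show ?thesis using D False by (simp add: pm_norm_const_pseudometric)
  qed (use D in \<open>simp add: pm_norm_const_pseudometric\<close>)
  then show ?thesis
    using assumptions_hold[of "2 * lam" "4 * ?D"] assumptions_hold[of 2 "4 * ?D"] A5_holds[OF K]
      pm_norm_const_pseudometric[of "4 * ?D"] lam D
    by (simp add: Let_def)
qed

end
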